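(* The commutator ideal of $C^*(z)$ is the $C^*$-algebra $\mathcal{K}$ of all compact operators on $H$.
   Context: Fix real numbers $a, r_1, r_2$ with $r_1, r_2 > 0$, $0<a<1$, $a+r_2<1$ and $r_1+r_2<a$. The closed pair of pants is $$PP_{(a,r_1,r_2)} = \{\zeta\in\mathbb{C} : |\zeta|\le 1,\ |\zeta|\ge r_1,\ |\zeta-a|\ge r_2\}.$$ Define functions $E_n(\zeta)=\zeta^n$ for $n\ge 0$, and $F_n(\zeta)=(\zeta/r_1)^n$, $G_n(\zeta)=((\zeta-a)/r_2)^n$ for $n\le -1$. Let $H$ be the Hilbert space of holomorphic functions on the interior of $PP_{(a,r_1,r_2)}$ of the form $$\varphi=\sum_{n=0}^\infty e_nE_n+\sum_{n=-\infty}^{-1}(f_nF_n+g_nG_n),\qquad \|\varphi\|^2=\sum_{n=0}^\infty|e_n|^2+\sum_{n=-\infty}^{-1}(|f_n|^2+|g_n|^2)<\infty,$$ so that $\{E_n\}_{n\ge0}\cup\{F_n\}_{n\le-1}\cup\{G_n\}_{n\le-1}$ is an orthonormal basis of $H$. The operator $z:H\to H$ is multiplication by the coordinate: $(z\varphi)(\zeta)=\zeta\varphi(\zeta)$. Equivalently, $zE_n=E_{n+1}$ for $n\ge0$; $zF_n=r_1F_{n+1}$ for $n\le-2$, $zF_{-1}=r_1E_0$; $zG_n=r_2G_{n+1}+aG_n$ for $n\le-2$, $zG_{-1}=r_2E_0+aG_{-1}$. $C^*(z)$ denotes the $C^*$-algebra of bounded operators on $H$ generated by $z$. Its commutator ideal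 is the closed two-sided ideal generated by all commutators of elements of $C^*(z)$ (equivalently, since $C^*(z)$ is singly generated, the closed two-sided ideal generated by $[z^*,z]=z^*z-zz^*$). *)

theory Defs
  imports "HOL-Complex_Analysis.Complex_Analysis" "HOL-Library.FuncSet"
begin

section \<open>Bounded operators on a Hilbert space of complex-valued functions\<close>

text \<open>
  A Hilbert space of complex-valued functions is given by its carrier \<open>H\<close> (a linear subspace of
  \<open>'x \<Rightarrow> complex\<close> with the pointwise operations) and its inner product \<open>ip\<close>, linear in the first
  argument. Only the values of \<open>ip\<close> on \<open>H\<close> matter. The carrier cannot be a type here, because it
  depends on real parameters.

  An operator on \<open>H\<close> is a function that is \<open>undefined\<close> outside \<open>H\<close>, so that equality of operators
  is equality on \<open>H\<close>; all the operations below restrict their results to \<open>H\<close> accordingly.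
\<close>

type_synonym 'x op = "('x \<Rightarrow> complex) \<Rightarrow> ('x \<Rightarrow> complex)"
type_synonym 'x ip = "('x \<Rightarrow> complex) \<Rightarrow> ('x \<Rightarrow> complex) \<Rightarrow> complex"

definition hnorm :: "'x ip \<Rightarrow> ('x \<Rightarrow> complex) \<Rightarrow> real" where
  "hnorm ip \<phi> = sqrt (Re (ip \<phi> \<phi>))"

definition bounded_ops :: "('x \<Rightarrow> complex) set \<Rightarrow> 'x ip \<Rightarrow> 'x op set" where
  "bounded_ops H ip = {T \<in> H \<rightarrow>\<^sub>E H.
     (\<forall>\<phi>\<in>H. \<forall>\<psi>\<in>H. T (\<lambda>x. \<phi> x + \<psi> x) = (\<lambda>x. T \<phi> x + T \<psi> x)) \<and>
     (\<forall>c. \<forall>\<phi>\<in>H. T (\<lambda>x. c * \<phi> x) = (\<lambda>x. c * T \<phi> x)) \<and>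
     (\<exists>B. \<forall>\<phi>\<in>H. hnorm ip (T \<phi>) \<le> B * hnorm ip \<phi>)}"

definition op_zero :: "('x \<Rightarrow> complex) set \<Rightarrow> 'x op" where
  "op_zero H = (\<lambda>\<phi>\<in>H. \<lambda>x. 0)"

definition op_add :: "('x \<Rightarrow> complex) set \<Rightarrow> 'x op \<Rightarrow> 'x op \<Rightarrow> 'x op" where
  "op_add H S T = (\<lambda>\<phi>\<in>H. \<lambda>x. S \<phi> x + T \<phi> x)"

definition op_diff :: "('x \<Rightarrow> complex) set \<Rightarrow> 'x op \<Rightarrow> 'x op \<Rightarrow> 'x op" where
  "op_diff H S T = (\<lambda>\<phi>\<in>H. \<lambda>x. S \<phi> x - T \<phi> x)"

definition op_scale :: "('x \<Rightarrow> complex) set \<Rightarrow> complex \<Rightarrow> 'x op \<Rightarrow> 'x op" where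
  "op_scale H c T = (\<lambda>\<phi>\<in>H. \<lambda>x. c * T \<phi> x)"

definition op_adj :: "('x \<Rightarrow> complex) set \<Rightarrow> 'x ip \<Rightarrow> 'x op \<Rightarrow> 'x op" where
  "op_adj H ip T = (THE S. S \<in> bounded_ops H ip \<and>
     (\<forall>\<phi>\<in>H. \<forall>\<psi>\<in>H. ip (T \<phi>) \<psi> = ip \<phi> (S \<psi>)))"

definition op_norm :: "('x \<Rightarrow> complex) set \<Rightarrow> 'x ip \<Rightarrow> 'x op \<Rightarrow> real" where
  "op_norm H ip T = (SUP \<phi>\<in>{\<phi>\<in>H. hnorm ip \<phi> \<le> 1}. hnorm ip (T \<phi>))"

definition op_norm_closed :: "('x \<Rightarrow> complex) set \<Rightarrow> 'x ip \<Rightarrow> 'x op set \<Rightarrow> bool" where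
  "op_norm_closed H ip A \<longleftrightarrow>
     (\<forall>T L. (\<forall>k::nat. T k \<in> A) \<and> L \<in> bounded_ops H ip \<and>
            (\<lambda>k. op_norm H ip (op_diff H (T k) L)) \<longlonglongrightarrow> 0 \<longrightarrow> L \<in> A)"

definition op_subspace :: "('x \<Rightarrow> complex) set \<Rightarrow> 'x op set \<Rightarrow> bool" where
  "op_subspace H A \<longleftrightarrow> op_zero H \<in> A \<and> (\<forall>S\<in>A. \<forall>T\<in>A. op_add H S T \<in> A) \<and>
     (\<forall>c. \<forall>T\<in>A. op_scale H c T \<in> A)"

text \<open>A concrete C*-algebra of operators; it is not required to contain the identity.\<close>

definition cstar_subalgebra :: "('x \<Rightarrow> complex) set \<Rightarrow> 'x ip \<Rightarrow> 'x op set \<Rightarrow> bool" where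
  "cstar_subalgebra H ip A \<longleftrightarrow> A \<subseteq> bounded_ops H ip \<and> op_subspace H A \<and>
     (\<forall>S\<in>A. \<forall>T\<in>A. compose H S T \<in> A) \<and> (\<forall>T\<in>A. op_adj H ip T \<in> A) \<and>
     op_norm_closed H ip A"

definition cstar_generated :: "('x \<Rightarrow> complex) set \<Rightarrow> 'x ip \<Rightarrow> 'x op \<Rightarrow> 'x op set" where
  "cstar_generated H ip T = \<Inter>{A. cstar_subalgebra H ip A \<and> T \<in> A}"

definition closed_ideal :: "('x \<Rightarrow> complex) set \<Rightarrow> 'x ip \<Rightarrow> 'x op set \<Rightarrow> 'x op set \<Rightarrow> bool" where
  "closed_ideal H ip A J \<longleftrightarrow> J \<subseteq> A \<and> op_subspace H J \<and>
     (\<forall>T\<in>A. \<forall>S\<in>J. compose H T S \<in> J \<and> compose H S T \<in> J) \<and> op_norm_closed H ip J"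

definition commutator_ideal :: "('x \<Rightarrow> complex) set \<Rightarrow> 'x ip \<Rightarrow> 'x op set \<Rightarrow> 'x op set" where
  "commutator_ideal H ip A = \<Inter>{J. closed_ideal H ip A J \<and>
     (\<forall>S\<in>A. \<forall>T\<in>A. op_diff H (compose H S T) (compose H T S) \<in> J)}"

definition compact_ops :: "('x \<Rightarrow> complex) set \<Rightarrow> 'x ip \<Rightarrow> 'x op set" where
  "compact_ops H ip = {T \<in> bounded_ops H ip.
     \<forall>\<phi>. (\<forall>k::nat. \<phi> k \<in> H) \<and> (\<exists>B. \<forall>k. hnorm ip (\<phi> k) \<le> B) \<longrightarrow>
       (\<exists>r \<psi>. strict_mono r \<and> \<psi> \<in> H \<and>
          (\<lambda>k. hnorm ip (\<lambda>x. T (\<phi> (r k)) x - \<psi> x)) \<longlonglongrightarrow> 0)}"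


section \<open>The pair of pants and its Hilbert space\<close>

definition pants :: "real \<Rightarrow> real \<Rightarrow> real \<Rightarrow> complex set" where
  "pants a r1 r2 = {\<zeta>. cmod \<zeta> \<le> 1 \<and> cmod \<zeta> \<ge> r1 \<and> cmod (\<zeta> - of_real a) \<ge> r2}"

datatype pants_index = E_ix nat | F_ix int | G_ix int

definition pants_indices :: "pants_index set" where
  "pants_indices = range E_ix \<union> F_ix ` {..-1} \<union> G_ix ` {..-1}"

fun pants_basis :: "real \<Rightarrow> real \<Rightarrow> real \<Rightarrow> pants_index \<Rightarrow> complex \<Rightarrow> complex" where
  "pants_basis a r1 r2 (E_ix n) \<zeta> = \<zeta> ^ n"
| "pants_basis a r1 r2 (F_ix n) \<zeta> = (\<zeta> / of_real r1) powi n"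
| "pants_basis a r1 r2 (G_ix n) \<zeta> = ((\<zeta> - of_real a) / of_real r2) powi n"

text \<open>
  \<open>c\<close> is the family of coefficients \<open>e\<^sub>n, f\<^sub>n, g\<^sub>n\<close> of \<open>\<phi>\<close>. In the interior of the pants the series
  converges absolutely for every square-summable \<open>c\<close>, so the unordered sum over all indices is the
  sum of the three series. The values of \<open>c\<close> outside the index set are normalised to 0 to make \<open>c\<close>
  unique.
\<close>

definition pants_expansion ::
  "real \<Rightarrow> real \<Rightarrow> real \<Rightarrow> (complex \<Rightarrow> complex) \<Rightarrow> (pants_index \<Rightarrow> complex) \<Rightarrow> bool" where
  "pants_expansion a r1 r2 \<phi> c \<longleftrightarrow>
     (\<forall>i. i \<notin> pants_indices \<longrightarrow> c i = 0) \<and>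
     (\<lambda>i. (cmod (c i))\<^sup>2) summable_on pants_indices \<and>
     (\<forall>\<zeta>\<in>interior (pants a r1 r2).
        ((\<lambda>i. c i * pants_basis a r1 r2 i \<zeta>) has_sum \<phi> \<zeta>) pants_indices)"

text \<open>
  Functions on the interior of the pants are represented by functions on the plane vanishing
  outside of it.
\<close>

definition pants_H :: "real \<Rightarrow> real \<Rightarrow> real \<Rightarrow> (complex \<Rightarrow> complex) set" where
  "pants_H a r1 r2 = {\<phi>. \<phi> holomorphic_on interior (pants a r1 r2) \<and>
     (\<forall>\<zeta>. \<zeta> \<notin> interior (pants a r1 r2) \<longrightarrow> \<phi> \<zeta> = 0) \<and>
     (\<exists>c. pants_expansion a r1 r2 \<phi> c)}"

definition pants_coeff :: "real \<Rightarrow> real \<Rightarrow> real \<Rightarrow> (complex \<Rightarrow> complex) \<Rightarrow> pants_index \<Rightarrow> complex" where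
  "pants_coeff a r1 r2 \<phi> = (THE c. pants_expansion a r1 r2 \<phi> c)"

text \<open>
  The inner product whose norm satisfies
  \<open>(hnorm \<phi>)\<^sup>2 = \<Sum>|e\<^sub>n|\<^sup>2 + \<Sum>(|f\<^sub>n|\<^sup>2 + |g\<^sub>n|\<^sup>2)\<close>.
\<close>

definition pants_ip :: "real \<Rightarrow> real \<Rightarrow> real \<Rightarrow> complex ip" where
  "pants_ip a r1 r2 \<phi> \<psi> =
     (\<Sum>\<^sub>\<infinity>i\<in>pants_indices. pants_coeff a r1 r2 \<phi> i * cnj (pants_coeff a r1 r2 \<psi> i))"

definition pants_z :: "real \<Rightarrow> real \<Rightarrow> real \<Rightarrow> complex op" where
  "pants_z a r1 r2 = (\<lambda>\<phi>\<in>pants_H a r1 r2. \<lambda>\<zeta>. \<zeta> * \<phi> \<zeta>)"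

end

theory Submission imports Defs begin

text \<open>
  Write \<open>F\<^sub>n\<close>, \<open>G\<^sub>n\<close> for the basis vectors of index \<open>- 1 - n\<close>. The self-commutator \<open>D = [z*, z]\<close> vanishes
  on all basis vectors except \<open>E\<^sub>0\<close>, \<open>F\<^sub>0\<close>, \<open>G\<^sub>0\<close>, so it has finite rank, \<open>z\<close> and \<open>z*\<close> commute modulo the
  compact operators, and hence so do any two elements of \<open>C*(z)\<close>. Conversely, the operator
  \<open>D (z\<^sup>2 - a z) D\<close> in the commutator ideal is a nonzero multiple of the rank one operator
  \<open>(D E\<^sub>0) \<otimes> (D F\<^sub>0)*\<close>. Multiplying it by \<open>z\<close> and \<open>z*\<close> from both sides yields all matrix units, and every
  compact operator is a norm limit of combinations of these.

  The coefficients of a function on the pants are unique because the principal part at a hole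
  extends to an entire function vanishing at infinity; so the Hilbert space is \<open>l\<^sup>2\<close> of the index set.
\<close>

section \<open>Inner product spaces of functions\<close>

text \<open>The self-commutator has rank three, so by itself it isolates no rank one operator; the
  usual way on would be irreducibility of \<open>C*(z)\<close> together with spectral projections.
  The factor z^2 - a z = z (z - a) replaces both. On the three vectors carried by \<open>D\<close>,
  z - a sends \<open>G 0\<close> to r2 \<open>E 0\<close>, and the second z moves this to
  \<open>E 1\<close>, which \<open>D\<close> kills; \<open>E 0\<close> also leaves the span; only
  the part - a \<open>F 0\<close> of (z - a) \<open>F 0\<close> comes back, as - a r1
  \<open>E 0\<close>. One matrix entry survives, and the rest is explicit linear algebra in which a,
  r1, r2 and 1 - r1^2 - r2^2 are the pivots.

  The Hilbert space is a set of functions rather than a type, so adjoints, compactness and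
  C*-algebras are rebuilt in coordinates. Parseval and Riesz-Fischer stand in for completeness, and
  compactness of T becomes uniform smallness of the coordinate tails of T \<phi>, a condition that
  passes to sums and norm limits without choosing subsequences.\<close>

locale fun_inner_product =
  fixes H :: "('x \<Rightarrow> complex) set" and ip :: "'x ip"
  assumes zero_mem: "(\<lambda>x. 0) \<in> H"
    and add_mem: "\<phi> \<in> H \<Longrightarrow> \<psi> \<in> H \<Longrightarrow> (\<lambda>x. \<phi> x + \<psi> x) \<in> H"
    and scale_mem: "\<phi> \<in> H \<Longrightarrow> (\<lambda>x. c * \<phi> x) \<in> H"
    and ip_add_left: "\<phi> \<in> H \<Longrightarrow> \<psi> \<in> H \<Longrightarrow> \<eta> \<in> H \<Longrightarrow> ip (\<lambda>x. \<phi> x + \<psi> x) \<eta> = ip \<phi> \<eta> + ip \<psi> \<eta>"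
    and ip_scale_left: "\<phi> \<in> H \<Longrightarrow> \<eta> \<in> H \<Longrightarrow> ip (\<lambda>x. c * \<phi> x) \<eta> = c * ip \<phi> \<eta>"
    and ip_commute: "\<phi> \<in> H \<Longrightarrow> \<eta> \<in> H \<Longrightarrow> ip \<phi> \<eta> = cnj (ip \<eta> \<phi>)"
    and ip_ge_0: "\<phi> \<in> H \<Longrightarrow> Re (ip \<phi> \<phi>) \<ge> 0"
    and ip_eq_0: "\<phi> \<in> H \<Longrightarrow> ip \<phi> \<phi> = 0 \<Longrightarrow> \<phi> = (\<lambda>x. 0)"
begin

abbreviation N :: "('x \<Rightarrow> complex) \<Rightarrow> real" where "N \<equiv> hnorm ip"

lemma diff_mem: "\<phi> \<in> H \<Longrightarrow> \<psi> \<in> H \<Longrightarrow> (\<lambda>x. \<phi> x - \<psi> x) \<in> H"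
  using add_mem[of \<phi> "\<lambda>x. (-1) * \<psi> x"] scale_mem[of \<psi> "-1"] by simp

lemmas mem_intros = zero_mem add_mem scale_mem diff_mem

lemma sum_mem: "(\<And>i. i \<in> A \<Longrightarrow> f i \<in> H) \<Longrightarrow> (\<lambda>x. \<Sum>i\<in>A. f i x) \<in> H"
  by (induction A rule: infinite_finite_induct) (auto intro: mem_intros)

lemma ip_diff_left:
  "\<phi> \<in> H \<Longrightarrow> \<psi> \<in> H \<Longrightarrow> \<eta> \<in> H \<Longrightarrow> ip (\<lambda>x. \<phi> x - \<psi> x) \<eta> = ip \<phi> \<eta> - ip \<psi> \<eta>"
  using ip_add_left[of \<phi> "\<lambda>x. (-1) * \<psi> x" \<eta>] ip_scale_left[of \<psi> \<eta> "-1"] scale_mem[of \<psi> "-1"]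
  by simp

lemma ip_add_right:
  "\<phi> \<in> H \<Longrightarrow> \<psi> \<in> H \<Longrightarrow> \<eta> \<in> H \<Longrightarrow> ip \<eta> (\<lambda>x. \<phi> x + \<psi> x) = ip \<eta> \<phi> + ip \<eta> \<psi>"
  by (subst (1 2 3) ip_commute) (auto simp: ip_add_left intro: mem_intros)

lemma ip_diff_right:
  "\<phi> \<in> H \<Longrightarrow> \<psi> \<in> H \<Longrightarrow> \<eta> \<in> H \<Longrightarrow> ip \<eta> (\<lambda>x. \<phi> x - \<psi> x) = ip \<eta> \<phi> - ip \<eta> \<psi>"
  by (subst (1 2 3) ip_commute) (auto simp: ip_diff_left intro: mem_intros)

lemma ip_scale_right: "\<phi> \<in> H \<Longrightarrow> \<eta> \<in> H \<Longrightarrow> ip \<eta> (\<lambda>x. c * \<phi> x) = cnj c * ip \<eta> \<phi>"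
  by (subst (1 2) ip_commute) (auto simp: ip_scale_left intro: mem_intros)

lemma ip_zero_left: "\<eta> \<in> H \<Longrightarrow> ip (\<lambda>x. 0) \<eta> = 0"
  using ip_scale_left[OF zero_mem, of \<eta> 0] by simp

lemma ip_zero_right: "\<eta> \<in> H \<Longrightarrow> ip \<eta> (\<lambda>x. 0) = 0"
  using ip_scale_right[OF zero_mem, of \<eta> 0] by simp

lemmas ip_simps = ip_add_left ip_add_right ip_diff_left ip_diff_right ip_scale_left ip_scale_right
  ip_zero_left ip_zero_right

lemma ip_sum_left:
  "(\<And>i. i \<in> A \<Longrightarrow> f i \<in> H) \<Longrightarrow> \<eta> \<in> H \<Longrightarrow> ip (\<lambda>x. \<Sum>i\<in>A. f i x) \<eta> = (\<Sum>i\<in>A. ip (f i) \<eta>)"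
proof (induction A rule: infinite_finite_induct)
  case (insert a A)
  then show ?case by (simp add: ip_add_left sum_mem)
qed (auto simp: ip_zero_left)

lemma ip_self: "\<phi> \<in> H \<Longrightarrow> ip \<phi> \<phi> = of_real ((N \<phi>)\<^sup>2)"
  using ip_commute[of \<phi> \<phi>] ip_ge_0[of \<phi>] by (simp add: complex_eq_iff hnorm_def)

lemma norm_nonneg: "\<phi> \<in> H \<Longrightarrow> N \<phi> \<ge> 0"
  by (simp add: hnorm_def ip_ge_0)

lemma norm_sq: "\<phi> \<in> H \<Longrightarrow> (N \<phi>)\<^sup>2 = Re (ip \<phi> \<phi>)"
  by (simp add: hnorm_def ip_ge_0)

lemma norm_eq_0: "\<phi> \<in> H \<Longrightarrow> N \<phi> = 0 \<Longrightarrow> \<phi> = (\<lambda>x. 0)"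
  using ip_self ip_eq_0 by simp

lemma norm_zero: "N (\<lambda>x. 0) = 0"
  by (simp add: hnorm_def ip_zero_left zero_mem)

lemma norm_scale: "\<phi> \<in> H \<Longrightarrow> N (\<lambda>x. c * \<phi> x) = cmod c * N \<phi>"
proof -
  assume \<phi>: "\<phi> \<in> H"
  have "(N (\<lambda>x. c * \<phi> x))\<^sup>2 = Re (c * (cnj c * ip \<phi> \<phi>))"
    using \<phi> by (simp add: norm_sq scale_mem ip_simps)
  also have "\<dots> = (cmod c * N \<phi>)\<^sup>2"
    using \<phi> by (simp add: ip_self power_mult_distrib mult.assoc[symmetric] complex_norm_square[symmetric]
        del: of_real_power flip: of_real_mult of_real_power)
  finally show ?thesis
    using norm_nonneg[OF \<phi>] norm_nonneg[OF scale_mem[OF \<phi>]]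
    by (simp add: power2_eq_iff_nonneg)
qed

lemma norm_sub_commute:
  "\<phi> \<in> H \<Longrightarrow> \<psi> \<in> H \<Longrightarrow> N (\<lambda>x. \<phi> x - \<psi> x) = N (\<lambda>x. \<psi> x - \<phi> x)"
  using norm_scale[OF diff_mem[of \<phi> \<psi>], of "-1"] by simp

lemma norm_ip:
  assumes "\<phi> \<in> H" "\<psi> \<in> H" shows "cmod (ip \<phi> \<psi>) \<le> N \<phi> * N \<psi>"
proof (cases "N \<psi> = 0")
  case True
  then show ?thesis using assms norm_eq_0[of \<psi>] by (simp add: ip_zero_right)
next
  case False
  \<comment> \<open>The coefficient of the orthogonal projection of \<phi> onto \<psi>, so that the
    squared norm of the residual is |\<phi>|^2 - |<\<phi>, \<psi>>|^2 / |\<psi>|^2.\<close>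
  define t where "t = ip \<phi> \<psi> / of_real ((N \<psi>)\<^sup>2)"
  have *: "ip \<psi> \<phi> = cnj (ip \<phi> \<psi>)" using assms by (rule ip_commute[rotated])
  have "0 \<le> Re (ip (\<lambda>x. \<phi> x - t * \<psi> x) (\<lambda>x. \<phi> x - t * \<psi> x))"
    using assms by (intro ip_ge_0 mem_intros)
  also have "ip (\<lambda>x. \<phi> x - t * \<psi> x) (\<lambda>x. \<phi> x - t * \<psi> x)
      = of_real ((N \<phi>)\<^sup>2) - of_real ((cmod (ip \<phi> \<psi>))\<^sup>2 / (N \<psi>)\<^sup>2)"
  proof -
    have "ip (\<lambda>x. \<phi> x - t * \<psi> x) (\<lambda>x. \<phi> x - t * \<psi> x)
        = ip \<phi> \<phi> - cnj t * ip \<phi> \<psi> - t * cnj (ip \<phi> \<psi>) + t * cnj t * ip \<psi> \<psi>"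
      using assms by (simp add: ip_simps mem_intros * algebra_simps)
    also have "\<dots> = ip \<phi> \<phi> - ip \<phi> \<psi> * cnj (ip \<phi> \<psi>) / of_real ((N \<psi>)\<^sup>2)"
      using False unfolding ip_self[OF assms(2)] by (simp add: t_def field_simps power2_eq_square)
    finally show ?thesis
      using assms by (simp add: ip_self complex_norm_square[symmetric])
  qed
  finally have "(cmod (ip \<phi> \<psi>))\<^sup>2 \<le> (N \<phi> * N \<psi>)\<^sup>2"
    using False by (simp add: field_simps power_mult_distrib del: of_real_power)
  then show ?thesis
    using norm_nonneg assms by (simp add: power2_le_iff_abs_le)
qed

lemma norm_triangle:
  assumes "\<phi> \<in> H" "\<psi> \<in> H" shows "N (\<lambda>x. \<phi> x + \<psi> x) \<le> N \<phi> + N \<psi>"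
proof -
  have "(N (\<lambda>x. \<phi> x + \<psi> x))\<^sup>2 = (N \<phi>)\<^sup>2 + 2 * Re (ip \<phi> \<psi>) + (N \<psi>)\<^sup>2"
    using assms ip_commute[of \<psi> \<phi>] by (simp add: norm_sq mem_intros ip_simps)
  also have "\<dots> \<le> (N \<phi> + N \<psi>)\<^sup>2"
    using norm_ip[OF assms] complex_Re_le_cmod[of "ip \<phi> \<psi>"] by (simp add: power2_sum)
  finally show ?thesis
    by (rule power2_le_imp_le) (use assms norm_nonneg in auto)
qed

lemma norm_diff_triangle:
  assumes "\<phi> \<in> H" "\<psi> \<in> H" "\<eta> \<in> H"
  shows "N (\<lambda>x. \<phi> x - \<eta> x) \<le> N (\<lambda>x. \<phi> x - \<psi> x) + N (\<lambda>x. \<psi> x - \<eta> x)"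
  using norm_triangle[of "\<lambda>x. \<phi> x - \<psi> x" "\<lambda>x. \<psi> x - \<eta> x"] assms by (simp add: mem_intros)

lemma norm_le_diff:
  assumes "\<phi> \<in> H" "\<psi> \<in> H"
  shows "N \<phi> \<le> N (\<lambda>x. \<phi> x - \<psi> x) + N \<psi>"
  using norm_triangle[of "\<lambda>x. \<phi> x - \<psi> x" \<psi>] assms by (simp add: mem_intros)

lemma tendsto_ip_left:
  assumes "\<And>n. u n \<in> H" "\<phi> \<in> H" "\<psi> \<in> H" and lim: "(\<lambda>n. N (\<lambda>x. \<phi> x - u n x)) \<longlonglongrightarrow> 0"
  shows "(\<lambda>n. ip (u n) \<psi>) \<longlonglongrightarrow> ip \<phi> \<psi>"
proof -
  have "(\<lambda>n. ip \<phi> \<psi> - ip (u n) \<psi>) \<longlonglongrightarrow> 0"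
  proof (rule Lim_null_comparison)
    show "\<forall>\<^sub>F n in sequentially. cmod (ip \<phi> \<psi> - ip (u n) \<psi>) \<le> N (\<lambda>x. \<phi> x - u n x) * N \<psi>"
      using assms norm_ip[of "\<lambda>x. \<phi> x - u n x" \<psi> for n] by (auto simp: ip_simps mem_intros)
    show "(\<lambda>n. N (\<lambda>x. \<phi> x - u n x) * N \<psi>) \<longlonglongrightarrow> 0"
      using tendsto_mult_left_zero[OF lim] by simp
  qed
  from tendsto_diff[OF tendsto_const this, of "ip \<phi> \<psi>"] show ?thesis by simp
qed

section \<open>Bounded operators\<close>

abbreviation B :: "'x op set" where "B \<equiv> bounded_ops H ip"

lemma bounded_opsI:
  assumes "T \<in> extensional H" "\<And>\<phi>. \<phi> \<in> H \<Longrightarrow> T \<phi> \<in> H"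
    "\<And>\<phi> \<psi>. \<phi> \<in> H \<Longrightarrow> \<psi> \<in> H \<Longrightarrow> T (\<lambda>x. \<phi> x + \<psi> x) = (\<lambda>x. T \<phi> x + T \<psi> x)"
    "\<And>c \<phi>. \<phi> \<in> H \<Longrightarrow> T (\<lambda>x. c * \<phi> x) = (\<lambda>x. c * T \<phi> x)"
    "\<And>\<phi>. \<phi> \<in> H \<Longrightarrow> N (T \<phi>) \<le> M * N \<phi>"
  shows "T \<in> B"
  using assms unfolding bounded_ops_def by (auto simp: PiE_def intro!: exI[of _ M])

context
  fixes T assumes T: "T \<in> B"
begin

lemma op_mem: "\<phi> \<in> H \<Longrightarrow> T \<phi> \<in> H"
  using T by (auto simp: bounded_ops_def)

lemma op_extensional: "T \<in> extensional H"
  using T by (auto simp: bounded_ops_def PiE_def)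

lemma op_plus: "\<phi> \<in> H \<Longrightarrow> \<psi> \<in> H \<Longrightarrow> T (\<lambda>x. \<phi> x + \<psi> x) = (\<lambda>x. T \<phi> x + T \<psi> x)"
  using T by (auto simp: bounded_ops_def)

lemma op_times: "\<phi> \<in> H \<Longrightarrow> T (\<lambda>x. c * \<phi> x) = (\<lambda>x. c * T \<phi> x)"
  using T by (auto simp: bounded_ops_def)

lemma op_minus: "\<phi> \<in> H \<Longrightarrow> \<psi> \<in> H \<Longrightarrow> T (\<lambda>x. \<phi> x - \<psi> x) = (\<lambda>x. T \<phi> x - T \<psi> x)"
  using op_plus[of \<phi> "\<lambda>x. (-1) * \<psi> x"] op_times[of \<psi> "-1"] scale_mem[of \<psi> "-1"] by simp

lemma op_at_zero: "T (\<lambda>x. 0) = (\<lambda>x. 0)"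
  using op_times[OF zero_mem, of 0] by simp

lemma op_sum: "(\<And>i. i \<in> A \<Longrightarrow> f i \<in> H) \<Longrightarrow> T (\<lambda>x. \<Sum>i\<in>A. f i x) = (\<lambda>x. \<Sum>i\<in>A. T (f i) x)"
proof (induction A rule: infinite_finite_induct)
  case (insert a A)
  then show ?case by (simp add: op_plus sum_mem)
qed (auto simp: op_at_zero)

lemma op_bound: obtains M where "M > 0" "\<And>\<phi>. \<phi> \<in> H \<Longrightarrow> N (T \<phi>) \<le> M * N \<phi>"
proof -
  obtain M where M: "\<And>\<phi>. \<phi> \<in> H \<Longrightarrow> N (T \<phi>) \<le> M * N \<phi>"
    using T unfolding bounded_ops_def by blast
  have "N (T \<phi>) \<le> (\<bar>M\<bar> + 1) * N \<phi>" if "\<phi> \<in> H" for \<phi>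
    by (rule order_trans[OF M[OF that]]) (use norm_nonneg[OF that] in \<open>intro mult_right_mono, auto\<close>)
  then show thesis using that[of "\<bar>M\<bar> + 1"] by auto
qed

end

lemmas op_linear = op_plus op_times op_minus op_at_zero

lemma op_eqI:
  assumes "S \<in> B" "T \<in> B" "\<And>\<phi>. \<phi> \<in> H \<Longrightarrow> S \<phi> = T \<phi>"
  shows "S = T"
  using assms op_extensional extensionalityI by metis

lemma op_apply:
  assumes "\<phi> \<in> H"
  shows "op_zero H \<phi> = (\<lambda>x. 0)" "op_add H S T \<phi> = (\<lambda>x. S \<phi> x + T \<phi> x)"
    "op_diff H S T \<phi> = (\<lambda>x. S \<phi> x - T \<phi> x)" "op_scale H c T \<phi> = (\<lambda>x. c * T \<phi> x)"
    "compose H S T \<phi> = S (T \<phi>)"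
  using assms by (auto simp: op_zero_def op_add_def op_diff_def op_scale_def compose_def)

lemma op_zero_bounded: "op_zero H \<in> B"
  by (rule bounded_opsI[where M=0]) (auto simp: op_apply mem_intros norm_zero, simp add: op_zero_def)

lemma op_add_bounded:
  assumes "S \<in> B" "T \<in> B" shows "op_add H S T \<in> B"
proof -
  obtain M M' where M: "\<And>\<phi>. \<phi> \<in> H \<Longrightarrow> N (S \<phi>) \<le> M * N \<phi>" "\<And>\<phi>. \<phi> \<in> H \<Longrightarrow> N (T \<phi>) \<le> M' * N \<phi>"
    using op_bound assms by metis
  show ?thesis
  proof (rule bounded_opsI[where M="M+M'"])
    fix \<phi> assume "\<phi> \<in> H"
    then show "N (op_add H S T \<phi>) \<le> (M + M') * N \<phi>"
      using norm_triangle[of "S \<phi>" "T \<phi>"] M[of \<phi>] assms by (simp add: op_apply op_mem algebra_simps)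
  qed (use assms in \<open>auto simp: op_apply op_mem mem_intros op_linear algebra_simps\<close>,
      simp add: op_add_def)
qed

lemma op_scale_bounded:
  assumes "T \<in> B" shows "op_scale H c T \<in> B"
proof -
  obtain M where M: "\<And>\<phi>. \<phi> \<in> H \<Longrightarrow> N (T \<phi>) \<le> M * N \<phi>"
    using op_bound assms by metis
  show ?thesis
  proof (rule bounded_opsI[where M="cmod c * M"])
    fix \<phi> assume "\<phi> \<in> H"
    then show "N (op_scale H c T \<phi>) \<le> (cmod c * M) * N \<phi>"
      using mult_left_mono[OF M[of \<phi>], of "cmod c"] assms by (simp add: op_apply op_mem norm_scale)
  qed (use assms in \<open>auto simp: op_apply op_mem mem_intros op_linear algebra_simps\<close>,
      simp add: op_scale_def)
qed

lemma op_diff_conv: "op_diff H S T = op_add H S (op_scale H (-1) T)"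
  by (auto simp: op_diff_def op_add_def op_scale_def)

lemma op_diff_bounded: "S \<in> B \<Longrightarrow> T \<in> B \<Longrightarrow> op_diff H S T \<in> B"
  by (simp add: op_diff_conv op_add_bounded op_scale_bounded)

lemma compose_bounded:
  assumes "S \<in> B" "T \<in> B" shows "compose H S T \<in> B"
proof -
  obtain M M' where M: "M > 0" "\<And>\<phi>. \<phi> \<in> H \<Longrightarrow> N (S \<phi>) \<le> M * N \<phi>" "\<And>\<phi>. \<phi> \<in> H \<Longrightarrow> N (T \<phi>) \<le> M' * N \<phi>"
    using op_bound assms by metis
  show ?thesis
  proof (rule bounded_opsI[where M="M*M'"])
    fix \<phi> assume "\<phi> \<in> H"
    then show "N (compose H S T \<phi>) \<le> (M * M') * N \<phi>"
      using order_trans[OF M(2)[of "T \<phi>"] mult_left_mono[OF M(3)[of \<phi>], of M]] M(1) assms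
      by (simp add: op_apply op_mem mult.assoc)
  qed (use assms in \<open>auto simp: op_apply op_mem mem_intros op_linear algebra_simps\<close>)
qed

lemmas bounded_intros = op_zero_bounded op_add_bounded op_scale_bounded op_diff_bounded compose_bounded

section \<open>Operator norm and norm-closed sets of operators\<close>

lemma op_norm_le:
  assumes "M \<ge> 0" "\<And>\<phi>. \<phi> \<in> H \<Longrightarrow> N (T \<phi>) \<le> M * N \<phi>"
  shows "op_norm H ip T \<le> M"
  unfolding op_norm_def
proof (rule cSUP_least)
  show "{\<phi> \<in> H. N \<phi> \<le> 1} \<noteq> {}" using zero_mem norm_zero by auto
  fix \<phi> assume "\<phi> \<in> {\<phi> \<in> H. N \<phi> \<le> 1}"
  then show "N (T \<phi>) \<le> M"
    using assms(2)[of \<phi>] mult_left_mono[of "N \<phi>" 1 M] assms(1) by auto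
qed

lemma norm_le_op_norm:
  assumes T: "T \<in> B" and "\<phi> \<in> H"
  shows "N (T \<phi>) \<le> op_norm H ip T * N \<phi>"
proof (cases "N \<phi> = 0")
  case True
  then show ?thesis using norm_eq_0[of \<phi>] assms by (simp add: op_at_zero norm_zero)
next
  case False
  then have pos: "N \<phi> > 0" using norm_nonneg[OF \<open>\<phi> \<in> H\<close>] by simp
  obtain M where M: "M > 0" "\<And>\<phi>. \<phi> \<in> H \<Longrightarrow> N (T \<phi>) \<le> M * N \<phi>"
    using op_bound[OF T] by metis
  define \<psi> where "\<psi> = (\<lambda>x. of_real (1 / N \<phi>) * \<phi> x)"
  have \<psi>: "\<psi> \<in> H" "N \<psi> = 1" "T \<psi> = (\<lambda>x. of_real (1 / N \<phi>) * T \<phi> x)"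
    unfolding \<psi>_def using assms pos
    by (auto simp: mem_intros norm_scale op_times norm_divide simp del: of_real_divide)
  have "N (T \<psi>) \<le> op_norm H ip T" unfolding op_norm_def
  proof (rule cSUP_upper)
    show "bdd_above ((\<lambda>\<phi>. N (T \<phi>)) ` {\<phi> \<in> H. N \<phi> \<le> 1})"
    proof (rule bdd_aboveI2)
      fix \<phi> assume "\<phi> \<in> {\<phi> \<in> H. N \<phi> \<le> 1}"
      then show "N (T \<phi>) \<le> M"
        using order_trans[OF M(2)[of \<phi>] mult_left_le[of "N \<phi>" M]] M(1) by simp
    qed
  qed (use \<psi> in auto)
  also have "N (T \<psi>) = N (T \<phi>) / N \<phi>"
    using pos assms by (simp only: \<psi> norm_scale op_mem norm_of_real) simp
  finally show ?thesis using pos by (simp add: field_simps)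
qed

text \<open>Trades the supremum and the sequences for a pointwise \<epsilon>-bound, so that later
  closedness proofs can estimate vector by vector. In the forward direction the sequence is picked
  with errors 1 / (k + 1).\<close>

lemma op_norm_closed_iff:
  assumes A: "A \<subseteq> B"
  shows "op_norm_closed H ip A \<longleftrightarrow>
    (\<forall>L\<in>B. (\<forall>\<epsilon>>0. \<exists>T\<in>A. \<forall>\<phi>\<in>H. N (\<lambda>x. T \<phi> x - L \<phi> x) \<le> \<epsilon> * N \<phi>) \<longrightarrow> L \<in> A)"
proof (intro iffI ballI impI)
  fix L assume cl: "op_norm_closed H ip A" and L: "L \<in> B"
    and "\<forall>\<epsilon>>0. \<exists>T\<in>A. \<forall>\<phi>\<in>H. N (\<lambda>x. T \<phi> x - L \<phi> x) \<le> \<epsilon> * N \<phi>"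
  then have "\<exists>T\<in>A. \<forall>\<phi>\<in>H. N (\<lambda>x. T \<phi> x - L \<phi> x) \<le> inverse (real (Suc k)) * N \<phi>" for k
    by (simp del: of_nat_Suc)
  then obtain T where T: "\<And>k. T k \<in> A"
    "\<And>k \<phi>. \<phi> \<in> H \<Longrightarrow> N (\<lambda>x. T k \<phi> x - L \<phi> x) \<le> inverse (real (Suc k)) * N \<phi>"
    by metis
  have le: "op_norm H ip (op_diff H (T k) L) \<le> inverse (real (Suc k))" for k
    using T(2)[of _ k] by (intro op_norm_le) (auto simp: op_apply simp del: of_nat_Suc)
  \<comment> \<open>A supremum of reals dominates the members of the set only if the set is bounded
    above; the \<epsilon>-bound supplies this, and the zero vector supplies the member 0.\<close>
  have "op_norm H ip (op_diff H (T k) L) \<ge> 0" for k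
  proof -
    have b: "op_diff H (T k) L \<in> B" using T(1) A L by (auto intro: bounded_intros)
    have "0 \<le> N (op_diff H (T k) L (\<lambda>x. 0))" by (simp add: op_at_zero[OF b] norm_zero)
    also have "\<dots> \<le> op_norm H ip (op_diff H (T k) L)"
      unfolding op_norm_def
    proof (rule cSUP_upper)
      show "bdd_above ((\<lambda>\<phi>. N (op_diff H (T k) L \<phi>)) ` {\<phi> \<in> H. N \<phi> \<le> 1})"
      proof (rule bdd_aboveI2)
        fix \<phi> assume \<phi>: "\<phi> \<in> {\<phi> \<in> H. N \<phi> \<le> 1}"
        then have "N (op_diff H (T k) L \<phi>) \<le> inverse (real (Suc k)) * N \<phi>"
          using T(2)[of \<phi> k] by (simp add: op_apply)
        also have "\<dots> \<le> inverse (real (Suc k)) * 1"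
          using \<phi> by (intro mult_left_mono) auto
        finally show "N (op_diff H (T k) L \<phi>) \<le> inverse (real (Suc k)) * 1" .
      qed
    qed (auto simp: zero_mem norm_zero)
    finally show ?thesis .
  qed
  then have "(\<lambda>k. op_norm H ip (op_diff H (T k) L)) \<longlonglongrightarrow> 0"
    using le by (intro real_tendsto_sandwich[OF _ _ tendsto_const LIMSEQ_inverse_real_of_nat]) auto
  then show "L \<in> A"
    using cl T(1) L unfolding op_norm_closed_def by blast
next
  assume *: "\<forall>L\<in>B. (\<forall>\<epsilon>>0. \<exists>T\<in>A. \<forall>\<phi>\<in>H. N (\<lambda>x. T \<phi> x - L \<phi> x) \<le> \<epsilon> * N \<phi>) \<longrightarrow> L \<in> A"
  show "op_norm_closed H ip A"
    unfolding op_norm_closed_def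
  proof (intro allI impI, elim conjE)
    fix T :: "nat \<Rightarrow> 'x op" and L
    assume T: "\<forall>k. T k \<in> A" and L: "L \<in> B"
      and lim: "(\<lambda>k. op_norm H ip (op_diff H (T k) L)) \<longlonglongrightarrow> 0"
    have "\<exists>T\<in>A. \<forall>\<phi>\<in>H. N (\<lambda>x. T \<phi> x - L \<phi> x) \<le> \<epsilon> * N \<phi>" if "\<epsilon> > 0" for \<epsilon>
    proof -
      obtain k where k: "op_norm H ip (op_diff H (T k) L) < \<epsilon>"
        using order_tendstoD(2)[OF lim \<open>\<epsilon> > 0\<close>] by (auto simp: eventually_sequentially)
      have "N (\<lambda>x. T k \<phi> x - L \<phi> x) \<le> \<epsilon> * N \<phi>" if "\<phi> \<in> H" for \<phi>
      proof -
        have "N (op_diff H (T k) L \<phi>) \<le> op_norm H ip (op_diff H (T k) L) * N \<phi>"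
          using T A L that by (intro norm_le_op_norm bounded_intros) auto
        also have "\<dots> \<le> \<epsilon> * N \<phi>" using k norm_nonneg[OF that] by (intro mult_right_mono) auto
        finally show ?thesis using that by (simp add: op_apply)
      qed
      then show ?thesis using T by blast
    qed
    then show "L \<in> A" using * L by blast
  qed
qed

lemma op_norm_closedI:
  assumes "A \<subseteq> B"
    "\<And>L. L \<in> B \<Longrightarrow> (\<And>\<epsilon>. \<epsilon> > 0 \<Longrightarrow> \<exists>T\<in>A. \<forall>\<phi>\<in>H. N (\<lambda>x. T \<phi> x - L \<phi> x) \<le> \<epsilon> * N \<phi>) \<Longrightarrow> L \<in> A"
  shows "op_norm_closed H ip A"
  using assms by (simp add: op_norm_closed_iff)

lemma op_norm_closedD:
  assumes "op_norm_closed H ip A" "A \<subseteq> B" "L \<in> B"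
    "\<And>\<epsilon>. \<epsilon> > 0 \<Longrightarrow> \<exists>T\<in>A. \<forall>\<phi>\<in>H. N (\<lambda>x. T \<phi> x - L \<phi> x) \<le> \<epsilon> * N \<phi>"
  shows "L \<in> A"
  using assms by (simp add: op_norm_closed_iff)

end

section \<open>Hilbert spaces with a countable orthonormal basis\<close>

text \<open>\<open>riesz_fischer\<close> is the form in which completeness is used: a vector is
  produced by naming its coefficients, both for adjoints and for limits of subsequences.
  \<open>parseval\<close> expresses that the orthonormal family is total.\<close>

locale fun_hilbert_space = fun_inner_product +
  fixes e :: "nat \<Rightarrow> 'a \<Rightarrow> complex"
  assumes e_mem: "e k \<in> H"
    and ip_e: "ip (e j) (e k) = (if j = k then 1 else 0)"
    and parseval: "\<phi> \<in> H \<Longrightarrow> (\<lambda>k. (cmod (ip \<phi> (e k)))\<^sup>2) sums (hnorm ip \<phi>)\<^sup>2"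
    and riesz_fischer: "summable (\<lambda>k. (cmod (c k))\<^sup>2) \<Longrightarrow> \<exists>\<phi>\<in>H. \<forall>k. ip \<phi> (e k) = c k"
begin

section \<open>Coordinate projections and tails\<close>

definition proj :: "nat \<Rightarrow> ('a \<Rightarrow> complex) \<Rightarrow> 'a \<Rightarrow> complex" where
  "proj n \<phi> = (\<lambda>x. \<Sum>k<n. ip \<phi> (e k) * e k x)"

definition tail :: "nat \<Rightarrow> ('a \<Rightarrow> complex) \<Rightarrow> 'a \<Rightarrow> complex" where
  "tail n \<phi> = (\<lambda>x. \<phi> x - proj n \<phi> x)"

lemma combination_mem: "(\<lambda>x. \<Sum>k\<in>A. c k * e k x) \<in> H"
  by (intro sum_mem scale_mem e_mem)

lemma ip_combination:
  assumes "\<phi> \<in> H" shows "ip (\<lambda>x. \<Sum>k\<in>A. c k * e k x) \<phi> = (\<Sum>k\<in>A. c k * ip (e k) \<phi>)"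
  using assms by (subst ip_sum_left) (auto simp: scale_mem e_mem ip_scale_left)

lemma norm_combination: "(N (\<lambda>x. \<Sum>k<n. c k * e k x))\<^sup>2 = (\<Sum>k<n. (cmod (c k))\<^sup>2)"
proof -
  have "ip (e k) (\<lambda>x. \<Sum>k<n. c k * e k x) = cnj (c k)" if "k < n" for k
    using that by (subst ip_commute)
      (auto simp: combination_mem e_mem ip_combination ip_e if_distrib sum.delta' cong: if_cong)
  then have "ip (\<lambda>x. \<Sum>k<n. c k * e k x) (\<lambda>x. \<Sum>k<n. c k * e k x) = (\<Sum>k<n. c k * cnj (c k))"
    by (subst ip_combination) (auto simp: combination_mem)
  then show ?thesis
    by (simp add: norm_sq combination_mem complex_norm_square[symmetric] flip: of_real_sum)
qed

lemma norm_e: "N (e k) = 1"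
  by (simp add: hnorm_def ip_e)

lemma proj_mem: "proj n \<phi> \<in> H"
  unfolding proj_def by (rule combination_mem)

lemma tail_mem: "\<phi> \<in> H \<Longrightarrow> tail n \<phi> \<in> H"
  unfolding tail_def by (intro diff_mem proj_mem)

lemma ip_proj: "ip (proj n \<phi>) (e j) = (if j < n then ip \<phi> (e j) else 0)"
  unfolding proj_def by (simp add: ip_combination e_mem ip_e if_distrib cong: if_cong)

lemma norm_proj: "(N (proj n \<phi>))\<^sup>2 = (\<Sum>k<n. (cmod (ip \<phi> (e k)))\<^sup>2)"
  unfolding proj_def by (rule norm_combination)

lemma norm_tail:
  assumes "\<phi> \<in> H" shows "(N (tail n \<phi>))\<^sup>2 = (N \<phi>)\<^sup>2 - (\<Sum>k<n. (cmod (ip \<phi> (e k)))\<^sup>2)"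
proof -
  have "ip (proj n \<phi>) \<phi> = (\<Sum>k<n. ip \<phi> (e k) * cnj (ip \<phi> (e k)))"
    unfolding proj_def using assms ip_commute[OF e_mem assms] by (simp add: ip_combination)
  then have *: "ip (proj n \<phi>) \<phi> = of_real ((N (proj n \<phi>))\<^sup>2)"
    by (simp add: norm_proj complex_norm_square[symmetric])
  then have **: "ip \<phi> (proj n \<phi>) = of_real ((N (proj n \<phi>))\<^sup>2)"
    using ip_commute[OF assms proj_mem, of n \<phi>] by simp
  show ?thesis unfolding tail_def using assms
    by (simp only: norm_sq diff_mem proj_mem)
       (simp add: ip_simps diff_mem proj_mem * ** ip_self norm_proj)
qed

lemma norm_tail_le: "\<phi> \<in> H \<Longrightarrow> N (tail n \<phi>) \<le> N \<phi>"
  by (rule power2_le_imp_le) (auto simp: norm_tail sum_nonneg norm_nonneg)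

lemma norm_tail_antimono: "\<phi> \<in> H \<Longrightarrow> m \<le> n \<Longrightarrow> N (tail n \<phi>) \<le> N (tail m \<phi>)"
  by (rule power2_le_imp_le) (auto simp: norm_tail norm_nonneg tail_mem intro!: sum_mono2)

lemma tail_tendsto:
  assumes "\<phi> \<in> H" shows "(\<lambda>n. N (tail n \<phi>)) \<longlonglongrightarrow> 0"
proof -
  have "(\<lambda>n. (N (tail n \<phi>))\<^sup>2) \<longlonglongrightarrow> 0"
    using tendsto_diff[OF tendsto_const parseval[OF assms, unfolded sums_def], of "(N \<phi>)\<^sup>2"]
    by (simp add: norm_tail[OF assms])
  from tendsto_real_sqrt[OF this] show ?thesis
    by (simp add: norm_nonneg tail_mem[OF assms])
qed

lemma norm_le_coeffs:
  assumes "\<phi> \<in> H" "M \<ge> 0" "\<And>n. (\<Sum>k<n. (cmod (ip \<phi> (e k)))\<^sup>2) \<le> M\<^sup>2"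
  shows "N \<phi> \<le> M"
proof -
  have "(N \<phi>)\<^sup>2 \<le> M\<^sup>2"
    using parseval[OF assms(1)] assms(3) unfolding sums_def by (intro LIMSEQ_le_const2) auto
  then show ?thesis using assms(2) by (rule power2_le_imp_le)
qed

lemma coeffs_eqI:
  assumes "\<phi> \<in> H" "\<psi> \<in> H" "\<And>k. ip \<phi> (e k) = ip \<psi> (e k)"
  shows "\<phi> = \<psi>"
proof -
  have m: "(\<lambda>x. \<phi> x - \<psi> x) \<in> H" using assms by (intro diff_mem)
  have "N (\<lambda>x. \<phi> x - \<psi> x) \<le> 0"
    using assms m by (intro norm_le_coeffs) (auto simp: ip_simps e_mem)
  then have "(\<lambda>x. \<phi> x - \<psi> x) = (\<lambda>x. 0)"
    using norm_nonneg[OF m] norm_eq_0[OF m] by simp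
  then show ?thesis by (simp add: fun_eq_iff)
qed

lemma proj_linear:
  assumes "\<phi> \<in> H"
  shows "\<psi> \<in> H \<Longrightarrow> proj n (\<lambda>x. \<phi> x + \<psi> x) = (\<lambda>x. proj n \<phi> x + proj n \<psi> x)"
    "\<psi> \<in> H \<Longrightarrow> proj n (\<lambda>x. \<phi> x - \<psi> x) = (\<lambda>x. proj n \<phi> x - proj n \<psi> x)"
    "proj n (\<lambda>x. c * \<phi> x) = (\<lambda>x. c * proj n \<phi> x)"
  using assms unfolding proj_def
  by (auto simp: ip_simps e_mem sum.distrib sum_subtractf sum_distrib_left algebra_simps)

lemma tail_linear:
  assumes "\<phi> \<in> H"
  shows "\<psi> \<in> H \<Longrightarrow> tail n (\<lambda>x. \<phi> x + \<psi> x) = (\<lambda>x. tail n \<phi> x + tail n \<psi> x)"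
    "\<psi> \<in> H \<Longrightarrow> tail n (\<lambda>x. \<phi> x - \<psi> x) = (\<lambda>x. tail n \<phi> x - tail n \<psi> x)"
    "tail n (\<lambda>x. c * \<phi> x) = (\<lambda>x. c * tail n \<phi> x)"
  using assms unfolding tail_def by (auto simp: proj_linear algebra_simps)

lemma op_proj: "T \<in> B \<Longrightarrow> T (proj n \<phi>) = (\<lambda>x. \<Sum>k<n. ip \<phi> (e k) * T (e k) x)"
  unfolding proj_def by (subst op_sum) (auto simp: op_times e_mem scale_mem)

lemma op_proj_tendsto:
  assumes T: "T \<in> B" and \<phi>: "\<phi> \<in> H"
  shows "(\<lambda>n. N (\<lambda>x. T \<phi> x - T (proj n \<phi>) x)) \<longlonglongrightarrow> 0"
proof -
  obtain M where M: "\<And>\<phi>. \<phi> \<in> H \<Longrightarrow> N (T \<phi>) \<le> M * N \<phi>" using op_bound[OF T] by metis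
  have "norm (N (\<lambda>x. T \<phi> x - T (proj n \<phi>) x)) \<le> M * N (tail n \<phi>)" for n
    using M[OF tail_mem[OF \<phi>, of n]] norm_nonneg[OF op_mem[OF T tail_mem[OF \<phi>, of n]]]
    unfolding tail_def op_minus[OF T \<phi> proj_mem] by simp
  then show ?thesis
    by (intro Lim_null_comparison[OF _ tendsto_mult_right_zero[OF tail_tendsto[OF \<phi>], of M]]) auto
qed

lemma op_eq_on_basisI:
  assumes "S \<in> B" "T \<in> B" "\<And>k. S (e k) = T (e k)"
  shows "S = T"
proof (rule op_eqI)
  fix \<phi> assume \<phi>: "\<phi> \<in> H"
  have "ip (S \<phi>) \<psi> = ip (T \<phi>) \<psi>" if "\<psi> \<in> H" for \<psi>
  proof -
    have "(\<lambda>n. ip (S (proj n \<phi>)) \<psi>) \<longlonglongrightarrow> ip (S \<phi>) \<psi>"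
      "(\<lambda>n. ip (T (proj n \<phi>)) \<psi>) \<longlonglongrightarrow> ip (T \<phi>) \<psi>"
      using assms \<phi> that by (auto intro!: tendsto_ip_left op_proj_tendsto simp: op_mem proj_mem)
    moreover have "S (proj n \<phi>) = T (proj n \<phi>)" for n
      using assms by (simp add: op_proj)
    ultimately show ?thesis using LIMSEQ_unique by simp
  qed
  then show "S \<phi> = T \<phi>"
    using assms \<phi> by (intro coeffs_eqI) (auto simp: op_mem e_mem)
qed (use assms in auto)

section \<open>Adjoints\<close>

abbreviation adj :: "'a op \<Rightarrow> 'a op" where "adj \<equiv> op_adj H ip"

text \<open>The coefficients of the adjoint at \<psi> have to be <\<psi>, T (\<open>e k\<close>)>,
  and Riesz-Fischer yields the vector once these are square summable. The bound \<open>M\<close> is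
  carried over to the adjoint because limits of adjoints are taken later.\<close>

lemma adjoint_exists:
  assumes T: "T \<in> B" and M: "M \<ge> 0" "\<And>\<phi>. \<phi> \<in> H \<Longrightarrow> N (T \<phi>) \<le> M * N \<phi>"
  shows "\<exists>S\<in>B. (\<forall>\<phi>\<in>H. \<forall>\<psi>\<in>H. ip (T \<phi>) \<psi> = ip \<phi> (S \<psi>)) \<and> (\<forall>\<psi>\<in>H. N (S \<psi>) \<le> M * N \<psi>)"
proof -
  have bound: "(\<Sum>k<n. (cmod (ip \<psi> (T (e k))))\<^sup>2) \<le> (M * N \<psi>)\<^sup>2" if \<psi>: "\<psi> \<in> H" for \<psi> n
  proof -
    define c where "c k = ip \<psi> (T (e k))" for k
    \<comment> \<open>Duality: testing T on the vector with these coefficients gives s = <T v,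
      \<psi>> \<le> M |v| |\<psi>|. Since also s = |v|^2, cancelling one factor leaves |v| \<le> M
      |\<psi>|, uniformly in n.\<close>
    define v where "v = (\<lambda>x. \<Sum>k<n. c k * e k x)"
    define s where "s = (\<Sum>k<n. (cmod (c k))\<^sup>2)"
    have v: "v \<in> H" unfolding v_def by (rule combination_mem)
    have Tv: "T v = (\<lambda>x. \<Sum>k<n. c k * T (e k) x)"
      unfolding v_def using T by (subst op_sum) (auto simp: op_times e_mem scale_mem)
    have "ip (T v) \<psi> = (\<Sum>k<n. c k * ip (T (e k)) \<psi>)"
      unfolding Tv using T \<psi> by (subst ip_sum_left) (auto simp: ip_scale_left op_mem e_mem scale_mem)
    also have "\<dots> = (\<Sum>k<n. c k * cnj (c k))"
      unfolding c_def using ip_commute[OF op_mem[OF T e_mem] \<psi>] by simp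
    also have "\<dots> = of_real s"
      by (simp add: s_def complex_norm_square del: of_real_power)
    finally have "cmod (ip (T v) \<psi>) = \<bar>s\<bar>" by (simp only: norm_of_real)
    then have "s = cmod (ip (T v) \<psi>)" by (simp add: s_def sum_nonneg)
    also have "\<dots> \<le> N (T v) * N \<psi>" using T v \<psi> by (intro norm_ip) (auto simp: op_mem)
    also have "\<dots> \<le> (M * N v) * N \<psi>" using M v \<psi> norm_nonneg by (intro mult_right_mono) auto
    finally have le: "s \<le> (M * N \<psi>) * N v" by (simp add: mult_ac)
    have sq: "(N v)\<^sup>2 = s" unfolding v_def s_def by (rule norm_combination)
    have "N v \<le> M * N \<psi>"
    proof (cases "N v = 0")
      case False
      then have "N v > 0" using norm_nonneg[OF v] by simp
      moreover have "N v * N v \<le> (M * N \<psi>) * N v" using le sq by (simp add: power2_eq_square)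
      ultimately show ?thesis by (simp only: mult_le_cancel_right_pos)
    qed (use M norm_nonneg[OF \<psi>] in simp)
    then have "(N v)\<^sup>2 \<le> (M * N \<psi>)\<^sup>2" using norm_nonneg[OF v] by (intro power_mono)
    then show ?thesis unfolding sq s_def c_def .
  qed
  have "\<exists>\<eta>\<in>H. \<forall>k. ip \<eta> (e k) = ip \<psi> (T (e k))" if "\<psi> \<in> H" for \<psi>
    using bound[OF that] by (intro riesz_fischer bounded_imp_summable[where B="(M * N \<psi>)\<^sup>2"])
      (auto simp: lessThan_Suc_atMost[symmetric] simp del: sum.lessThan_Suc)
  then obtain A where A: "\<And>\<psi>. \<psi> \<in> H \<Longrightarrow> A \<psi> \<in> H"
    "\<And>\<psi> k. \<psi> \<in> H \<Longrightarrow> ip (A \<psi>) (e k) = ip \<psi> (T (e k))" by metis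
  have normA: "N (A \<psi>) \<le> M * N \<psi>" if "\<psi> \<in> H" for \<psi>
    using that A bound M norm_nonneg by (intro norm_le_coeffs) auto
  have adj: "ip (T \<phi>) \<psi> = ip \<phi> (A \<psi>)" if "\<phi> \<in> H" "\<psi> \<in> H" for \<phi> \<psi>
  proof -
    have "(\<lambda>n. ip (T (proj n \<phi>)) \<psi>) \<longlonglongrightarrow> ip (T \<phi>) \<psi>"
      using T that by (auto intro!: tendsto_ip_left op_proj_tendsto simp: op_mem proj_mem)
    moreover have "(\<lambda>n. ip (proj n \<phi>) (A \<psi>)) \<longlonglongrightarrow> ip \<phi> (A \<psi>)"
      using tail_tendsto[of \<phi>] that A by (auto intro!: tendsto_ip_left simp: proj_mem tail_def)
    moreover have "ip (T (proj n \<phi>)) \<psi> = ip (proj n \<phi>) (A \<psi>)" for n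
    proof -
      have "ip (T (proj n \<phi>)) \<psi> = (\<Sum>k<n. ip \<phi> (e k) * ip (T (e k)) \<psi>)"
        unfolding op_proj[OF T] using T that
        by (subst ip_sum_left) (auto simp: ip_scale_left op_mem e_mem scale_mem)
      also have "\<dots> = (\<Sum>k<n. ip \<phi> (e k) * ip (e k) (A \<psi>))"
        using ip_commute[OF op_mem[OF T e_mem] \<open>\<psi> \<in> H\<close>] ip_commute[OF e_mem A(1)[OF \<open>\<psi> \<in> H\<close>]]
          A(2)[OF \<open>\<psi> \<in> H\<close>] by simp
      also have "\<dots> = ip (proj n \<phi>) (A \<psi>)"
        unfolding proj_def using that A by (simp add: ip_combination)
      finally show ?thesis .
    qed
    ultimately show ?thesis using LIMSEQ_unique by simp
  qed
  have "restrict A H \<in> B"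
  proof (rule bounded_opsI[where M=M])
    fix \<phi> \<psi> assume "\<phi> \<in> H" "\<psi> \<in> H"
    then show "restrict A H (\<lambda>x. \<phi> x + \<psi> x) = (\<lambda>x. restrict A H \<phi> x + restrict A H \<psi> x)"
      using T by (intro coeffs_eqI) (auto simp: A ip_simps add_mem e_mem op_mem)
  next
    fix \<phi> c assume "\<phi> \<in> H"
    then show "restrict A H (\<lambda>x. c * \<phi> x) = (\<lambda>x. c * restrict A H \<phi> x)"
      using T by (intro coeffs_eqI) (auto simp: A ip_simps scale_mem e_mem op_mem)
  qed (auto simp: A normA)
  then show ?thesis using adj normA by (intro bexI[of _ "restrict A H"]) auto
qed

lemma adjoint_unique:
  assumes "S \<in> B" "S' \<in> B" "\<forall>\<phi>\<in>H. \<forall>\<psi>\<in>H. ip (T \<phi>) \<psi> = ip \<phi> (S \<psi>)"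
    "\<forall>\<phi>\<in>H. \<forall>\<psi>\<in>H. ip (T \<phi>) \<psi> = ip \<phi> (S' \<psi>)"
  shows "S = S'"
proof (rule op_eqI)
  fix \<psi> assume \<psi>: "\<psi> \<in> H"
  show "S \<psi> = S' \<psi>"
  proof (rule coeffs_eqI)
    fix k
    have "ip (e k) (S \<psi>) = ip (e k) (S' \<psi>)" using assms(3,4) \<psi> e_mem by metis
    then show "ip (S \<psi>) (e k) = ip (S' \<psi>) (e k)"
      using ip_commute[OF op_mem[OF assms(1) \<psi>] e_mem[of k]]
        ip_commute[OF op_mem[OF assms(2) \<psi>] e_mem[of k]] by simp
  qed (use assms \<psi> op_mem in auto)
qed (use assms in auto)

lemma adj_eqI:
  assumes "S \<in> B" "\<And>\<phi> \<psi>. \<phi> \<in> H \<Longrightarrow> \<psi> \<in> H \<Longrightarrow> ip (T \<phi>) \<psi> = ip \<phi> (S \<psi>)"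
  shows "adj T = S"
  unfolding op_adj_def using assms by (intro the_equality conjI adjoint_unique[of _ S T]) auto

lemma
  assumes T: "T \<in> B"
  shows adj_bounded: "adj T \<in> B"
    and ip_adj_right: "\<And>\<phi> \<psi>. \<phi> \<in> H \<Longrightarrow> \<psi> \<in> H \<Longrightarrow> ip \<phi> (adj T \<psi>) = ip (T \<phi>) \<psi>"
proof -
  obtain M where "M > 0" "\<And>\<phi>. \<phi> \<in> H \<Longrightarrow> N (T \<phi>) \<le> M * N \<phi>" using op_bound[OF T] by metis
  then obtain S where S: "S \<in> B" "\<forall>\<phi>\<in>H. \<forall>\<psi>\<in>H. ip (T \<phi>) \<psi> = ip \<phi> (S \<psi>)"
    using adjoint_exists[OF T, of M] by auto
  then have "adj T = S" by (intro adj_eqI) auto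
  then show "adj T \<in> B" "\<And>\<phi> \<psi>. \<phi> \<in> H \<Longrightarrow> \<psi> \<in> H \<Longrightarrow> ip \<phi> (adj T \<psi>) = ip (T \<phi>) \<psi>"
    using S by auto
qed

lemma adj_norm_le:
  assumes "T \<in> B" "M \<ge> 0" "\<And>\<phi>. \<phi> \<in> H \<Longrightarrow> N (T \<phi>) \<le> M * N \<phi>" "\<psi> \<in> H"
  shows "N (adj T \<psi>) \<le> M * N \<psi>"
proof -
  obtain S where S: "S \<in> B" "\<forall>\<phi>\<in>H. \<forall>\<psi>\<in>H. ip (T \<phi>) \<psi> = ip \<phi> (S \<psi>)" "\<forall>\<psi>\<in>H. N (S \<psi>) \<le> M * N \<psi>"
    using adjoint_exists[OF assms(1-3)] by auto
  then have "adj T = S" by (intro adj_eqI) auto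
  then show ?thesis using S assms(4) by simp
qed

lemma ip_adj_left: "T \<in> B \<Longrightarrow> \<phi> \<in> H \<Longrightarrow> \<psi> \<in> H \<Longrightarrow> ip (adj T \<phi>) \<psi> = ip \<phi> (T \<psi>)"
  using ip_commute[of "adj T \<phi>" \<psi>] ip_commute[of \<phi> "T \<psi>"]
  by (simp add: ip_adj_right op_mem adj_bounded)

lemma adj_adj: "T \<in> B \<Longrightarrow> adj (adj T) = T"
  by (intro adj_eqI) (auto simp: ip_adj_left)

lemma adj_zero: "adj (op_zero H) = op_zero H"
  by (intro adj_eqI) (auto simp: op_apply ip_simps op_zero_bounded)

lemma adj_add: "S \<in> B \<Longrightarrow> T \<in> B \<Longrightarrow> adj (op_add H S T) = op_add H (adj S) (adj T)"
  by (intro adj_eqI) (auto simp: op_apply ip_simps ip_adj_right op_mem adj_bounded bounded_intros)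

lemma adj_diff: "S \<in> B \<Longrightarrow> T \<in> B \<Longrightarrow> adj (op_diff H S T) = op_diff H (adj S) (adj T)"
  by (intro adj_eqI) (auto simp: op_apply ip_simps ip_adj_right op_mem adj_bounded bounded_intros)

lemma adj_scale: "T \<in> B \<Longrightarrow> adj (op_scale H c T) = op_scale H (cnj c) (adj T)"
  by (intro adj_eqI) (auto simp: op_apply ip_simps ip_adj_right op_mem adj_bounded bounded_intros)

lemma adj_compose: "S \<in> B \<Longrightarrow> T \<in> B \<Longrightarrow> adj (compose H S T) = compose H (adj T) (adj S)"
  by (intro adj_eqI) (auto simp: op_apply ip_adj_right op_mem adj_bounded bounded_intros)


section \<open>Compact operators\<close>

abbreviation K :: "'a op set" where "K \<equiv> compact_ops H ip"

lemma compact_bounded: "T \<in> K \<Longrightarrow> T \<in> B"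
  by (simp add: compact_ops_def)

lemma compact_opsD:
  assumes "T \<in> K" "\<And>k. \<phi> k \<in> H" "\<And>k. N (\<phi> k) \<le> M"
  shows "\<exists>r \<psi>. strict_mono (r :: nat \<Rightarrow> nat) \<and> \<psi> \<in> H \<and>
    (\<lambda>k. N (\<lambda>x. T (\<phi> (r k)) x - \<psi> x)) \<longlonglongrightarrow> 0"
  using assms unfolding compact_ops_def by blast

text \<open>Otherwise there are unit vectors \<open>u n\<close> for which the n-th tail of T
  (\<open>u n\<close>) exceeds \<epsilon>. Along a subsequence with T (u (r k)) converging to
  \<psi>, the tails at \<open>r k\<close> differ from those of \<psi> by at most the distance to
  \<psi>, while the tails of \<psi> itself tend to 0.\<close>

lemma compact_tail:
  assumes T: "T \<in> K" and "\<epsilon> > 0"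
  shows "\<exists>n. \<forall>\<phi>\<in>H. N (tail n (T \<phi>)) \<le> \<epsilon> * N \<phi>"
proof (rule ccontr)
  have TB: "T \<in> B" using T by (rule compact_bounded)
  assume "\<not> ?thesis"
  then obtain \<phi> where \<phi>: "\<And>n. \<phi> n \<in> H" "\<And>n. N (tail n (T (\<phi> n))) > \<epsilon> * N (\<phi> n)"
    by (auto simp: not_le) metis
  have pos: "N (\<phi> n) > 0" for n
  proof (rule ccontr)
    assume "\<not> N (\<phi> n) > 0"
    then have "\<phi> n = (\<lambda>x. 0)" using norm_nonneg[OF \<phi>(1)[of n]] by (intro norm_eq_0) (auto simp: \<phi>)
    then show False
      using \<phi>(2)[of n] norm_tail_le[OF zero_mem, of n] TB by (simp add: op_at_zero norm_zero)
  qed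
  define u where "u n = (\<lambda>x. of_real (1 / N (\<phi> n)) * \<phi> n x)" for n
  have u: "u n \<in> H" "N (u n) = 1" for n
    using pos[of n] \<phi>(1) by (auto simp: u_def mem_intros norm_scale norm_divide simp del: of_real_divide)
  have big: "N (tail n (T (u n))) > \<epsilon>" for n
  proof -
    have "N (tail n (T (u n))) = cmod (of_real (1 / N (\<phi> n))) * N (tail n (T (\<phi> n)))"
      unfolding u_def using TB \<phi>(1)
      by (simp only: op_times tail_linear op_mem norm_scale tail_mem)
    also have "\<dots> = N (tail n (T (\<phi> n))) / N (\<phi> n)"
      using pos[of n] by (simp only: norm_of_real) simp
    finally show ?thesis using \<phi>(2)[of n] pos[of n] by (simp add: pos_less_divide_eq)
  qed
  obtain r \<psi> where r: "strict_mono r" and \<psi>: "\<psi> \<in> H"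
    and lim: "(\<lambda>k. N (\<lambda>x. T (u (r k)) x - \<psi> x)) \<longlonglongrightarrow> 0"
    using compact_opsD[OF T u(1) eq_refl[OF u(2)], of "\<lambda>k. k"] by (elim exE conjE) (rule that)
  have "(\<lambda>k. N (tail (r k) \<psi>)) \<longlonglongrightarrow> 0"
    using LIMSEQ_subseq_LIMSEQ[OF tail_tendsto[OF \<psi>] r] by (simp add: o_def)
  from tendsto_add[OF lim this]
  have lim': "(\<lambda>k. N (\<lambda>x. T (u (r k)) x - \<psi> x) + N (tail (r k) \<psi>)) \<longlonglongrightarrow> 0" by simp
  have "\<epsilon> \<le> N (\<lambda>x. T (u (r k)) x - \<psi> x) + N (tail (r k) \<psi>)" for k
  proof -
    have m: "T (u (r k)) \<in> H" using TB u by (auto simp: op_mem)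
    have "\<epsilon> \<le> N (tail (r k) (T (u (r k))))" using big[of "r k"] by simp
    also have "\<dots> \<le> N (\<lambda>x. tail (r k) (T (u (r k))) x - tail (r k) \<psi> x) + N (tail (r k) \<psi>)"
      using m \<psi> by (intro norm_le_diff tail_mem)
    also have "(\<lambda>x. tail (r k) (T (u (r k))) x - tail (r k) \<psi> x) = tail (r k) (\<lambda>x. T (u (r k)) x - \<psi> x)"
      using m \<psi> by (simp add: tail_linear)
    finally show ?thesis using norm_tail_le[OF diff_mem[OF m \<psi>], of "r k"] by simp
  qed
  then have "\<epsilon> \<le> 0" using lim' by (intro LIMSEQ_le_const) auto
  then show False using \<open>\<epsilon> > 0\<close> by simp
qed

text \<open>Diagonal extraction makes every coordinate of the images converge, and Riesz-Fischer
  assembles the limits into a vector. Convergence in norm follows because finitely many coordinates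
  converge together and the tails are small uniformly in k.\<close>

lemma compactI_tail:
  assumes T: "T \<in> B" and small: "\<And>\<epsilon>. \<epsilon> > 0 \<Longrightarrow> \<exists>n. \<forall>\<phi>\<in>H. N (tail n (T \<phi>)) \<le> \<epsilon> * N \<phi>"
  shows "T \<in> K"
  unfolding compact_ops_def
proof (intro CollectI conjI T allI impI, elim conjE exE)
  fix \<phi> :: "nat \<Rightarrow> 'a \<Rightarrow> complex" and M0
  assume \<phi>: "\<forall>k. \<phi> k \<in> H" and M0: "\<forall>k. N (\<phi> k) \<le> M0"
  define M where "M = \<bar>M0\<bar>"
  have M: "M \<ge> 0" "N (\<phi> k) \<le> M" for k using M0 by (auto simp: M_def intro: order_trans)
  obtain C where C: "C > 0" "\<And>\<phi>. \<phi> \<in> H \<Longrightarrow> N (T \<phi>) \<le> C * N \<phi>" using op_bound[OF T] by metis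
  have Tm: "T (\<phi> k) \<in> H" for k using T \<phi> by (auto simp: op_mem)
  have TN: "N (T (\<phi> k)) \<le> C * M" for k
    using order_trans[OF C(2) mult_left_mono[OF M(2)]] \<phi> C(1) by simp
  have le: "cmod (ip (T (\<phi> k)) (e j)) \<le> C * M" for k j
    using norm_ip[OF Tm e_mem, of k j] TN[of k] by (simp add: norm_e)
  have "\<exists>r. strict_mono (r::nat\<Rightarrow>nat) \<and> (\<forall>j. \<exists>l. (\<lambda>k. ip (T (\<phi> (r k))) (e j)) \<longlonglongrightarrow> l)"
    by (rule function_convergent_subsequence[of UNIV "\<lambda>k j. ip (T (\<phi> k)) (e j)" "C * M"])
      (simp, use le in simp, blast)
  then obtain r where r: "strict_mono (r::nat\<Rightarrow>nat)"
    and "\<And>j. \<exists>l. (\<lambda>k. ip (T (\<phi> (r k))) (e j)) \<longlonglongrightarrow> l" by auto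
  then obtain c where c: "\<And>j. (\<lambda>k. ip (T (\<phi> (r k))) (e j)) \<longlonglongrightarrow> c j" by metis
  \<comment> \<open>Each finite sum passes to the limit under a bound that does not depend on n;
    this is what makes the limit coordinates square summable.\<close>
  have csum: "(\<Sum>j<n. (cmod (c j))\<^sup>2) \<le> (C * M)\<^sup>2" for n
  proof (rule LIMSEQ_le_const2)
    show "(\<lambda>k. \<Sum>j<n. (cmod (ip (T (\<phi> (r k))) (e j)))\<^sup>2) \<longlonglongrightarrow> (\<Sum>j<n. (cmod (c j))\<^sup>2)"
      by (intro tendsto_intros c)
    have "(\<Sum>j<n. (cmod (ip (T (\<phi> (r k))) (e j)))\<^sup>2) \<le> (C * M)\<^sup>2" for k
    proof -
      have "(\<Sum>j<n. (cmod (ip (T (\<phi> (r k))) (e j)))\<^sup>2) \<le> (N (T (\<phi> (r k))))\<^sup>2"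
        using sum_le_suminf[OF sums_summable[OF parseval[OF Tm[of "r k"]]], of "{..<n}"]
          sums_unique[OF parseval[OF Tm[of "r k"]]] by simp
      also have "\<dots> \<le> (C * M)\<^sup>2" using TN Tm norm_nonneg by (intro power_mono) auto
      finally show ?thesis .
    qed
    then show "\<exists>k0. \<forall>k\<ge>k0. (\<Sum>j<n. (cmod (ip (T (\<phi> (r k))) (e j)))\<^sup>2) \<le> (C * M)\<^sup>2" by blast
  qed
  then have "\<exists>\<psi>\<in>H. \<forall>j. ip \<psi> (e j) = c j"
    by (intro riesz_fischer bounded_imp_summable[where B="(C * M)\<^sup>2"])
      (auto simp: lessThan_Suc_atMost[symmetric] simp del: sum.lessThan_Suc)
  then obtain \<psi> where \<psi>: "\<psi> \<in> H" "\<And>j. ip \<psi> (e j) = c j" by auto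
  have "(\<lambda>k. N (\<lambda>x. T (\<phi> (r k)) x - \<psi> x)) \<longlonglongrightarrow> 0"
  proof (rule LIMSEQ_I)
    fix \<epsilon> :: real assume \<epsilon>: "\<epsilon> > 0"
    \<comment> \<open>\<open>M + 1\<close> keeps the denominator positive when \<open>M\<close> is
      0. The two tails and the first n coordinates each cost at most \<epsilon> / 4.\<close>
    obtain n1 where n1: "\<And>\<phi>. \<phi> \<in> H \<Longrightarrow> N (tail n1 (T \<phi>)) \<le> \<epsilon> / (4 * (M + 1)) * N \<phi>"
      using small[of "\<epsilon> / (4 * (M + 1))"] \<epsilon> M(1) by auto
    obtain n2 where n2: "N (tail n2 \<psi>) < \<epsilon> / 4"
      using order_tendstoD(2)[OF tail_tendsto[OF \<psi>(1)], of "\<epsilon> / 4"] \<epsilon>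
      by (auto simp: eventually_sequentially)
    define n where "n = max n1 n2"
    define d where "d k = (\<lambda>x. T (\<phi> (r k)) x - \<psi> x)" for k
    have d: "d k \<in> H" for k unfolding d_def using Tm \<psi> by (intro diff_mem)
    have "(\<lambda>k. (N (proj n (d k)))\<^sup>2) \<longlonglongrightarrow> (\<Sum>j<n. (cmod (c j - c j))\<^sup>2)"
      unfolding norm_proj d_def using c
      by (simp only: ip_diff_left Tm \<psi> e_mem) (intro tendsto_intros c)
    then have "(\<lambda>k. N (proj n (d k))) \<longlonglongrightarrow> 0"
      using tendsto_real_sqrt[of "\<lambda>k. (N (proj n (d k)))\<^sup>2" 0] by (simp add: norm_nonneg proj_mem)
    then obtain k0 where k0: "\<And>k. k \<ge> k0 \<Longrightarrow> N (proj n (d k)) < \<epsilon> / 4"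
      using order_tendstoD(2)[of _ 0 sequentially "\<epsilon> / 4"] \<epsilon> by (auto simp: eventually_sequentially)
    have t1: "N (tail n (T (\<phi> (r k)))) \<le> \<epsilon> / 4" for k
    proof -
      have "N (tail n (T (\<phi> (r k)))) \<le> N (tail n1 (T (\<phi> (r k))))"
        using Tm by (intro norm_tail_antimono) (auto simp: n_def)
      also have "\<dots> \<le> \<epsilon> / (4 * (M + 1)) * N (\<phi> (r k))" using \<phi> by (intro n1) auto
      also have "\<dots> \<le> \<epsilon> / (4 * (M + 1)) * (M + 1)"
        using \<epsilon> M order_trans[OF M(2), of "M + 1"] by (intro mult_left_mono) auto
      also have "\<dots> = \<epsilon> / 4" using M(1) by (simp add: field_simps)
      finally show ?thesis .
    qed
    have t2: "N (tail n \<psi>) < \<epsilon> / 4"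
      using norm_tail_antimono[OF \<psi>(1), of n2 n] n2 by (simp add: n_def)
    have "N (d k) < \<epsilon>" if "k \<ge> k0" for k
    proof -
      have "N (d k) \<le> N (\<lambda>x. d k x - proj n (d k) x) + N (proj n (d k))"
        using d by (intro norm_le_diff proj_mem)
      also have "(\<lambda>x. d k x - proj n (d k) x) = (\<lambda>x. tail n (T (\<phi> (r k))) x - tail n \<psi> x)"
        using tail_linear(2)[OF Tm \<psi>(1), of n "r k"] by (simp add: d_def tail_def)
      also have "N (\<lambda>x. tail n (T (\<phi> (r k))) x - tail n \<psi> x)
          \<le> N (tail n (T (\<phi> (r k)))) + N (tail n \<psi>)"
        using norm_diff_triangle[OF tail_mem[OF Tm] zero_mem tail_mem[OF \<psi>(1)], of n "r k" n]
          norm_sub_commute[OF zero_mem tail_mem[OF \<psi>(1)], of n] by simp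
      finally show ?thesis using t1[of k] t2 k0[OF that] \<epsilon> by linarith
    qed
    then show "\<exists>no. \<forall>k\<ge>no. norm (N (\<lambda>x. T (\<phi> (r k)) x - \<psi> x) - 0) < \<epsilon>"
      using norm_nonneg[OF d] by (auto simp: d_def)
  qed
  then show "\<exists>r \<psi>. strict_mono (r::nat\<Rightarrow>nat) \<and> \<psi> \<in> H \<and> (\<lambda>k. N (\<lambda>x. T (\<phi> (r k)) x - \<psi> x)) \<longlonglongrightarrow> 0"
    using r \<psi>(1) by blast
qed

lemma compact_zero: "op_zero H \<in> K"
  by (rule compactI_tail)
    (auto simp: op_zero_bounded op_apply tail_def proj_def ip_zero_left e_mem norm_zero norm_nonneg)

lemma compact_add:
  assumes S: "S \<in> K" and T: "T \<in> K" shows "op_add H S T \<in> K"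
proof (rule compactI_tail)
  fix \<epsilon> :: real assume "\<epsilon> > 0"
  obtain m where m: "\<And>\<phi>. \<phi> \<in> H \<Longrightarrow> N (tail m (S \<phi>)) \<le> \<epsilon> / 2 * N \<phi>"
    using compact_tail[OF S, of "\<epsilon> / 2"] \<open>\<epsilon> > 0\<close> by auto
  obtain n where n: "\<And>\<phi>. \<phi> \<in> H \<Longrightarrow> N (tail n (T \<phi>)) \<le> \<epsilon> / 2 * N \<phi>"
    using compact_tail[OF T, of "\<epsilon> / 2"] \<open>\<epsilon> > 0\<close> by auto
  have "N (tail (max m n) (op_add H S T \<phi>)) \<le> \<epsilon> * N \<phi>" if \<phi>: "\<phi> \<in> H" for \<phi>
  proof -
    have mem: "S \<phi> \<in> H" "T \<phi> \<in> H" using S T \<phi> by (auto simp: op_mem compact_bounded)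
    have "N (tail (max m n) (op_add H S T \<phi>)) \<le> N (tail (max m n) (S \<phi>)) + N (tail (max m n) (T \<phi>))"
      using norm_triangle[OF tail_mem[OF mem(1)] tail_mem[OF mem(2)]] \<phi> mem
      by (simp add: op_apply tail_linear)
    also have "\<dots> \<le> N (tail m (S \<phi>)) + N (tail n (T \<phi>))"
      using mem by (intro add_mono norm_tail_antimono) auto
    finally show ?thesis using m[OF \<phi>] n[OF \<phi>] by simp
  qed
  then show "\<exists>n. \<forall>\<phi>\<in>H. N (tail n (op_add H S T \<phi>)) \<le> \<epsilon> * N \<phi>" by blast
qed (use assms in \<open>auto simp: compact_bounded bounded_intros\<close>)

text \<open>A left factor does not respect coordinate tails, so here the subsequence definition is
  used: by continuity, \<open>S\<close> carries the convergent subsequence along.\<close>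

lemma compact_compose_left:
  assumes S: "S \<in> B" and T: "T \<in> K" shows "compose H S T \<in> K"
  unfolding compact_ops_def
proof (intro CollectI conjI allI impI, goal_cases)
  case 1
  show ?case by (intro compose_bounded S compact_bounded[OF T])
next
  case (2 \<phi>)
  then obtain M where M: "\<And>k. \<phi> k \<in> H" "\<And>k. N (\<phi> k) \<le> M" by auto
  obtain r \<psi> where r: "strict_mono r" "\<psi> \<in> H" "(\<lambda>k. N (\<lambda>x. T (\<phi> (r k)) x - \<psi> x)) \<longlonglongrightarrow> 0"
    using compact_opsD[OF T M, of "\<lambda>k. k"] by (elim exE conjE) (rule that)
  have Tm: "T (\<phi> k) \<in> H" for k using T M by (auto simp: op_mem compact_bounded)
  obtain C where C: "\<And>\<phi>. \<phi> \<in> H \<Longrightarrow> N (S \<phi>) \<le> C * N \<phi>" using op_bound[OF S] by metis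
  have "norm (N (\<lambda>x. compose H S T (\<phi> (r k)) x - S \<psi> x)) \<le> C * N (\<lambda>x. T (\<phi> (r k)) x - \<psi> x)" for k
    using C[OF diff_mem[OF Tm r(2)], of "r k"] norm_nonneg[OF op_mem[OF S diff_mem[OF Tm r(2)]], of "r k"]
    by (simp add: op_apply M op_minus[OF S Tm r(2)])
  then have "(\<lambda>k. N (\<lambda>x. compose H S T (\<phi> (r k)) x - S \<psi> x)) \<longlonglongrightarrow> 0"
    by (intro Lim_null_comparison[OF _ tendsto_mult_right_zero[OF r(3), of C]]) auto
  then show ?case using r S by (intro exI[of _ r] exI[of _ "S \<psi>"]) (auto simp: op_mem)
qed

lemma compact_compose_right:
  assumes S: "S \<in> B" and T: "T \<in> K" shows "compose H T S \<in> K"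
proof (rule compactI_tail)
  fix \<epsilon> :: real assume "\<epsilon> > 0"
  obtain C where C: "C > 0" "\<And>\<phi>. \<phi> \<in> H \<Longrightarrow> N (S \<phi>) \<le> C * N \<phi>" using op_bound[OF S] by metis
  obtain n where n: "\<And>\<phi>. \<phi> \<in> H \<Longrightarrow> N (tail n (T \<phi>)) \<le> \<epsilon> / C * N \<phi>"
    using compact_tail[OF T, of "\<epsilon> / C"] \<open>\<epsilon> > 0\<close> C(1) by auto
  have "N (tail n (compose H T S \<phi>)) \<le> \<epsilon> * N \<phi>" if \<phi>: "\<phi> \<in> H" for \<phi>
  proof -
    have "N (tail n (compose H T S \<phi>)) \<le> \<epsilon> / C * N (S \<phi>)"
      using n[of "S \<phi>"] S \<phi> by (simp add: op_apply op_mem)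
    also have "\<dots> \<le> \<epsilon> / C * (C * N \<phi>)"
      using C \<phi> \<open>\<epsilon> > 0\<close> by (intro mult_left_mono) auto
    finally show ?thesis using C(1) by simp
  qed
  then show "\<exists>n. \<forall>\<phi>\<in>H. N (tail n (compose H T S \<phi>)) \<le> \<epsilon> * N \<phi>" by blast
qed (use assms in \<open>auto simp: compact_bounded bounded_intros\<close>)

text \<open>Scaling is left multiplication by a multiple of the identity.\<close>

lemma compact_scale: "T \<in> K \<Longrightarrow> op_scale H c T \<in> K"
proof -
  assume T: "T \<in> K"
  have id: "restrict (\<lambda>\<phi>. \<phi>) H \<in> B"
    by (rule bounded_opsI[where M=1]) (auto simp: mem_intros)
  have "compose H (op_scale H c (restrict (\<lambda>\<phi>. \<phi>) H)) T \<in> K"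
    by (intro compact_compose_left op_scale_bounded id T)
  also have "compose H (op_scale H c (restrict (\<lambda>\<phi>. \<phi>) H)) T = op_scale H c T"
    using T by (intro op_eqI bounded_intros id) (auto simp: compact_bounded op_apply op_mem)
  finally show ?thesis .
qed

lemma compact_closed: "op_norm_closed H ip K"
proof (rule op_norm_closedI)
  fix L assume L: "L \<in> B" and
    lim: "\<And>\<epsilon>. \<epsilon> > 0 \<Longrightarrow> \<exists>T\<in>K. \<forall>\<phi>\<in>H. N (\<lambda>x. T \<phi> x - L \<phi> x) \<le> \<epsilon> * N \<phi>"
  show "L \<in> K"
  proof (rule compactI_tail[OF L])
    fix \<epsilon> :: real assume "\<epsilon> > 0"
    then obtain T where T: "T \<in> K" and d: "\<And>\<phi>. \<phi> \<in> H \<Longrightarrow> N (\<lambda>x. T \<phi> x - L \<phi> x) \<le> \<epsilon> / 2 * N \<phi>"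
      using lim[of "\<epsilon> / 2"] by auto
    obtain n where n: "\<And>\<phi>. \<phi> \<in> H \<Longrightarrow> N (tail n (T \<phi>)) \<le> \<epsilon> / 2 * N \<phi>"
      using compact_tail[OF T, of "\<epsilon> / 2"] \<open>\<epsilon> > 0\<close> by auto
    have "N (tail n (L \<phi>)) \<le> \<epsilon> * N \<phi>" if \<phi>: "\<phi> \<in> H" for \<phi>
    proof -
      have m: "T \<phi> \<in> H" "L \<phi> \<in> H" using T L \<phi> by (auto simp: op_mem compact_bounded)
      have "N (tail n (L \<phi>)) \<le> N (\<lambda>x. tail n (L \<phi>) x - tail n (T \<phi>) x) + N (tail n (T \<phi>))"
        using m by (intro norm_le_diff tail_mem)
      also have "N (\<lambda>x. tail n (L \<phi>) x - tail n (T \<phi>) x) = N (tail n (\<lambda>x. T \<phi> x - L \<phi> x))"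
        using m norm_sub_commute[OF tail_mem tail_mem] by (simp add: tail_linear)
      also have "\<dots> \<le> \<epsilon> / 2 * N \<phi>"
        using norm_tail_le[OF diff_mem[OF m], of n] d[OF \<phi>] by simp
      finally show ?thesis using n[OF \<phi>] by simp
    qed
    then show "\<exists>n. \<forall>\<phi>\<in>H. N (tail n (L \<phi>)) \<le> \<epsilon> * N \<phi>" by blast
  qed
qed (auto simp: compact_bounded)

section \<open>Rank one operators\<close>

definition rank_one :: "('a \<Rightarrow> complex) \<Rightarrow> ('a \<Rightarrow> complex) \<Rightarrow> 'a op" where
  "rank_one u v = (\<lambda>\<phi>\<in>H. \<lambda>x. ip \<phi> v * u x)"

lemma rank_one_apply: "\<phi> \<in> H \<Longrightarrow> rank_one u v \<phi> = (\<lambda>x. ip \<phi> v * u x)"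
  by (simp add: rank_one_def)

lemma rank_one_bounded:
  assumes "u \<in> H" "v \<in> H" shows "rank_one u v \<in> B"
proof (rule bounded_opsI[where M="N u * N v"])
  fix \<phi> assume \<phi>: "\<phi> \<in> H"
  have "N (rank_one u v \<phi>) = cmod (ip \<phi> v) * N u"
    using \<phi> assms by (simp add: rank_one_apply norm_scale)
  also have "\<dots> \<le> (N \<phi> * N v) * N u"
    by (rule mult_right_mono[OF norm_ip[OF \<phi> assms(2)] norm_nonneg[OF assms(1)]])
  finally show "N (rank_one u v \<phi>) \<le> (N u * N v) * N \<phi>" by (simp add: mult_ac)
qed (use assms in \<open>auto simp: rank_one_apply mem_intros ip_simps distrib_right mult.assoc\<close>,
    simp add: rank_one_def)

lemma compose_rank_one:
  "T \<in> B \<Longrightarrow> u \<in> H \<Longrightarrow> v \<in> H \<Longrightarrow> compose H T (rank_one u v) = rank_one (T u) v"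
  by (intro op_eqI bounded_intros rank_one_bounded) (auto simp: op_apply rank_one_apply op_mem op_times)

text \<open>A right factor reaches the second vector through its adjoint, since <T \<phi>, v> =
  <\<phi>, T* v>.\<close>

lemma rank_one_compose:
  "T \<in> B \<Longrightarrow> u \<in> H \<Longrightarrow> v \<in> H \<Longrightarrow> compose H (rank_one u v) T = rank_one u (adj T v)"
  by (intro op_eqI bounded_intros rank_one_bounded)
    (auto simp: op_apply rank_one_apply op_mem ip_adj_right adj_bounded)

lemma rank_one_add_left:
  "u \<in> H \<Longrightarrow> u' \<in> H \<Longrightarrow> v \<in> H \<Longrightarrow>
    rank_one (\<lambda>x. u x + u' x) v = op_add H (rank_one u v) (rank_one u' v)"
  by (intro op_eqI bounded_intros rank_one_bounded)
    (auto simp: op_apply rank_one_apply mem_intros algebra_simps)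

lemma rank_one_add_right:
  "u \<in> H \<Longrightarrow> v \<in> H \<Longrightarrow> v' \<in> H \<Longrightarrow>
    rank_one u (\<lambda>x. v x + v' x) = op_add H (rank_one u v) (rank_one u v')"
  by (intro op_eqI bounded_intros rank_one_bounded)
    (auto simp: op_apply rank_one_apply mem_intros ip_simps algebra_simps)

lemma rank_one_scale_left:
  "u \<in> H \<Longrightarrow> v \<in> H \<Longrightarrow> rank_one (\<lambda>x. c * u x) v = op_scale H c (rank_one u v)"
  by (intro op_eqI bounded_intros rank_one_bounded)
    (auto simp: op_apply rank_one_apply mem_intros algebra_simps)

lemma rank_one_scale_right:
  "u \<in> H \<Longrightarrow> v \<in> H \<Longrightarrow> rank_one u (\<lambda>x. c * v x) = op_scale H (cnj c) (rank_one u v)"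
  by (intro op_eqI bounded_intros rank_one_bounded)
    (auto simp: op_apply rank_one_apply mem_intros ip_simps algebra_simps)

lemma op_subspace_sum:
  assumes "op_subspace H J" "\<And>k. k < n \<Longrightarrow> T k \<in> J"
  shows "(\<lambda>\<phi>\<in>H. \<lambda>x. \<Sum>k<(n::nat). T k \<phi> x) \<in> J"
  using assms(2)
proof (induction n)
  case 0
  then show ?case using assms(1) by (simp add: op_subspace_def op_zero_def restrict_def)
next
  case (Suc n)
  have "(\<lambda>\<phi>\<in>H. \<lambda>x. \<Sum>k<Suc n. T k \<phi> x) = op_add H (\<lambda>\<phi>\<in>H. \<lambda>x. \<Sum>k<n. T k \<phi> x) (T n)"
    by (auto simp: op_add_def)
  moreover have "(\<lambda>\<phi>\<in>H. \<lambda>x. \<Sum>k<n. T k \<phi> x) \<in> J" by (rule Suc.IH) (use Suc.prems in auto)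
  ultimately show ?case using assms(1) Suc.prems[of n] unfolding op_subspace_def by (metis lessI)
qed

text \<open>Finite combinations of matrix units in one row, followed by a norm limit, give every
  rank one operator with left vector \<open>e i\<close>. The compression of T to its first n output
  coordinates is the sum of the rank one operators with vectors \<open>e k\<close> and T*
  (\<open>e k\<close>), and it approximates T in norm because the tails of a compact operator are
  uniformly small.\<close>

lemma compact_subset_closed_subspace:
  assumes J: "J \<subseteq> B" "op_subspace H J" "op_norm_closed H ip J"
    and units: "\<And>i j. rank_one (e i) (e j) \<in> J"
  shows "K \<subseteq> J"
proof
  have proj: "rank_one (e i) (proj n v) \<in> J" if "v \<in> H" for i n v
  proof -
    have "(\<lambda>\<phi>\<in>H. \<lambda>x. \<Sum>k<n. op_scale H (cnj (ip v (e k))) (rank_one (e i) (e k)) \<phi> x) \<in> J"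
      using J(2) units by (intro op_subspace_sum) (auto simp: op_subspace_def)
    also have "(\<lambda>\<phi>\<in>H. \<lambda>x. \<Sum>k<n. op_scale H (cnj (ip v (e k))) (rank_one (e i) (e k)) \<phi> x)
        = rank_one (e i) (proj n v)"
      unfolding rank_one_def
    proof (rule restrict_ext)
      fix \<phi> assume \<phi>: "\<phi> \<in> H"
      have "ip \<phi> (proj n v) = cnj (\<Sum>k<n. ip v (e k) * ip (e k) \<phi>)"
        using ip_commute[OF \<phi> proj_mem] \<phi> unfolding proj_def by (simp add: ip_combination)
      also have "\<dots> = (\<Sum>k<n. cnj (ip v (e k)) * ip \<phi> (e k))"
        using ip_commute[OF \<phi> e_mem] by simp
      finally show "(\<lambda>x. \<Sum>k<n. op_scale H (cnj (ip v (e k))) (\<lambda>\<phi>\<in>H. \<lambda>x. ip \<phi> (e k) * e i x) \<phi> x)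
          = (\<lambda>x. ip \<phi> (proj n v) * e i x)"
        using \<phi> by (simp add: op_apply sum_distrib_right mult.assoc)
    qed
    finally show ?thesis .
  qed
  have col: "rank_one (e i) v \<in> J" if v: "v \<in> H" for i v
  proof (rule op_norm_closedD[OF J(3,1)])
    fix \<epsilon> :: real assume "\<epsilon> > 0"
    then obtain n where n: "N (tail n v) < \<epsilon>"
      using order_tendstoD(2)[OF tail_tendsto[OF v], of \<epsilon>] by (auto simp: eventually_sequentially)
    have "N (\<lambda>x. rank_one (e i) (proj n v) \<phi> x - rank_one (e i) v \<phi> x) \<le> \<epsilon> * N \<phi>" if \<phi>: "\<phi> \<in> H" for \<phi>
    proof -
      have "(\<lambda>x. rank_one (e i) (proj n v) \<phi> x - rank_one (e i) v \<phi> x) = (\<lambda>x. (- ip \<phi> (tail n v)) * e i x)"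
        using \<phi> v by (simp add: rank_one_apply tail_def ip_simps proj_mem algebra_simps)
      then have "N (\<lambda>x. rank_one (e i) (proj n v) \<phi> x - rank_one (e i) v \<phi> x) = cmod (ip \<phi> (tail n v))"
        using norm_scale[OF e_mem, of "- ip \<phi> (tail n v)" i] by (simp add: norm_e)
      also have "\<dots> \<le> N \<phi> * N (tail n v)" using \<phi> v by (intro norm_ip tail_mem)
      also have "\<dots> \<le> N \<phi> * \<epsilon>" using n norm_nonneg[OF \<phi>] by (intro mult_left_mono) auto
      finally show ?thesis by (simp add: mult.commute)
    qed
    then show "\<exists>T\<in>J. \<forall>\<phi>\<in>H. N (\<lambda>x. T \<phi> x - rank_one (e i) v \<phi> x) \<le> \<epsilon> * N \<phi>"
      using proj[OF v] by blast
  qed (use v in \<open>auto intro: rank_one_bounded e_mem\<close>)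
  fix T assume T: "T \<in> K"
  then have TB: "T \<in> B" by (rule compact_bounded)
  show "T \<in> J"
  proof (rule op_norm_closedD[OF J(3,1) TB])
    fix \<epsilon> :: real assume "\<epsilon> > 0"
    then obtain n where n: "\<And>\<phi>. \<phi> \<in> H \<Longrightarrow> N (tail n (T \<phi>)) \<le> \<epsilon> * N \<phi>"
      using compact_tail[OF T] by blast
    define S where "S = (\<lambda>\<phi>\<in>H. \<lambda>x. \<Sum>k<n. rank_one (e k) (adj T (e k)) \<phi> x)"
    have "S \<in> J"
      unfolding S_def by (intro op_subspace_sum J(2) col op_mem[OF adj_bounded[OF TB] e_mem])
    moreover have "N (\<lambda>x. S \<phi> x - T \<phi> x) \<le> \<epsilon> * N \<phi>" if \<phi>: "\<phi> \<in> H" for \<phi>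
    proof -
      have "S \<phi> = proj n (T \<phi>)"
        using \<phi> TB by (simp add: S_def proj_def rank_one_apply ip_adj_right e_mem)
      then show ?thesis
        using n[OF \<phi>] norm_sub_commute[OF proj_mem op_mem[OF TB \<phi>]] by (simp add: tail_def)
    qed
    ultimately show "\<exists>S\<in>J. \<forall>\<phi>\<in>H. N (\<lambda>x. S \<phi> x - T \<phi> x) \<le> \<epsilon> * N \<phi>" by blast
  qed
qed


section \<open>Commutators modulo the compact operators\<close>

abbreviation commutator :: "'a op \<Rightarrow> 'a op \<Rightarrow> 'a op" where
  "commutator S T \<equiv> op_diff H (compose H S T) (compose H T S)"

text \<open>Makes the family intersected in \<open>cstar_generated\<close> nonempty, so that the
  generated algebra consists of bounded operators.\<close>

lemma cstar_subalgebra_bounded: "cstar_subalgebra H ip B"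
  unfolding cstar_subalgebra_def op_subspace_def op_norm_closed_def
  by (auto intro: bounded_intros adj_bounded)

lemma cstar_generated_cstar_subalgebra:
  assumes "T \<in> B" shows "cstar_subalgebra H ip (cstar_generated H ip T)"
proof -
  have sub: "cstar_generated H ip T \<subseteq> B"
    unfolding cstar_generated_def using cstar_subalgebra_bounded assms by auto
  show ?thesis
    unfolding cstar_subalgebra_def
  proof (intro conjI sub)
    show "op_subspace H (cstar_generated H ip T)"
      unfolding cstar_generated_def op_subspace_def cstar_subalgebra_def by blast
    show "\<forall>S\<in>cstar_generated H ip T. \<forall>R\<in>cstar_generated H ip T. compose H S R \<in> cstar_generated H ip T"
      "\<forall>S\<in>cstar_generated H ip T. adj S \<in> cstar_generated H ip T"
      unfolding cstar_generated_def cstar_subalgebra_def by blast+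
    show "op_norm_closed H ip (cstar_generated H ip T)"
    proof (rule op_norm_closedI[OF sub])
      fix L assume L: "L \<in> B" and
        lim: "\<And>\<epsilon>. \<epsilon> > 0 \<Longrightarrow> \<exists>S\<in>cstar_generated H ip T. \<forall>\<phi>\<in>H. N (\<lambda>x. S \<phi> x - L \<phi> x) \<le> \<epsilon> * N \<phi>"
      have "L \<in> A" if A: "cstar_subalgebra H ip A" "T \<in> A" for A
      proof (rule op_norm_closedD[OF _ _ L])
        show "op_norm_closed H ip A" "A \<subseteq> B" using A by (auto simp: cstar_subalgebra_def)
        have "cstar_generated H ip T \<subseteq> A" using A by (auto simp: cstar_generated_def)
        then show "\<exists>S\<in>A. \<forall>\<phi>\<in>H. N (\<lambda>x. S \<phi> x - L \<phi> x) \<le> \<epsilon> * N \<phi>" if "\<epsilon> > 0" for \<epsilon>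
          using lim[OF that] by (meson subsetD)
      qed
      then show "L \<in> cstar_generated H ip T" by (auto simp: cstar_generated_def)
    qed
  qed
qed

lemma op_norm_closed_Int:
  assumes "op_norm_closed H ip A" "op_norm_closed H ip A'"
  shows "op_norm_closed H ip (A \<inter> A')"
  unfolding op_norm_closed_def
proof (intro allI impI, elim conjE, intro IntI)
  fix T :: "nat \<Rightarrow> 'a op" and L
  assume *: "\<forall>k. T k \<in> A \<inter> A'" "L \<in> B" "(\<lambda>k. op_norm H ip (op_diff H (T k) L)) \<longlonglongrightarrow> 0"
  show "L \<in> A" by (rule assms(1)[unfolded op_norm_closed_def, rule_format, of T]) (use * in auto)
  show "L \<in> A'" by (rule assms(2)[unfolded op_norm_closed_def, rule_format, of T]) (use * in auto)
qed

lemma cstar_generated_self: "T \<in> cstar_generated H ip T"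
  by (auto simp: cstar_generated_def)

lemma cstar_generated_minimal:
  "cstar_subalgebra H ip A \<Longrightarrow> T \<in> A \<Longrightarrow> cstar_generated H ip T \<subseteq> A"
  by (auto simp: cstar_generated_def)

text \<open>
  Adding the condition on the adjoint makes this ideal self-adjoint by construction, which avoids
  Schauder's theorem.
\<close>

definition star_compact :: "'a op set" where
  "star_compact = {T \<in> K. adj T \<in> K}"

lemma star_compact_bounded: "T \<in> star_compact \<Longrightarrow> T \<in> B"
  by (simp add: star_compact_def compact_bounded)

lemma star_compact_subspace: "op_subspace H star_compact"
  unfolding op_subspace_def star_compact_def
  by (auto simp: compact_zero adj_zero adj_add adj_scale compact_add compact_scale compact_bounded)

lemma star_compact_compose:
  "S \<in> B \<Longrightarrow> T \<in> star_compact \<Longrightarrow> compose H S T \<in> star_compact"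
  "S \<in> B \<Longrightarrow> T \<in> star_compact \<Longrightarrow> compose H T S \<in> star_compact"
  unfolding star_compact_def
  by (auto simp: compact_compose_left compact_compose_right adj_compose adj_bounded compact_bounded)

lemma star_compact_adj: "T \<in> star_compact \<Longrightarrow> adj T \<in> star_compact"
  unfolding star_compact_def by (auto simp: adj_adj compact_bounded)

text \<open>Passing to adjoints preserves norm bounds, so an approximation of \<open>L\<close> is at
  once one of \<open>adj L\<close>, and closedness of \<open>K\<close> applies to both.\<close>

lemma star_compact_closed: "op_norm_closed H ip star_compact"
proof (rule op_norm_closedI)
  fix L assume L: "L \<in> B" and
    lim: "\<And>\<epsilon>. \<epsilon> > 0 \<Longrightarrow> \<exists>T\<in>star_compact. \<forall>\<phi>\<in>H. N (\<lambda>x. T \<phi> x - L \<phi> x) \<le> \<epsilon> * N \<phi>"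
  have "L \<in> K"
    using lim by (intro op_norm_closedD[OF compact_closed _ L]) (auto simp: star_compact_def compact_bounded)
  moreover have "adj L \<in> K"
  proof (rule op_norm_closedD[OF compact_closed])
    fix \<epsilon> :: real assume "\<epsilon> > 0"
    then obtain T where T: "T \<in> star_compact" "\<And>\<phi>. \<phi> \<in> H \<Longrightarrow> N (\<lambda>x. T \<phi> x - L \<phi> x) \<le> \<epsilon> * N \<phi>"
      using lim by blast
    have TB: "T \<in> B" using T(1) by (rule star_compact_bounded)
    have "N (adj (op_diff H T L) \<phi>) \<le> \<epsilon> * N \<phi>" if "\<phi> \<in> H" for \<phi>
      using that L TB T(2) \<open>\<epsilon> > 0\<close> by (intro adj_norm_le) (auto simp: op_apply bounded_intros)
    then have "N (\<lambda>x. adj T \<phi> x - adj L \<phi> x) \<le> \<epsilon> * N \<phi>" if "\<phi> \<in> H" for \<phi>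
      using that L TB by (simp add: adj_diff op_apply)
    then show "\<exists>T\<in>K. \<forall>\<phi>\<in>H. N (\<lambda>x. T \<phi> x - adj L \<phi> x) \<le> \<epsilon> * N \<phi>"
      using T(1) by (auto simp: star_compact_def)
  qed (use L in \<open>auto simp: compact_bounded adj_bounded\<close>)
  ultimately show "L \<in> star_compact" by (simp add: star_compact_def)
qed (auto simp: star_compact_bounded)

section \<open>Calculus of commutators\<close>

lemma commutator_add_left:
  "S \<in> B \<Longrightarrow> S' \<in> B \<Longrightarrow> T \<in> B \<Longrightarrow>
    commutator (op_add H S S') T = op_add H (commutator S T) (commutator S' T)"
  by (intro op_eqI bounded_intros) (auto simp: op_apply op_mem op_linear algebra_simps)

lemma commutator_scale_left:
  "S \<in> B \<Longrightarrow> T \<in> B \<Longrightarrow> commutator (op_scale H c S) T = op_scale H c (commutator S T)"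
  by (intro op_eqI bounded_intros) (auto simp: op_apply op_mem op_linear algebra_simps)

text \<open>The Leibniz rule. It makes commutation modulo an ideal stable under products.\<close>

lemma commutator_compose_left:
  "S \<in> B \<Longrightarrow> S' \<in> B \<Longrightarrow> T \<in> B \<Longrightarrow> commutator (compose H S S') T =
    op_add H (compose H S (commutator S' T)) (compose H (commutator S T) S')"
  by (intro op_eqI bounded_intros) (auto simp: op_apply op_mem op_linear algebra_simps)

lemma commutator_adj_left:
  "S \<in> B \<Longrightarrow> T \<in> B \<Longrightarrow> commutator (adj S) T = op_scale H (-1) (adj (commutator S (adj T)))"
  by (simp add: adj_diff adj_compose adj_adj adj_bounded bounded_intros)
     (intro op_eqI bounded_intros adj_bounded,
       auto simp: op_apply op_mem op_linear algebra_simps adj_bounded)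

text \<open>For fixed T, taking the commutator with T is a norm continuous derivation, and
  \<open>star_compact\<close> is a closed ideal, so sums, products and limits stay in the set.
  Adjoints rest on [S*, T] = - [S, T*]*, for which both \<open>W\<close> and the ideal have to be
  self-adjoint.\<close>

lemma essential_commutant_cstar_subalgebra:
  assumes W: "W \<subseteq> B" "\<And>T. T \<in> W \<Longrightarrow> adj T \<in> W"
  shows "cstar_subalgebra H ip {S \<in> B. \<forall>T\<in>W. commutator S T \<in> star_compact}"
    (is "cstar_subalgebra H ip ?A")
proof -
  have sub: "?A \<subseteq> B" by auto
  have WB: "T \<in> B" if "T \<in> W" for T using W that by auto
  note ss = star_compact_subspace[unfolded op_subspace_def]
  have zero: "op_zero H \<in> ?A"
  proof -
    have "commutator (op_zero H) T = op_zero H" if "T \<in> W" for T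
      using WB[OF that] by (intro op_eqI bounded_intros) (auto simp: op_apply op_mem zero_mem op_linear)
    then show ?thesis using ss by (auto simp: op_zero_bounded)
  qed
  have closed: "op_norm_closed H ip ?A"
  proof (rule op_norm_closedI[OF sub])
    fix L assume L: "L \<in> B" and
      lim: "\<And>\<epsilon>. \<epsilon> > 0 \<Longrightarrow> \<exists>S\<in>?A. \<forall>\<phi>\<in>H. N (\<lambda>x. S \<phi> x - L \<phi> x) \<le> \<epsilon> * N \<phi>"
    have "commutator L T \<in> star_compact" if T: "T \<in> W" for T
    proof (rule op_norm_closedD[OF star_compact_closed])
      fix \<epsilon> :: real assume "\<epsilon> > 0"
      have TB: "T \<in> B" using WB T by auto
      obtain M where M: "M > 0" "\<And>\<phi>. \<phi> \<in> H \<Longrightarrow> N (T \<phi>) \<le> M * N \<phi>" using op_bound[OF TB] by metis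
      \<comment> \<open>The commutator of S - L with T has two terms, each at most M times the
        error; hence the divisor \<open>2 * M\<close>.\<close>
      obtain S where S: "S \<in> ?A" "\<And>\<phi>. \<phi> \<in> H \<Longrightarrow> N (\<lambda>x. S \<phi> x - L \<phi> x) \<le> \<epsilon> / (2 * M) * N \<phi>"
        using lim[of "\<epsilon> / (2 * M)"] \<open>\<epsilon> > 0\<close> M(1) by auto
      have SB: "S \<in> B" using S by auto
      have "N (\<lambda>x. commutator S T \<phi> x - commutator L T \<phi> x) \<le> \<epsilon> * N \<phi>" if \<phi>: "\<phi> \<in> H" for \<phi>
      proof -
        let ?D = "op_diff H S L"
        have D: "?D \<in> B" "\<And>\<phi>. \<phi> \<in> H \<Longrightarrow> N (?D \<phi>) \<le> \<epsilon> / (2 * M) * N \<phi>"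
          using SB L S(2) by (auto simp: bounded_intros op_apply)
        have eq: "(\<lambda>x. commutator S T \<phi> x - commutator L T \<phi> x) = (\<lambda>x. ?D (T \<phi>) x - T (?D \<phi>) x)"
          using SB L TB \<phi> by (simp add: op_apply op_mem op_linear algebra_simps)
        have "N (\<lambda>x. ?D (T \<phi>) x - T (?D \<phi>) x) \<le> N (?D (T \<phi>)) + N (T (?D \<phi>))"
          using norm_diff_triangle[of "?D (T \<phi>)" "\<lambda>x. 0" "T (?D \<phi>)"]
            norm_sub_commute[of "\<lambda>x. 0" "T (?D \<phi>)"] D(1) TB \<phi> by (simp add: op_mem zero_mem)
        also have "\<dots> \<le> \<epsilon> / (2 * M) * (M * N \<phi>) + M * (\<epsilon> / (2 * M) * N \<phi>)"
          using M \<open>\<epsilon> > 0\<close> \<phi> TB D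
          by (intro add_mono order_trans[OF D(2)] order_trans[OF M(2)] mult_left_mono) (auto simp: op_mem)
        also have "\<dots> = \<epsilon> * N \<phi>" using M(1) by (simp add: field_simps)
        finally show ?thesis unfolding eq .
      qed
      then show "\<exists>R\<in>star_compact. \<forall>\<phi>\<in>H. N (\<lambda>x. R \<phi> x - commutator L T \<phi> x) \<le> \<epsilon> * N \<phi>"
        using S(1) T by blast
    qed (use L WB T in \<open>auto simp: star_compact_bounded bounded_intros\<close>)
    then show "L \<in> ?A" using L by blast
  qed
  show ?thesis
    unfolding cstar_subalgebra_def op_subspace_def[of H ?A]
  proof (intro conjI ballI allI sub zero closed)
    fix S T assume "S \<in> ?A" "T \<in> ?A"
    then show "op_add H S T \<in> ?A" "compose H S T \<in> ?A"
      using ss star_compact_compose WB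
      by (auto simp: commutator_add_left commutator_compose_left bounded_intros)
  next
    fix S c assume "S \<in> ?A"
    then show "op_scale H c S \<in> ?A"
      using ss WB by (auto simp: commutator_scale_left bounded_intros)
  next
    fix S assume S: "S \<in> ?A"
    have "commutator (adj S) T \<in> star_compact" if T: "T \<in> W" for T
    proof -
      have "commutator S (adj T) \<in> star_compact" using S W(2)[OF T] by auto
      then have "op_scale H (-1) (adj (commutator S (adj T))) \<in> star_compact"
        using ss star_compact_adj by blast
      then show ?thesis using S WB[OF T] by (simp add: commutator_adj_left)
    qed
    then show "adj S \<in> ?A" using S by (auto simp: adj_bounded)
  qed
qed

text \<open>The essential commutant is formed twice. For \<open>W\<close> consisting of z and its
  adjoint it contains z, hence all of the generated algebra. By this, the essential commutant of the
  whole algebra again contains z, hence the whole algebra, which is commutativity modulo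
  \<open>star_compact\<close>.\<close>

theorem commutator_ideal_subset_compact:
  assumes z: "z \<in> B" and self: "commutator (adj z) z \<in> K"
  shows "commutator_ideal H ip (cstar_generated H ip z) \<subseteq> K"
proof -
  let ?A = "cstar_generated H ip z"
  have A: "cstar_subalgebra H ip ?A" "z \<in> ?A"
    using z by (simp_all add: cstar_generated_cstar_subalgebra cstar_generated_self)
  then have AB: "?A \<subseteq> B" and Aadj: "\<And>T. T \<in> ?A \<Longrightarrow> adj T \<in> ?A"
    by (auto simp: cstar_subalgebra_def)
  have az: "adj z \<in> B" using z by (rule adj_bounded)
  have "adj (commutator (adj z) z) = commutator (adj z) z"
    using z az by (simp add: adj_diff adj_compose adj_adj bounded_intros)
  then have sc: "commutator (adj z) z \<in> star_compact"
    using self by (simp add: star_compact_def)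
  have zero: "commutator T T = op_zero H" for T
    by (auto simp: op_diff_def op_zero_def)
  have neg: "commutator z (adj z) = op_scale H (-1) (commutator (adj z) z)"
    using z az by (intro op_eqI bounded_intros) (auto simp: op_apply)
  have c1: "commutator S T \<in> star_compact" if "S \<in> ?A" "T \<in> {z, adj z}" for S T
  proof -
    have "?A \<subseteq> {S \<in> B. \<forall>T\<in>{z, adj z}. commutator S T \<in> star_compact}"
      using z az sc star_compact_subspace
      by (intro cstar_generated_minimal essential_commutant_cstar_subalgebra)
        (auto simp: adj_adj zero neg op_subspace_def)
    then show ?thesis using that by blast
  qed
  have c2: "commutator S T \<in> star_compact" if "S \<in> ?A" "T \<in> ?A" for S T
  proof -
    have "commutator z T \<in> star_compact" if "T \<in> ?A" for T
    proof -
      have "commutator z T = op_scale H (-1) (commutator T z)"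
        using z AB that by (intro op_eqI bounded_intros) (auto simp: op_apply)
      then show ?thesis using c1[OF that, of z] star_compact_subspace by (simp add: op_subspace_def)
    qed
    then have "?A \<subseteq> {S \<in> B. \<forall>T\<in>?A. commutator S T \<in> star_compact}"
      using z
      by (intro cstar_generated_minimal[OF essential_commutant_cstar_subalgebra[OF AB Aadj]]) auto
    then show ?thesis using that by blast
  qed
  \<comment> \<open>\<open>closed_ideal\<close> asks for a subset of \<open>?A\<close>, and nothing
    so far places \<open>star_compact\<close> inside \<open>?A\<close>; hence the
    intersection.\<close>
  have "closed_ideal H ip ?A (?A \<inter> star_compact)"
    unfolding closed_ideal_def
  proof (intro conjI ballI)
    show "op_subspace H (?A \<inter> star_compact)"
      using A(1) star_compact_subspace unfolding cstar_subalgebra_def op_subspace_def by blast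
    show "op_norm_closed H ip (?A \<inter> star_compact)"
      using A(1) star_compact_closed by (intro op_norm_closed_Int) (auto simp: cstar_subalgebra_def)
    fix T S assume "T \<in> ?A" "S \<in> ?A \<inter> star_compact"
    then show "compose H T S \<in> ?A \<inter> star_compact" "compose H S T \<in> ?A \<inter> star_compact"
      using A(1) AB star_compact_compose unfolding cstar_subalgebra_def by blast+
  qed auto
  moreover have "commutator S T \<in> ?A" if "S \<in> ?A" "T \<in> ?A" for S T
    using that A(1) unfolding cstar_subalgebra_def op_subspace_def op_diff_conv by blast
  ultimately have "commutator_ideal H ip ?A \<subseteq> ?A \<inter> star_compact"
    unfolding commutator_ideal_def using c2 by blast
  then show ?thesis by (auto simp: star_compact_def)
qed

end

section \<open>The coordinate operator on a basis\<close>

text \<open>\<open>F n\<close> and \<open>G n\<close> stand for the basis vectors of index \<open>-1 - n\<close>.\<close>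

locale pants_shift = fun_hilbert_space +
  fixes z :: "'a op" and a r1 r2 :: real and E F G :: "nat \<Rightarrow> 'a \<Rightarrow> complex"
  assumes z_bounded: "z \<in> bounded_ops H ip"
    and params: "a > 0" "r1 > 0" "r2 > 0" "r1\<^sup>2 + r2\<^sup>2 < 1"
    and EFG_mem: "E n \<in> H" "F n \<in> H" "G n \<in> H"
    and EFG_orthonormal:
      "ip (E m) (E n) = (if m = n then 1 else 0)" "ip (F m) (F n) = (if m = n then 1 else 0)"
      "ip (G m) (G n) = (if m = n then 1 else 0)" "ip (E m) (F n) = 0" "ip (E m) (G n) = 0"
      "ip (F m) (E n) = 0" "ip (F m) (G n) = 0" "ip (G m) (E n) = 0" "ip (G m) (F n) = 0"
    and e_cases: "e k \<in> range E \<union> range F \<union> range G"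
    and z_E: "z (E n) = E (Suc n)"
    and z_F_0: "z (F 0) = (\<lambda>x. of_real r1 * E 0 x)"
    and z_F_Suc: "z (F (Suc n)) = (\<lambda>x. of_real r1 * F n x)"
    and z_G_0: "z (G 0) = (\<lambda>x. of_real r2 * E 0 x + of_real a * G 0 x)"
    and z_G_Suc: "z (G (Suc n)) = (\<lambda>x. of_real r2 * G n x + of_real a * G (Suc n) x)"
begin

lemmas z_basis = z_E z_F_0 z_F_Suc z_G_0 z_G_Suc

lemma basis_cases:
  assumes "\<And>n. P (E n)" "\<And>n. P (F n)" "\<And>n. P (G n)" shows "P (e k)"
  using e_cases[of k] assms by auto

lemma EFG_eqI:
  assumes "\<phi> \<in> H" "\<psi> \<in> H" "\<And>n. ip \<phi> (E n) = ip \<psi> (E n)" "\<And>n. ip \<phi> (F n) = ip \<psi> (F n)"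
    "\<And>n. ip \<phi> (G n) = ip \<psi> (G n)"
  shows "\<phi> = \<psi>"
  using assms(1,2)
proof (rule coeffs_eqI)
  show "ip \<phi> (e k) = ip \<psi> (e k)" for k
    by (rule basis_cases[where P="\<lambda>v. ip \<phi> v = ip \<psi> v"]) (use assms in auto)
qed

section \<open>The adjoint of the coordinate operator\<close>

abbreviation zs :: "'a op" where "zs \<equiv> adj z"

lemma zs_bounded: "zs \<in> B"
  using z_bounded by (rule adj_bounded)

lemma ip_z:
  assumes "\<phi> \<in> H"
  shows "ip (zs \<phi>) (E n) = ip \<phi> (E (Suc n))" "ip (zs \<phi>) (F 0) = of_real r1 * ip \<phi> (E 0)"
    "ip (zs \<phi>) (F (Suc n)) = of_real r1 * ip \<phi> (F n)"
    "ip (zs \<phi>) (G 0) = of_real r2 * ip \<phi> (E 0) + of_real a * ip \<phi> (G 0)"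
    "ip (zs \<phi>) (G (Suc n)) = of_real r2 * ip \<phi> (G n) + of_real a * ip \<phi> (G (Suc n))"
  using assms by (simp_all add: ip_adj_left z_bounded EFG_mem z_basis ip_simps mem_intros)

text \<open>The matrix of z is real, so the adjoint has the transposed one. Both \<open>F 0\<close>
  and \<open>G 0\<close> feed into \<open>E 0\<close>, hence the two terms of
  \<open>zs (E 0)\<close>; the case splits separate index 0, where \<open>ip_z\<close> has its own
  formulas.\<close>

lemma zs_basis:
  "zs (E 0) = (\<lambda>x. of_real r1 * F 0 x + of_real r2 * G 0 x)"
  "zs (E (Suc n)) = E n"
  "zs (F n) = (\<lambda>x. of_real r1 * F (Suc n) x)"
  "zs (G n) = (\<lambda>x. of_real r2 * G (Suc n) x + of_real a * G n x)"
proof -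
  note mem = EFG_mem op_mem[OF zs_bounded] mem_intros
  show "zs (E 0) = (\<lambda>x. of_real r1 * F 0 x + of_real r2 * G 0 x)"
  proof (rule EFG_eqI)
    fix n
    show "ip (zs (E 0)) (F n) = ip (\<lambda>x. of_real r1 * F 0 x + of_real r2 * G 0 x) (F n)"
      "ip (zs (E 0)) (G n) = ip (\<lambda>x. of_real r1 * F 0 x + of_real r2 * G 0 x) (G n)"
      by (cases n; simp add: mem ip_simps ip_z EFG_orthonormal)+
  qed (simp_all add: mem ip_simps ip_z EFG_orthonormal)
  show "zs (E (Suc n)) = E n"
  proof (rule EFG_eqI)
    fix m
    show "ip (zs (E (Suc n))) (F m) = ip (E n) (F m)" "ip (zs (E (Suc n))) (G m) = ip (E n) (G m)"
      by (cases m; simp add: mem ip_simps ip_z EFG_orthonormal)+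
  qed (simp_all add: mem ip_simps ip_z EFG_orthonormal)
  show "zs (F n) = (\<lambda>x. of_real r1 * F (Suc n) x)"
  proof (rule EFG_eqI)
    fix m
    show "ip (zs (F n)) (F m) = ip (\<lambda>x. of_real r1 * F (Suc n) x) (F m)"
      "ip (zs (F n)) (G m) = ip (\<lambda>x. of_real r1 * F (Suc n) x) (G m)"
      by (cases m; simp add: mem ip_simps ip_z EFG_orthonormal)+
  qed (simp_all add: mem ip_simps ip_z EFG_orthonormal)
  show "zs (G n) = (\<lambda>x. of_real r2 * G (Suc n) x + of_real a * G n x)"
  proof (rule EFG_eqI)
    fix m
    show "ip (zs (G n)) (F m) = ip (\<lambda>x. of_real r2 * G (Suc n) x + of_real a * G n x) (F m)"
      "ip (zs (G n)) (G m) = ip (\<lambda>x. of_real r2 * G (Suc n) x + of_real a * G n x) (G m)"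
      by (cases m; simp add: mem ip_simps ip_z EFG_orthonormal)+
  qed (simp_all add: mem ip_simps ip_z EFG_orthonormal)
qed

section \<open>The self-commutator and its matrix on three vectors\<close>

abbreviation D :: "'a op" where "D \<equiv> commutator zs z"

text \<open>The diagonal entry of \<open>D\<close> at \<open>E 0\<close>. On the span of
  \<open>E 0\<close>, \<open>F 0\<close>, \<open>G 0\<close> the determinant of \<open>D\<close> is
  - \<delta> r1^2 r2^2, so \<delta> being nonzero is what makes \<open>D\<close> invertible
  there.\<close>

definition \<delta> :: real where "\<delta> = 1 - r1\<^sup>2 - r2\<^sup>2"

lemma D_bounded: "D \<in> B"
  by (intro bounded_intros z_bounded zs_bounded)

lemma D_apply: "\<phi> \<in> H \<Longrightarrow> D \<phi> = (\<lambda>x. zs (z \<phi>) x - z (zs \<phi>) x)"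
  by (simp add: op_apply)

text \<open>At positive indices the two products of z and its adjoint agree: both act as the
  identity on \<open>E (Suc n)\<close>, as r1^2 on \<open>F (Suc n)\<close>, and send
  \<open>G (Suc n)\<close> to the same combination of itself and its two neighbours. Only where the
  three chains meet do they differ.\<close>

lemma D_basis:
  "D (E 0) = (\<lambda>x. of_real \<delta> * E 0 x - of_real (a * r2) * G 0 x)"
  "D (E (Suc n)) = (\<lambda>x. 0)"
  "D (F 0) = (\<lambda>x. of_real (r1 * r2) * G 0 x)"
  "D (F (Suc n)) = (\<lambda>x. 0)"
  "D (G 0) = (\<lambda>x. of_real (r1 * r2) * F 0 x - of_real (a * r2) * E 0 x)"
  "D (G (Suc n)) = (\<lambda>x. 0)"
  by (simp_all add: D_apply EFG_mem mem_intros z_basis zs_basis op_linear[OF z_bounded]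
      op_linear[OF zs_bounded] \<delta>_def algebra_simps power2_eq_square fun_eq_iff)

lemma adj_D: "adj D = D"
  by (simp add: adj_diff adj_compose adj_adj z_bounded zs_bounded bounded_intros)

text \<open>By self-adjointness, vanishing of \<open>D\<close> on a basis vector means vanishing of
  that coordinate of every \<open>D \<phi>\<close>. The positions of the three exceptional vectors
  in the enumeration are not specified, but injectivity of \<open>e\<close> leaves only finitely
  many, so some tail is identically zero.\<close>

lemma D_compact: "D \<in> K"
proof (rule compactI_tail[OF D_bounded])
  fix \<epsilon> :: real assume "\<epsilon> > 0"
  have inj: "inj e"
    by (rule injI) (metis ip_e zero_neq_one)
  have "finite (e -` {E 0, F 0, G 0})"
    by (intro finite_vimageI inj) auto
  then obtain n where n: "\<And>k. k \<ge> n \<Longrightarrow> e k \<notin> {E 0, F 0, G 0}"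
    using finite_nat_set_iff_bounded[of "e -` {E 0, F 0, G 0}"] by (auto simp: not_less[symmetric])
  have De: "D (e k) = (\<lambda>x. 0)" if "k \<ge> n" for k
  proof -
    have "e k \<notin> {E 0, F 0, G 0} \<longrightarrow> D (e k) = (\<lambda>x. 0)"
      by (rule basis_cases) (metis D_basis insertCI not0_implies_Suc)+
    then show ?thesis using n[OF that] by blast
  qed
  have "tail n (D \<phi>) = (\<lambda>x. 0)" if \<phi>: "\<phi> \<in> H" for \<phi>
  proof (rule coeffs_eqI)
    have "ip (D \<phi>) (e k) = 0" if "k \<ge> n" for k
      using ip_adj_left[OF D_bounded \<phi> e_mem, of k] De[OF that] \<phi> by (simp add: adj_D ip_simps)
    then show "ip (tail n (D \<phi>)) (e k) = ip (\<lambda>x. 0) (e k)" for k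
      using \<phi> unfolding tail_def
      by (simp add: ip_simps op_mem[OF D_bounded] proj_mem e_mem ip_proj)
  qed (use \<phi> in \<open>auto intro: tail_mem op_mem[OF D_bounded] zero_mem\<close>)
  then have "\<forall>\<phi>\<in>H. N (tail n (D \<phi>)) \<le> \<epsilon> * N \<phi>"
    using \<open>\<epsilon> > 0\<close> norm_nonneg by (simp add: norm_zero)
  then show "\<exists>n. \<forall>\<phi>\<in>H. N (tail n (D \<phi>)) \<le> \<epsilon> * N \<phi>" by (intro exI)
qed

lemma \<delta>_pos: "\<delta> > 0"
  using params by (simp add: \<delta>_def)

text \<open>Meant for the set \<open>X\<close> of left vectors u for which the rank one operator
  with a fixed right vector lies in the ideal, and for the mirrored set of right vectors. Such sets
  are subspaces stable under z and its adjoint, so one suitable vector in them produces the whole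
  basis.\<close>

lemma
  assumes X: "X \<subseteq> H"
    and add: "\<And>\<phi> \<psi>. \<phi> \<in> X \<Longrightarrow> \<psi> \<in> X \<Longrightarrow> (\<lambda>x. \<phi> x + \<psi> x) \<in> X"
    and scale: "\<And>\<phi> c. \<phi> \<in> X \<Longrightarrow> (\<lambda>x. c * \<phi> x) \<in> X"
    and z: "\<And>\<phi>. \<phi> \<in> X \<Longrightarrow> z \<phi> \<in> X" and zs: "\<And>\<phi>. \<phi> \<in> X \<Longrightarrow> zs \<phi> \<in> X"
  shows reducing_contains_G: "D (E 0) \<in> X \<Longrightarrow> G 0 \<in> X"
    and reducing_contains_basis: "G 0 \<in> X \<Longrightarrow> e k \<in> X"
proof -
  have lin: "(\<lambda>x. c * \<phi> x + d * \<psi> x) \<in> X" if "\<phi> \<in> X" "\<psi> \<in> X" for c d \<phi> \<psi>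
    using that by (intro add scale)
  have D: "D \<phi> \<in> X" if "\<phi> \<in> X" for \<phi>
  proof -
    have eq: "D \<phi> = (\<lambda>x. 1 * zs (z \<phi>) x + (-1) * z (zs \<phi>) x)"
      using that X by (auto simp: D_apply)
    show ?thesis unfolding eq by (intro lin z zs that)
  qed
  have D_comb: "D (\<lambda>x. c * \<phi> x - d * \<psi> x) = (\<lambda>x. c * D \<phi> x - d * D \<psi> x)"
    if "\<phi> \<in> H" "\<psi> \<in> H" for c d \<phi> \<psi>
    using that by (simp only: op_minus[OF D_bounded] op_times[OF D_bounded] scale_mem)
  note pos = params \<delta>_pos
  show "G 0 \<in> X" if u: "D (E 0) \<in> X"
  proof -
    \<comment> \<open>Since \<open>D (E 0)\<close> is \<delta> \<open>E 0\<close> - a r2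
      \<open>G 0\<close>, the vector v equals - a r2 \<open>D (G 0)\<close>, a combination of
      \<open>E 0\<close> and \<open>F 0\<close>. As \<open>D (F 0)\<close> is a multiple of
      \<open>G 0\<close>, one more \<open>D\<close> and subtraction of a multiple of
      \<open>D (E 0)\<close> leave a multiple of \<open>G 0\<close>.\<close>
    define v where "v = (\<lambda>x. 1 * D (D (E 0)) x + (- of_real \<delta>) * D (E 0) x)"
    have v: "v \<in> X" unfolding v_def using u D by (intro lin)
    have "D (\<lambda>x. of_real \<delta> * E 0 x - of_real (a * r2) * G 0 x)
        = (\<lambda>x. of_real \<delta> * D (E 0) x - of_real (a * r2) * D (G 0) x)"
      by (rule D_comb; rule EFG_mem)
    then have "D (D (E 0)) = (\<lambda>x. of_real \<delta> * D (E 0) x - of_real (a * r2) * D (G 0) x)"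
      unfolding D_basis(1)[symmetric] .
    then have "v = (\<lambda>x. of_real (a\<^sup>2 * r2\<^sup>2) * E 0 x - of_real (a * r1 * r2\<^sup>2) * F 0 x)"
      unfolding v_def D_basis(5) by (simp add: algebra_simps power2_eq_square)
    then have "D v = (\<lambda>x. of_real (a\<^sup>2 * r2\<^sup>2) * D (E 0) x - of_real (a * r1 * r2\<^sup>2) * D (F 0) x)"
      by (simp only: D_comb EFG_mem)
    then have Dv: "D v = (\<lambda>x. of_real (a\<^sup>2 * r2\<^sup>2) * D (E 0) x - of_real (a * r1\<^sup>2 * r2 ^ 3) * G 0 x)"
      unfolding D_basis(3) by (simp add: algebra_simps power2_eq_square power3_eq_cube)
    have "(\<lambda>x. (- 1 / of_real (a * r1\<^sup>2 * r2 ^ 3)) * D v x + (of_real (a\<^sup>2 * r2\<^sup>2) / of_real (a * r1\<^sup>2 * r2 ^ 3)) * D (E 0) x) \<in> X"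
      using u v D by (intro lin)
    also have "(\<lambda>x. (- 1 / of_real (a * r1\<^sup>2 * r2 ^ 3)) * D v x + (of_real (a\<^sup>2 * r2\<^sup>2) / of_real (a * r1\<^sup>2 * r2 ^ 3)) * D (E 0) x) = G 0"
      unfolding Dv using pos by (simp add: field_simps fun_eq_iff)
    finally show ?thesis .
  qed
  show "e k \<in> X" if G0: "G 0 \<in> X"
  proof -
    \<comment> \<open>p lies in the span of \<open>E 0\<close> and \<open>F 0\<close>, and
      \<open>D p\<close> in that of \<open>E 0\<close> and \<open>G 0\<close>, with coefficient - a
      r2 \<delta> at \<open>E 0\<close>. Removing the known \<open>G 0\<close> and dividing isolates
      \<open>E 0\<close>, which is where \<delta> has to be nonzero; p then yields
      \<open>F 0\<close>.\<close>
    define p where "p = D (G 0)"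
    have p: "p \<in> X" "D p \<in> X" unfolding p_def using D G0 by auto
    have p_eq: "p = (\<lambda>x. of_real (r1 * r2) * F 0 x - of_real (a * r2) * E 0 x)"
      unfolding p_def by (rule D_basis)
    have Dp: "D p = (\<lambda>x. of_real (r1\<^sup>2 * r2\<^sup>2 + a\<^sup>2 * r2\<^sup>2) * G 0 x - of_real (a * r2 * \<delta>) * E 0 x)"
      unfolding p_eq D_comb[OF EFG_mem(2,1)] D_basis by (simp add: algebra_simps power2_eq_square)
    have "(\<lambda>x. (- 1 / of_real (a * r2 * \<delta>)) * D p x + (of_real (r1\<^sup>2 * r2\<^sup>2 + a\<^sup>2 * r2\<^sup>2) / of_real (a * r2 * \<delta>)) * G 0 x) \<in> X"
      using p G0 by (intro lin)
    also have "(\<lambda>x. (- 1 / of_real (a * r2 * \<delta>)) * D p x + (of_real (r1\<^sup>2 * r2\<^sup>2 + a\<^sup>2 * r2\<^sup>2) / of_real (a * r2 * \<delta>)) * G 0 x) = E 0"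
      unfolding Dp using pos by (simp add: field_simps fun_eq_iff)
    finally have E0: "E 0 \<in> X" .
    have "(\<lambda>x. (1 / of_real (r1 * r2)) * p x + of_real (a / r1) * E 0 x) \<in> X"
      using p E0 by (intro lin)
    also have "(\<lambda>x. (1 / of_real (r1 * r2)) * p x + of_real (a / r1) * E 0 x) = F 0"
      unfolding p_eq using pos by (simp add: field_simps fun_eq_iff)
    finally have F0: "F 0 \<in> X" .
    \<comment> \<open>z climbs the chain of the \<open>E n\<close>, its adjoint the chains of the
      \<open>F n\<close> and \<open>G n\<close>; on the latter the diagonal term a
      \<open>G n\<close> has to be subtracted.\<close>
    have "E n \<in> X" for n
    proof (induction n)
      case (Suc n)
      then show ?case using z[of "E n"] by (simp add: z_basis)
    qed (rule E0)
    moreover have "F n \<in> X" for n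
    proof (induction n)
      case (Suc n)
      have "(\<lambda>x. (1 / of_real r1) * zs (F n) x) \<in> X" using Suc by (intro scale zs)
      then show ?case using pos by (simp add: zs_basis)
    qed (rule F0)
    moreover have "G n \<in> X" for n
    proof (induction n)
      case (Suc n)
      have "(\<lambda>x. (1 / of_real r2) * zs (G n) x + (- of_real (a / r2)) * G n x) \<in> X"
        using Suc by (intro lin zs)
      also have "(\<lambda>x. (1 / of_real r2) * zs (G n) x + (- of_real (a / r2)) * G n x) = G (Suc n)"
        using pos by (simp add: zs_basis field_simps fun_eq_iff)
      finally show ?case .
    qed (rule G0)
    ultimately show ?thesis by (rule basis_cases)
  qed
qed

text \<open>
  Compressed to the range of \<open>D\<close>, spanned by \<open>E 0\<close>, \<open>F 0\<close>, \<open>G 0\<close>, the operator \<open>z\<^sup>2 - a z\<close> only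
  retains its component from \<open>F 0\<close> to \<open>E 0\<close>.
\<close>

lemma D_compression:
  "compose H (compose H D (op_diff H (compose H z z) (op_scale H (of_real a) z))) D
    = op_scale H (- of_real (a * r1)) (rank_one (D (E 0)) (D (F 0)))" (is "?L = ?R")
proof (rule op_eq_on_basisI)
  let ?w = "op_diff H (compose H z z) (op_scale H (of_real a) z)"
  have DH: "D \<phi> \<in> H" if "\<phi> \<in> H" for \<phi> using op_mem[OF D_bounded that] .
  have w: "?w \<in> B" by (intro bounded_intros z_bounded)
  show "?L \<in> B" by (intro bounded_intros D_bounded w z_bounded)
  show "?R \<in> B" by (intro bounded_intros rank_one_bounded DH EFG_mem)
  \<comment> \<open>\<open>D\<close> kills \<open>E 1\<close> and \<open>E 2\<close>, so only
    components at \<open>E 0\<close>, \<open>F 0\<close>, \<open>G 0\<close> count, and the only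
    such component is that of \<open>?w (F 0)\<close> at \<open>E 0\<close>.\<close>
  have wb: "?w (E 0) = (\<lambda>x. E 2 x - of_real a * E 1 x)"
    "?w (F 0) = (\<lambda>x. of_real r1 * E 1 x - of_real (a * r1) * E 0 x)"
    "?w (G 0) = (\<lambda>x. of_real r2 * E 1 x)"
    by (simp_all add: op_apply EFG_mem mem_intros z_basis op_linear[OF z_bounded] algebra_simps
        numeral_2_eq_2)
  have DE: "D (E 1) = (\<lambda>x. 0)" "D (E 2) = (\<lambda>x. 0)"
    using D_basis(2)[of 0] D_basis(2)[of 1] by (simp_all add: numeral_2_eq_2)
  have L: "?L \<phi> = D (?w (D \<phi>))" if "\<phi> \<in> H" for \<phi>
    using that DH[OF that] by (simp add: compose_def)
  have R: "?R \<phi> = (\<lambda>x. - of_real (a * r1) * (ip \<phi> (D (F 0)) * D (E 0) x))" if "\<phi> \<in> H" for \<phi>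
    using that by (simp only: op_apply rank_one_apply)
  note simps = EFG_mem D_basis mem_intros op_linear[OF w] op_linear[OF D_bounded] wb DE ip_simps
    EFG_orthonormal
  show "?L (e k) = ?R (e k)" for k
  proof (rule basis_cases[where P="\<lambda>v. ?L v = ?R v"])
    fix n
    show "?L (E n) = ?R (E n)"
      unfolding L[OF EFG_mem(1)] R[OF EFG_mem(1)] by (cases n) (simp_all only: simps, simp_all)
    show "?L (F n) = ?R (F n)"
      unfolding L[OF EFG_mem(2)] R[OF EFG_mem(2)] by (cases n) (simp_all only: simps, simp_all)
    show "?L (G n) = ?R (G n)"
      unfolding L[OF EFG_mem(3)] R[OF EFG_mem(3)]
      by (cases n) (simp_all only: simps, simp_all add: algebra_simps)
  qed
qed

theorem compact_subset_commutator_ideal: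
  "K \<subseteq> commutator_ideal H ip (cstar_generated H ip z)"
  unfolding commutator_ideal_def
proof (intro Inter_greatest, elim CollectE conjE)
  fix J
  let ?A = "cstar_generated H ip z"
  assume ideal: "closed_ideal H ip ?A J" and comm: "\<forall>S\<in>?A. \<forall>T\<in>?A. commutator S T \<in> J"
  have A: "cstar_subalgebra H ip ?A" "z \<in> ?A"
    using z_bounded by (simp_all add: cstar_generated_cstar_subalgebra cstar_generated_self)
  then have AB: "?A \<subseteq> B" and zsA: "zs \<in> ?A"
    by (auto simp: cstar_subalgebra_def)
  have Aclosed: "op_add H S T \<in> ?A" "op_scale H c T \<in> ?A" "compose H S T \<in> ?A"
    if "S \<in> ?A" "T \<in> ?A" for S T c
    using A(1) that by (auto simp: cstar_subalgebra_def op_subspace_def)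
  have J: "J \<subseteq> ?A" "op_subspace H J" "op_norm_closed H ip J"
    using ideal by (auto simp: closed_ideal_def)
  have Jcomp: "compose H T S \<in> J" "compose H S T \<in> J" if "T \<in> ?A" "S \<in> J" for S T
    using ideal that by (auto simp: closed_ideal_def)
  have Jadd: "op_add H S T \<in> J" if "S \<in> J" "T \<in> J" for S T
    using J(2) that by (auto simp: op_subspace_def)
  have Jscale: "op_scale H c T \<in> J" if "T \<in> J" for T c
    using J(2) that by (auto simp: op_subspace_def)
  have Junscale: "T \<in> J" if "op_scale H c T \<in> J" "c \<noteq> 0" "T \<in> B" for T c
  proof -
    have "op_scale H (1 / c) (op_scale H c T) = T"
      using that by (intro op_eqI bounded_intros) (auto simp: op_apply)
    then show ?thesis using Jscale[OF that(1), of "1 / c"] by simp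
  qed
  have DJ: "D \<in> J" using comm zsA A(2) by blast
  have "op_diff H (compose H z z) (op_scale H (of_real a) z) \<in> ?A"
    unfolding op_diff_conv using A(2) by (intro Aclosed)
  then have "op_scale H (- of_real (a * r1)) (rank_one (D (E 0)) (D (F 0))) \<in> J"
    unfolding D_compression[symmetric] using DJ J(1) by (intro Jcomp) auto
  then have "rank_one (D (E 0)) (D (F 0)) \<in> J"
    by (rule Junscale) (use params in \<open>auto intro!: rank_one_bounded op_mem[OF D_bounded] EFG_mem\<close>)
  \<comment> \<open>\<open>D (F 0)\<close> is a multiple of \<open>G 0\<close>, so the right vector
    already is the starting point of \<open>reducing_contains_basis\<close>; only the left vector
    \<open>D (E 0)\<close> has to pass through \<open>reducing_contains_G\<close>.\<close>
  then have "op_scale H (of_real (r1 * r2)) (rank_one (D (E 0)) (G 0)) \<in> J"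
    unfolding D_basis(3)
      rank_one_scale_right[OF op_mem[OF D_bounded EFG_mem(1)] EFG_mem(3)] complex_cnj_complex_of_real .
  then have seed: "rank_one (D (E 0)) (G 0) \<in> J"
    by (rule Junscale) (use params in \<open>auto intro!: rank_one_bounded op_mem[OF D_bounded] EFG_mem\<close>)
  have col: "rank_one (e i) (G 0) \<in> J" for i
  proof -
    let ?X = "{u \<in> H. rank_one u (G 0) \<in> J}"
    have add: "(\<lambda>x. \<phi> x + \<psi> x) \<in> ?X" if "\<phi> \<in> ?X" "\<psi> \<in> ?X" for \<phi> \<psi>
      using that by (auto simp: mem_intros rank_one_add_left EFG_mem Jadd)
    have scale: "(\<lambda>x. c * \<phi> x) \<in> ?X" if "\<phi> \<in> ?X" for c \<phi>
      using that by (auto simp: mem_intros rank_one_scale_left EFG_mem Jscale)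
    have ops: "T \<phi> \<in> ?X" if "\<phi> \<in> ?X" "T \<in> ?A" for \<phi> T
    proof -
      have TB: "T \<in> B" using that AB by auto
      have "compose H T (rank_one \<phi> (G 0)) \<in> J" using that by (intro Jcomp) auto
      then show ?thesis using that TB by (simp add: compose_rank_one EFG_mem op_mem)
    qed
    have "D (E 0) \<in> ?X" using seed by (simp add: op_mem[OF D_bounded] EFG_mem)
    then have "G 0 \<in> ?X"
      by (rule reducing_contains_G[rotated 5]) (use add scale ops A(2) zsA in blast)+
    then have "e i \<in> ?X"
      by (rule reducing_contains_basis[rotated 5]) (use add scale ops A(2) zsA in blast)+
    then show ?thesis by simp
  qed
  have units: "rank_one (e i) (e j) \<in> J" for i j
  proof -
    let ?X = "{v \<in> H. rank_one (e i) v \<in> J}"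
    have add: "(\<lambda>x. \<phi> x + \<psi> x) \<in> ?X" if "\<phi> \<in> ?X" "\<psi> \<in> ?X" for \<phi> \<psi>
      using that by (auto simp: mem_intros rank_one_add_right e_mem Jadd)
    have scale: "(\<lambda>x. c * \<phi> x) \<in> ?X" if "\<phi> \<in> ?X" for c \<phi>
      using that by (auto simp: mem_intros rank_one_scale_right e_mem Jscale)
    \<comment> \<open>Multiplying by T from the right applies \<open>adj T\<close> to the right
      vector, so stability under z comes from T = \<open>zs\<close>, and stability under
      \<open>zs\<close> from T = z.\<close>
    have ops: "adj T \<phi> \<in> ?X" if "\<phi> \<in> ?X" "T \<in> ?A" for \<phi> T
    proof -
      have TB: "T \<in> B" using that AB by auto
      have "compose H (rank_one (e i) \<phi>) T \<in> J" using that by (intro Jcomp) auto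
      then show ?thesis using that TB by (simp add: rank_one_compose e_mem op_mem adj_bounded)
    qed
    have z: "z \<phi> \<in> ?X" if "\<phi> \<in> ?X" for \<phi>
      using ops[OF that zsA] by (simp only: adj_adj[OF z_bounded])
    have zs: "zs \<phi> \<in> ?X" if "\<phi> \<in> ?X" for \<phi>
      using ops[OF that A(2)] .
    have "G 0 \<in> ?X" using col by (simp add: EFG_mem)
    then have "e j \<in> ?X"
      by (rule reducing_contains_basis[rotated 5]) (use add scale z zs in blast)+
    then show ?thesis by simp
  qed
  show "K \<subseteq> J"
    using J AB units by (intro compact_subset_closed_subspace) auto
qed

theorem commutator_ideal_eq_compact:
  "commutator_ideal H ip (cstar_generated H ip z) = K"
  using commutator_ideal_subset_compact[OF z_bounded D_compact] compact_subset_commutator_ideal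
  by (rule subset_antisym)

end

section \<open>Power series with bounded coefficients\<close>

text \<open>The lemmas assume the coefficients to be bounded: this gives convergence on the open
  unit disc, and square summable families satisfy it.\<close>

definition psum :: "(nat \<Rightarrow> complex) \<Rightarrow> complex \<Rightarrow> complex" where
  "psum c w = (\<Sum>n. c n * w ^ n)"

lemma psum_abs_summable:
  assumes "\<And>n. cmod (c n) \<le> M" "cmod w < 1"
  shows "summable (\<lambda>n. norm (c n * w ^ n))"
proof (rule summable_comparison_test')
  show "summable (\<lambda>n. M * cmod w ^ n)" using assms by (intro summable_mult summable_geometric) auto
  show "norm (norm (c n * w ^ n)) \<le> M * cmod w ^ n" for n
    using assms(1) by (auto simp: norm_mult norm_power intro!: mult_right_mono)
qed

lemma psum_sums:
  assumes "\<And>n. cmod (c n) \<le> M" "cmod w < 1"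
  shows "(\<lambda>n. c n * w ^ n) sums psum c w"
  unfolding psum_def by (rule summable_sums[OF summable_norm_cancel[OF psum_abs_summable[OF assms]]])

lemma psum_has_sum:
  assumes "\<And>n. cmod (c n) \<le> M" "cmod w < 1"
  shows "((\<lambda>n. c n * w ^ n) has_sum psum c w) UNIV"
  using norm_summable_imp_has_sum[OF psum_abs_summable[OF assms] psum_sums[OF assms]] .

lemma psum_holomorphic:
  assumes "\<And>n. cmod (c n) \<le> M" shows "psum c holomorphic_on ball 0 1"
  using psum_sums[OF assms] by (intro power_series_holomorphic[where a=c]) auto

lemma psum_Suc:
  assumes "\<And>n. cmod (c n) \<le> M" "cmod w < 1"
  shows "psum c w = c 0 + w * psum (\<lambda>n. c (Suc n)) w"
proof -
  have "(\<lambda>n. c (Suc n) * w ^ n) sums psum (\<lambda>n. c (Suc n)) w"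
    using assms by (intro psum_sums[where M=M]) auto
  then have "(\<lambda>n. c (Suc n) * w ^ Suc n) sums (w * psum (\<lambda>n. c (Suc n)) w)"
    by (drule_tac sums_mult[where c=w]) (simp add: mult_ac)
  then have "(\<lambda>n. c n * w ^ n) sums (w * psum (\<lambda>n. c (Suc n)) w + c 0)"
    by (subst (asm) sums_Suc_iff) simp
  then show ?thesis using psum_sums[OF assms] sums_unique2 by fastforce
qed

lemma psum_eq_0:
  assumes bd: "\<And>n. cmod (c n) \<le> M" and zero: "\<And>w. cmod w < 1 \<Longrightarrow> psum c w = 0"
  shows "c n = 0"
\<comment> \<open>\<open>powser_0_nonzero\<close> works with a nonzero coefficient of positive
  index, so the constant term is treated by evaluation at 0.\<close>
proof (cases n)
  case 0
  then show ?thesis using psum_Suc[OF bd, of 0] zero[of 0] by simp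
next
  case (Suc m)
  show ?thesis
  proof (rule ccontr)
    assume "c n \<noteq> 0"
    show False
    proof (rule powser_0_nonzero[of 1 0 c "\<lambda>_. 0" n])
      show "(\<lambda>n. c n * (w - 0) ^ n) sums 0" if "cmod (w - 0) < 1" for w
        using psum_sums[of c M w, OF bd] zero[of w] that by simp
      fix s :: real assume s: "0 < s" "\<And>w :: complex. w \<in> cball 0 s - {0} \<Longrightarrow> (0::complex) \<noteq> 0"
      show False using s(2)[of "of_real s"] s(1) by simp
    qed (use \<open>c n \<noteq> 0\<close> Suc in simp_all)
  qed
qed

lemma psum_scale:
  assumes "\<And>n. cmod (c n) \<le> M" "cmod w < 1"
  shows "psum (\<lambda>n. t * c n) w = t * psum c w"
  using sums_mult[OF psum_sums[OF assms], of t] by (simp add: psum_def sums_iff mult.assoc)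

lemma psum_add:
  assumes "\<And>n. cmod (c n) \<le> M" "\<And>n. cmod (d n) \<le> M'" "cmod w < 1"
  shows "psum (\<lambda>n. c n + d n) w = psum c w + psum d w"
  using sums_add[OF psum_sums[OF assms(1,3)] psum_sums[OF assms(2,3)]]
  by (simp add: psum_def sums_iff distrib_right)

text \<open>
  The principal part and \<open>- q\<close> glue to an entire function that vanishes at infinity.
\<close>

lemma principal_part_eq_0:
  assumes bd: "\<And>n. cmod (c n) \<le> M" and r: "0 < r" "r < R" and q: "q holomorphic_on ball b R"
    and zero: "\<And>\<zeta>. r < cmod (\<zeta> - b) \<Longrightarrow> cmod (\<zeta> - b) < R \<Longrightarrow>
      of_real r / (\<zeta> - b) * psum c (of_real r / (\<zeta> - b)) + q \<zeta> = 0"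
  shows "c n = 0"
proof -
  define f where "f \<zeta> = of_real r / (\<zeta> - b) * psum c (of_real r / (\<zeta> - b))" for \<zeta>
  define A where "A = {\<zeta>. r < cmod (\<zeta> - b)}"
  define h where "h = (\<lambda>\<zeta>. if \<zeta> \<in> A then f \<zeta> else - q \<zeta>)"
  have small: "of_real r / (\<zeta> - b) \<in> ball 0 1" "\<zeta> - b \<noteq> 0" if "\<zeta> \<in> A" for \<zeta>
  proof -
    have "\<zeta> - b \<noteq> 0" using that r unfolding A_def by force
    then show "\<zeta> - b \<noteq> 0" "of_real r / (\<zeta> - b) \<in> ball 0 1"
      using that r by (auto simp: A_def norm_divide)
  qed
  have "open A" unfolding A_def by (intro open_Collect_less continuous_intros)
  have "(psum c \<circ> (\<lambda>\<zeta>. of_real r / (\<zeta> - b))) holomorphic_on A"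
    using small by (intro holomorphic_on_compose_gen[OF _ psum_holomorphic[OF bd]] holomorphic_intros) auto
  then have "f holomorphic_on A"
    unfolding f_def using small(2) by (intro holomorphic_intros) (auto simp: o_def)
  moreover have "f \<zeta> = - q \<zeta>" if "\<zeta> \<in> A" "\<zeta> \<in> ball b R" for \<zeta>
    using zero[of \<zeta>] that by (simp add: A_def f_def dist_norm norm_minus_commute eq_neg_iff_add_eq_0)
  ultimately have "h holomorphic_on (A \<union> ball b R)"
    unfolding h_def by (rule holomorphic_on_If_Un[OF _ holomorphic_on_minus[OF q] \<open>open A\<close> open_ball])
  \<comment> \<open>Because \<open>r < R\<close>, the exterior domain and the disc overlap in an
    annulus and together cover the plane.\<close>
  moreover have "A \<union> ball b R = UNIV"
    using r by (force simp: A_def dist_norm norm_minus_commute)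
  ultimately have hol: "h holomorphic_on UNIV" by simp
  have lim0: "((\<lambda>\<zeta>. of_real r / (\<zeta> - b)) \<longlongrightarrow> 0) at_infinity"
  proof (rule tendsto_divide_0[OF tendsto_const])
    show "filterlim (\<lambda>\<zeta>. \<zeta> - b) at_infinity at_infinity"
      using tendsto_add_filterlim_at_infinity[OF tendsto_const[of "-b"] filterlim_ident] by simp
  qed
  have "isCont (psum c) 0"
    using holomorphic_on_imp_continuous_on[OF psum_holomorphic[OF bd]]
    by (simp add: continuous_on_eq_continuous_at)
  then have "((\<lambda>\<zeta>. psum c (of_real r / (\<zeta> - b))) \<longlongrightarrow> psum c 0) at_infinity"
    using lim0 by (rule isCont_tendsto_compose)
  from tendsto_mult[OF lim0 this] have "(f \<longlongrightarrow> 0) at_infinity"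
    by (simp add: f_def[abs_def])
  moreover have "eventually (\<lambda>\<zeta>. h \<zeta> = f \<zeta>) at_infinity"
    unfolding eventually_at_infinity
  proof (intro exI allI impI)
    fix \<zeta> assume "r + cmod b + 1 \<le> cmod \<zeta>"
    then have "\<zeta> \<in> A" using norm_triangle_ineq2[of \<zeta> b] by (auto simp: A_def)
    then show "h \<zeta> = f \<zeta>" by (simp add: h_def)
  qed
  ultimately have "(h \<longlongrightarrow> 0) at_infinity" using tendsto_cong by blast
  then have h0: "h \<zeta> = 0" for \<zeta> using Liouville_weak_0[OF hol] by blast
  \<comment> \<open>In the variable w = r / (\<zeta> - b) the function f is w times the series of
    \<open>c\<close>, with coefficient sequence \<open>d\<close>. The point w = 0 corresponds to
    infinity and is covered by the zero constant term.\<close>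
  define d where "d = (\<lambda>n. case n of 0 \<Rightarrow> 0 | Suc m \<Rightarrow> c m)"
  have M: "0 \<le> M" using order_trans[OF norm_ge_zero bd] .
  have dbd: "cmod (d n) \<le> M" for n using bd M by (cases n) (auto simp: d_def)
  have "psum d w = 0" if w: "cmod w < 1" for w
  proof (cases "w = 0")
    case True
    then show ?thesis using psum_Suc[OF dbd w] by (simp add: d_def)
  next
    case False
    have "b + of_real r / w \<in> A" using w False r by (simp add: A_def norm_divide field_simps)
    then have "f (b + of_real r / w) = 0" using h0[of "b + of_real r / w"] by (simp add: h_def)
    then have "w * psum c w = 0" using False r by (simp add: f_def)
    then show ?thesis using psum_Suc[OF dbd w] by (simp add: d_def)
  qed
  then have "d (Suc n) = 0" by (rule psum_eq_0[OF dbd])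
  then show ?thesis by (simp add: d_def)
qed

section \<open>Square summable families\<close>

lemma square_summable_mult:
  fixes c d :: "'i \<Rightarrow> complex"
  assumes "(\<lambda>i. (cmod (c i))\<^sup>2) summable_on I" "(\<lambda>i. (cmod (d i))\<^sup>2) summable_on I"
  shows "(\<lambda>i. c i * cnj (d i)) summable_on I"
proof (rule abs_summable_summable, rule summable_on_comparison_test)
  show "(\<lambda>i. (cmod (c i))\<^sup>2 + (cmod (d i))\<^sup>2) summable_on I" using assms by (rule summable_on_add)
  show "norm (c i * cnj (d i)) \<le> (cmod (c i))\<^sup>2 + (cmod (d i))\<^sup>2" for i
    using sum_squares_bound[of "cmod (c i)" "cmod (d i)", unfolded mult.assoc]
      mult_nonneg_nonneg[OF norm_ge_zero norm_ge_zero, of "c i" "d i"]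
    unfolding norm_mult complex_mod_cnj by linarith
qed auto

lemma cmod_add_sq_le: "(cmod (x + y))\<^sup>2 \<le> 2 * (cmod x)\<^sup>2 + 2 * (cmod y)\<^sup>2"
proof -
  have "(cmod (x + y))\<^sup>2 \<le> (cmod x + cmod y)\<^sup>2"
    by (intro power_mono norm_triangle_ineq) auto
  also have "\<dots> \<le> 2 * (cmod x)\<^sup>2 + 2 * (cmod y)\<^sup>2"
    using sum_squares_bound[of "cmod x" "cmod y"] by (simp add: power2_sum)
  finally show ?thesis .
qed

lemma square_summable_add:
  fixes c d :: "'i \<Rightarrow> complex"
  assumes "(\<lambda>i. (cmod (c i))\<^sup>2) summable_on I" "(\<lambda>i. (cmod (d i))\<^sup>2) summable_on I"
  shows "(\<lambda>i. (cmod (c i + d i))\<^sup>2) summable_on I"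
proof (rule summable_on_comparison_test)
  show "(\<lambda>i. 2 * (cmod (c i))\<^sup>2 + 2 * (cmod (d i))\<^sup>2) summable_on I"
    using assms by (intro summable_on_add summable_on_cmult_right)
qed (auto intro: cmod_add_sq_le)

lemma square_summable_scale:
  fixes c :: "'i \<Rightarrow> complex"
  assumes "(\<lambda>i. (cmod (c i))\<^sup>2) summable_on I"
  shows "(\<lambda>i. (cmod (t * c i))\<^sup>2) summable_on I"
  using summable_on_cmult_right[OF assms, of "(cmod t)\<^sup>2"] by (simp add: norm_mult power_mult_distrib)

lemma square_summable_bounded:
  fixes c :: "'i \<Rightarrow> complex"
  assumes "(\<lambda>i. (cmod (c i))\<^sup>2) summable_on I" "i \<in> I"
  shows "cmod (c i) \<le> sqrt (infsum (\<lambda>i. (cmod (c i))\<^sup>2) I)"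
  using finite_sum_le_infsum[OF assms(1), of "{i}"] assms(2) by (intro real_le_rsqrt) auto

section \<open>The Hilbert space of the pair of pants\<close>

locale pants_params =
  fixes a r1 r2 :: real
  assumes params: "r1 > 0" "r2 > 0" "a > 0" "a + r2 < 1" "r1 + r2 < a"
begin

abbreviation I :: "pants_index set" where "I \<equiv> pants_indices"
abbreviation S :: "complex set" where "S \<equiv> interior (pants a r1 r2)"
abbreviation H :: "(complex \<Rightarrow> complex) set" where "H \<equiv> pants_H a r1 r2"
abbreviation ip :: "complex ip" where "ip \<equiv> pants_ip a r1 r2"

definition Fi :: "nat \<Rightarrow> pants_index" where "Fi n = F_ix (- 1 - int n)"
definition Gi :: "nat \<Rightarrow> pants_index" where "Gi n = G_ix (- 1 - int n)"

definition l2 :: "(pants_index \<Rightarrow> complex) \<Rightarrow> bool" where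
  "l2 c \<longleftrightarrow> (\<forall>i. i \<notin> I \<longrightarrow> c i = 0) \<and> (\<lambda>i. (cmod (c i))\<^sup>2) summable_on I"

text \<open>On \<open>S\<close> the arguments of all three power series have modulus below 1. The
  factors in front of the last two arise because the indices of \<open>F\<close> and
  \<open>G\<close> start at -1, that is, at the first power.\<close>

definition series :: "(pants_index \<Rightarrow> complex) \<Rightarrow> complex \<Rightarrow> complex" where
  "series c \<zeta> = psum (\<lambda>n. c (E_ix n)) \<zeta>
     + of_real r1 / \<zeta> * psum (\<lambda>n. c (Fi n)) (of_real r1 / \<zeta>)
     + of_real r2 / (\<zeta> - of_real a) * psum (\<lambda>n. c (Gi n)) (of_real r2 / (\<zeta> - of_real a))"

lemma interior_pants: "S = {\<zeta>. cmod \<zeta> < 1 \<and> r1 < cmod \<zeta> \<and> r2 < cmod (\<zeta> - of_real a)}"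
proof -
  have "pants a r1 r2 = cball 0 1 \<inter> - ball 0 r1 \<inter> - ball (of_real a) r2"
    by (auto simp: pants_def dist_norm norm_minus_commute)
  then have "S = ball 0 1 \<inter> - cball 0 r1 \<inter> - cball (of_real a) r2"
    using params by (simp only: interior_Int interior_complement interior_cball closure_ball)
  also have "\<dots> = {\<zeta>. cmod \<zeta> < 1 \<and> r1 < cmod \<zeta> \<and> r2 < cmod (\<zeta> - of_real a)}"
    by (auto simp: dist_norm norm_minus_commute)
  finally show ?thesis .
qed

lemma interior_pantsD:
  assumes "\<zeta> \<in> S"
  shows "cmod \<zeta> < 1" "cmod (of_real r1 / \<zeta>) < 1" "cmod (of_real r2 / (\<zeta> - of_real a)) < 1"
    "\<zeta> \<noteq> 0" "\<zeta> - of_real a \<noteq> 0"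
  using assms params by (auto simp: interior_pants norm_divide divide_less_eq)

text \<open>In this annulus around the hole at 0 the distance to a exceeds r2. It is nonempty by
  \<open>r1 + r2 < a\<close> and serves to separate the principal part at 0.\<close>

lemma in_interior_pants:
  assumes "r1 < cmod \<zeta>" "cmod \<zeta> < a - r2" shows "\<zeta> \<in> S"
  using assms params norm_triangle_ineq2[of "of_real a" \<zeta>]
  by (auto simp: interior_pants norm_minus_commute)

lemma indices_eq: "I = range E_ix \<union> range Fi \<union> range Gi"
proof -
  have "(\<lambda>n. - 1 - int n) ` UNIV = {..-1}"
  proof (intro equalityI subsetI)
    fix k :: int assume "k \<in> {..-1}"
    then have "k = - 1 - int (nat (- 1 - k))" by simp
    then show "k \<in> range (\<lambda>n. - 1 - int n)" by blast
  qed auto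
  then have "F_ix ` {..-1} = range Fi" "G_ix ` {..-1} = range Gi"
    by (auto simp: Fi_def[abs_def] Gi_def[abs_def] image_image[symmetric])
  then show ?thesis by (simp add: pants_indices_def)
qed

lemma index_mem [simp]: "E_ix n \<in> I" "Fi n \<in> I" "Gi n \<in> I"
  by (auto simp: indices_eq)

lemma index_neq [simp]: "E_ix n \<noteq> Fi m" "E_ix n \<noteq> Gi m" "Fi m \<noteq> Gi n" "Fi n \<noteq> E_ix m"
  "Gi n \<noteq> E_ix m" "Gi m \<noteq> Fi n" "Fi m = Fi n \<longleftrightarrow> m = n" "Gi m = Gi n \<longleftrightarrow> m = n"
  by (auto simp: Fi_def Gi_def)

lemma index_cases:
  assumes "i \<in> I" obtains n where "i = E_ix n" | n where "i = Fi n" | n where "i = Gi n"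
  using assms by (auto simp: indices_eq)

lemma pants_basis_FG:
  "pants_basis a r1 r2 (Fi n) \<zeta> = (of_real r1 / \<zeta>) ^ Suc n"
  "pants_basis a r1 r2 (Gi n) \<zeta> = (of_real r2 / (\<zeta> - of_real a)) ^ Suc n"
proof -
  have "- 1 - int n = - int (Suc n)" by simp
  then have "x powi (- 1 - int n) = inverse x ^ Suc n" for x :: complex
    by (simp only: power_int_minus power_int_of_nat power_inverse)
  then show "pants_basis a r1 r2 (Fi n) \<zeta> = (of_real r1 / \<zeta>) ^ Suc n"
    "pants_basis a r1 r2 (Gi n) \<zeta> = (of_real r2 / (\<zeta> - of_real a)) ^ Suc n"
    by (simp_all add: Fi_def Gi_def)
qed

section \<open>Convergence of the expansion\<close>

lemma l2_bounded:
  assumes "l2 c" obtains M where "M \<ge> 0" "\<And>i. cmod (c i) \<le> M"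
proof -
  have sm: "(\<lambda>i. (cmod (c i))\<^sup>2) summable_on I" using assms by (simp add: l2_def)
  have pos: "0 \<le> infsum (\<lambda>i. (cmod (c i))\<^sup>2) I" by (intro infsum_nonneg) auto
  have "cmod (c i) \<le> sqrt (infsum (\<lambda>i. (cmod (c i))\<^sup>2) I)" for i
    using square_summable_bounded[OF sm, of i] assms pos by (cases "i \<in> I") (auto simp: l2_def)
  then show thesis using that pos by (meson real_sqrt_ge_zero)
qed

lemma series_has_sum:
  assumes c: "l2 c" and \<zeta>: "\<zeta> \<in> S"
  shows "((\<lambda>i. c i * pants_basis a r1 r2 i \<zeta>) has_sum series c \<zeta>) I"
proof -
  obtain M where M: "\<And>i. cmod (c i) \<le> M" using l2_bounded[OF c] by metis
  note S = interior_pantsD[OF \<zeta>]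
  let ?w1 = "of_real r1 / \<zeta>" and ?w2 = "of_real r2 / (\<zeta> - of_real a)"
  let ?g = "\<lambda>i. c i * pants_basis a r1 r2 i \<zeta>"
  have "(?g has_sum psum (\<lambda>n. c (E_ix n)) \<zeta>) (range E_ix)"
    using psum_has_sum[of "\<lambda>n. c (E_ix n)", OF M S(1)]
    by (subst has_sum_reindex) (auto simp: inj_def o_def)
  moreover have "(?g has_sum ?w1 * psum (\<lambda>n. c (Fi n)) ?w1) (range Fi)"
    using has_sum_cmult_right[OF psum_has_sum[of "\<lambda>n. c (Fi n)", OF M S(2)], of ?w1]
    by (subst has_sum_reindex) (auto simp: inj_def o_def pants_basis_FG mult_ac)
  moreover have "(?g has_sum ?w2 * psum (\<lambda>n. c (Gi n)) ?w2) (range Gi)"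
    using has_sum_cmult_right[OF psum_has_sum[of "\<lambda>n. c (Gi n)", OF M S(3)], of ?w2]
    by (subst has_sum_reindex) (auto simp: inj_def o_def pants_basis_FG mult_ac)
  ultimately show ?thesis
    unfolding series_def indices_eq by (intro has_sum_Un_disjoint) auto
qed

lemma series_holomorphic:
  assumes c: "l2 c" shows "series c holomorphic_on S"
proof -
  obtain M where M: "\<And>i. cmod (c i) \<le> M" using l2_bounded[OF c] by metis
  have p: "(\<lambda>\<zeta>. psum (\<lambda>n. c (f n)) (g \<zeta>)) holomorphic_on S"
    if "g holomorphic_on S" "g ` S \<subseteq> ball 0 1" for f :: "nat \<Rightarrow> pants_index" and g
    using holomorphic_on_compose_gen[OF that(1) psum_holomorphic[of "\<lambda>n. c (f n)", OF M] that(2)]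
    by (simp add: o_def)
  show ?thesis
    unfolding series_def[abs_def]
    using interior_pantsD by (intro holomorphic_intros p) auto
qed

lemma pants_expansion_iff:
  "pants_expansion a r1 r2 \<phi> c \<longleftrightarrow> l2 c \<and> (\<forall>\<zeta>\<in>S. \<phi> \<zeta> = series c \<zeta>)"
  unfolding pants_expansion_def l2_def[symmetric] conj_assoc[symmetric]
  using series_has_sum has_sum_unique by (metis (no_types, lifting))

lemma l2_add: "l2 c \<Longrightarrow> l2 d \<Longrightarrow> l2 (\<lambda>i. c i + d i)"
  by (auto simp: l2_def square_summable_add)

lemma l2_scale: "l2 c \<Longrightarrow> l2 (\<lambda>i. t * c i)"
  by (auto simp: l2_def square_summable_scale)

lemma l2_zero: "l2 (\<lambda>i. 0)"
  by (simp add: l2_def)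

lemma series_add:
  "l2 c \<Longrightarrow> l2 d \<Longrightarrow> \<zeta> \<in> S \<Longrightarrow> series (\<lambda>i. c i + d i) \<zeta> = series c \<zeta> + series d \<zeta>"
  using has_sum_add[OF series_has_sum[of c \<zeta>] series_has_sum[of d \<zeta>]] series_has_sum[OF l2_add, of c d \<zeta>]
  by (auto simp: algebra_simps intro: has_sum_unique)

lemma series_scale: "l2 c \<Longrightarrow> \<zeta> \<in> S \<Longrightarrow> series (\<lambda>i. t * c i) \<zeta> = t * series c \<zeta>"
  using has_sum_cmult_right[OF series_has_sum[of c \<zeta>], of t] series_has_sum[OF l2_scale, of c \<zeta> t]
  by (auto simp: algebra_simps intro: has_sum_unique)

text \<open>Around each hole the other two parts are holomorphic across the hole, so
  \<open>principal_part_eq_0\<close> annihilates the \<open>F\<close> and the \<open>G\<close>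
  coefficients independently. What is left is a power series vanishing on \<open>S\<close>, hence on
  the whole disc by analytic continuation.\<close>

lemma series_eq_0:
  assumes c: "l2 c" and zero: "\<And>\<zeta>. \<zeta> \<in> S \<Longrightarrow> series c \<zeta> = 0"
  shows "c i = 0"
proof -
  obtain M where M: "\<And>i. cmod (c i) \<le> M" using l2_bounded[OF c] by metis
  let ?E = "psum (\<lambda>n. c (E_ix n))"
  let ?F = "\<lambda>\<zeta>. of_real r1 / \<zeta> * psum (\<lambda>n. c (Fi n)) (of_real r1 / \<zeta>)"
  let ?G = "\<lambda>\<zeta>. of_real r2 / (\<zeta> - of_real a) * psum (\<lambda>n. c (Gi n)) (of_real r2 / (\<zeta> - of_real a))"
  have hol: "(\<lambda>\<zeta>. g \<zeta> * psum (\<lambda>n. c (f n)) (g \<zeta>)) holomorphic_on A"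
    if "g holomorphic_on A" "g ` A \<subseteq> ball 0 1" for f :: "nat \<Rightarrow> pants_index" and g A
    using holomorphic_on_compose_gen[OF that(1) psum_holomorphic[of "\<lambda>n. c (f n)", OF M] that(2)] that(1)
    by (auto simp: o_def intro: holomorphic_on_mult)
  have holE: "?E holomorphic_on A" if "A \<subseteq> ball 0 1" for A
    using psum_holomorphic[of "\<lambda>n. c (E_ix n)", OF M] that by (rule holomorphic_on_subset)
  have F0: "c (Fi n) = 0" for n
  proof (rule principal_part_eq_0[where c="\<lambda>n. c (Fi n)" and q="\<lambda>\<zeta>. ?E \<zeta> + ?G \<zeta>" and b=0])
    have far: "r2 < cmod (\<zeta> - of_real a)" if "cmod \<zeta> < a - r2" for \<zeta> :: complex
      using that params norm_triangle_ineq2[of "of_real a" \<zeta>] by (auto simp: norm_minus_commute)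
    show "(\<lambda>\<zeta>. ?E \<zeta> + ?G \<zeta>) holomorphic_on ball 0 (a - r2)"
    proof (intro holomorphic_on_add holE hol holomorphic_intros)
      show "\<zeta> - of_real a \<noteq> 0" if "\<zeta> \<in> ball 0 (a - r2)" for \<zeta> :: complex
        using far[of \<zeta>] that params by auto
      show "(\<lambda>\<zeta>. complex_of_real r2 / (\<zeta> - of_real a)) ` ball 0 (a - r2) \<subseteq> ball 0 1"
        using params by (auto simp: norm_divide divide_less_eq dest!: far)
    qed (use params in auto)
    show "of_real r1 / (\<zeta> - 0) * psum (\<lambda>n. c (Fi n)) (of_real r1 / (\<zeta> - 0)) + (?E \<zeta> + ?G \<zeta>) = 0"
      if "r1 < cmod (\<zeta> - 0)" "cmod (\<zeta> - 0) < a - r2" for \<zeta>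
      using zero[OF in_interior_pants, of \<zeta>] that by (simp add: series_def algebra_simps)
  qed (use M params in auto)
  have G0: "c (Gi n) = 0" for n
  proof (rule principal_part_eq_0[where c="\<lambda>n. c (Gi n)" and q="\<lambda>\<zeta>. ?E \<zeta> + ?F \<zeta>" and b="of_real a"])
    \<comment> \<open>The disc of this radius about a stays inside the unit disc and clear of the
      hole at 0. Both entries of the minimum exceed r2, which leaves an annulus around the hole at
      a.\<close>
    let ?R = "min (1 - a) (a - r1)"
    have near: "r1 < cmod \<zeta>" "cmod \<zeta> < 1" if "cmod (\<zeta> - of_real a) < ?R" for \<zeta> :: complex
      using that params norm_triangle_ineq2[of "of_real a" \<zeta>] norm_triangle_ineq2[of \<zeta> "of_real a"]
      by (auto simp: norm_minus_commute)
    show "(\<lambda>\<zeta>. ?E \<zeta> + ?F \<zeta>) holomorphic_on ball (of_real a) ?R"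
    proof (intro holomorphic_on_add holE hol holomorphic_intros)
      show "\<zeta> \<noteq> 0" if "\<zeta> \<in> ball (of_real a) ?R" for \<zeta> :: complex
        using near(1)[of \<zeta>] that params by (auto simp: dist_norm norm_minus_commute)
      show "(\<lambda>\<zeta>. complex_of_real r1 / \<zeta>) ` ball (of_real a) ?R \<subseteq> ball 0 1"
        using params near(1)
        by (auto simp: norm_divide divide_less_eq dist_norm norm_minus_commute)
      show "ball (of_real a) ?R \<subseteq> (ball 0 1 :: complex set)"
        using near(2) by (force simp: dist_norm norm_minus_commute)
    qed
    show "of_real r2 / (\<zeta> - of_real a) * psum (\<lambda>n. c (Gi n)) (of_real r2 / (\<zeta> - of_real a))
        + (?E \<zeta> + ?F \<zeta>) = 0"
      if "r2 < cmod (\<zeta> - of_real a)" "cmod (\<zeta> - of_real a) < ?R" for \<zeta>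
      using zero[of \<zeta>] that near[of \<zeta>] by (simp add: series_def interior_pants algebra_simps)
  qed (use M params in auto)
  have psum0: "psum (\<lambda>n. 0) w = 0" for w by (simp add: psum_def)
  have E_S: "?E \<zeta> = 0" if "\<zeta> \<in> S" for \<zeta>
    using zero[OF that] by (simp add: series_def F0 G0 psum0)
  \<comment> \<open>A witness that \<open>S\<close> is nonempty: the midpoint of the radii bounding
    the annulus around 0.\<close>
  have "of_real ((r1 + (a - r2)) / 2) \<in> S"
    using params by (intro in_interior_pants) (auto simp del: of_real_divide)
  then have ne: "S \<noteq> {}" by auto
  have "?E w = 0" if "cmod w < 1" for w
  proof (rule analytic_continuation_open[where f="?E" and g="\<lambda>_. 0" and s=S and s'="ball 0 1"])
    show "S \<subseteq> ball 0 1" using interior_pantsD(1) by auto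
  qed (use ne E_S that holE in auto)
  then have E0: "c (E_ix n) = 0" for n
    using psum_eq_0[of "\<lambda>n. c (E_ix n)", OF M] by blast
  show ?thesis
    using c E0 F0 G0 by (cases "i \<in> I") (auto simp: l2_def elim: index_cases)
qed

lemma series_inj:
  assumes c: "l2 c" and d: "l2 d" and eq: "\<And>\<zeta>. \<zeta> \<in> S \<Longrightarrow> series c \<zeta> = series d \<zeta>"
  shows "c = d"
proof
  fix i
  have m: "l2 (\<lambda>i. (-1) * d i)" using d by (rule l2_scale)
  have "l2 (\<lambda>i. c i + (-1) * d i)" using c m by (rule l2_add)
  moreover have "series (\<lambda>i. c i + (-1) * d i) \<zeta> = 0" if "\<zeta> \<in> S" for \<zeta>
    by (simp only: series_add[OF c m that] series_scale[OF d that] eq[OF that]) simp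
  ultimately have "c i + (-1) * d i = 0" by (rule series_eq_0)
  then show "c i = d i" by simp
qed

section \<open>The Hilbert space as the space of square summable families\<close>

definition fun_of :: "(pants_index \<Rightarrow> complex) \<Rightarrow> complex \<Rightarrow> complex" where
  "fun_of c = (\<lambda>\<zeta>. if \<zeta> \<in> S then series c \<zeta> else 0)"

abbreviation coeff :: "(complex \<Rightarrow> complex) \<Rightarrow> pants_index \<Rightarrow> complex" where
  "coeff \<equiv> pants_coeff a r1 r2"

lemma fun_of_mem: "l2 c \<Longrightarrow> fun_of c \<in> H"
  unfolding pants_H_def pants_expansion_iff fun_of_def
  using series_holomorphic[of c] by (auto cong: holomorphic_cong)

lemma coeff_fun_of: "l2 c \<Longrightarrow> coeff (fun_of c) = c"
  unfolding pants_coeff_def pants_expansion_iff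
  by (rule the_equality) (auto simp: fun_of_def intro!: series_inj)

lemma mem_H_cases:
  assumes "\<phi> \<in> H" obtains c where "l2 c" "\<phi> = fun_of c"
proof -
  obtain c where "l2 c" "\<forall>\<zeta>\<in>S. \<phi> \<zeta> = series c \<zeta>" and "\<forall>\<zeta>. \<zeta> \<notin> S \<longrightarrow> \<phi> \<zeta> = 0"
    using assms by (auto simp: pants_H_def pants_expansion_iff)
  then show thesis using that[of c] by (auto simp: fun_of_def fun_eq_iff)
qed

lemma fun_of_add: "l2 c \<Longrightarrow> l2 d \<Longrightarrow> fun_of (\<lambda>i. c i + d i) = (\<lambda>\<zeta>. fun_of c \<zeta> + fun_of d \<zeta>)"
  by (auto simp: fun_of_def series_add fun_eq_iff)

lemma fun_of_scale: "l2 c \<Longrightarrow> fun_of (\<lambda>i. t * c i) = (\<lambda>\<zeta>. t * fun_of c \<zeta>)"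
  by (auto simp: fun_of_def series_scale fun_eq_iff)

lemma fun_of_zero: "fun_of (\<lambda>i. 0) = (\<lambda>\<zeta>. 0)"
  using fun_of_scale[OF l2_zero, of 0] by simp

lemma ip_fun_of: "l2 c \<Longrightarrow> l2 d \<Longrightarrow> ip (fun_of c) (fun_of d) = (\<Sum>\<^sub>\<infinity>i\<in>I. c i * cnj (d i))"
  by (simp add: pants_ip_def coeff_fun_of)

lemma l2_summable: "l2 c \<Longrightarrow> l2 d \<Longrightarrow> (\<lambda>i. c i * cnj (d i)) summable_on I"
  by (intro square_summable_mult) (auto simp: l2_def)

lemma ip_fun_of_self: "l2 c \<Longrightarrow> ip (fun_of c) (fun_of c) = of_real (\<Sum>\<^sub>\<infinity>i\<in>I. (cmod (c i))\<^sup>2)"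
proof -
  assume c: "l2 c"
  then have "((\<lambda>i. (cmod (c i))\<^sup>2) has_sum (\<Sum>\<^sub>\<infinity>i\<in>I. (cmod (c i))\<^sup>2)) I"
    by (intro has_sum_infsum) (simp add: l2_def)
  then have "((\<lambda>i. complex_of_real ((cmod (c i))\<^sup>2)) has_sum of_real (\<Sum>\<^sub>\<infinity>i\<in>I. (cmod (c i))\<^sup>2)) I"
    by (rule has_sum_of_real_iff[THEN iffD2])
  then show ?thesis
    using c unfolding complex_norm_square by (simp add: ip_fun_of infsumI)
qed

lemma norm_fun_of: "l2 c \<Longrightarrow> (hnorm ip (fun_of c))\<^sup>2 = (\<Sum>\<^sub>\<infinity>i\<in>I. (cmod (c i))\<^sup>2)"
  by (simp add: hnorm_def ip_fun_of_self infsum_nonneg)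

lemma fun_inner_product: "fun_inner_product H ip"
proof
  show "(\<lambda>\<zeta>. 0) \<in> H" using fun_of_mem[OF l2_zero] by (simp add: fun_of_zero)
next
  fix \<phi> \<psi> \<eta> assume "\<phi> \<in> H" "\<psi> \<in> H"
  then obtain c d where cd: "l2 c" "l2 d" "\<phi> = fun_of c" "\<psi> = fun_of d"
    by (metis mem_H_cases)
  have "(\<lambda>\<zeta>. fun_of c \<zeta> + fun_of d \<zeta>) \<in> H"
    using fun_of_mem[OF l2_add[OF cd(1,2)]] by (simp add: fun_of_add cd)
  then show "(\<lambda>\<zeta>. \<phi> \<zeta> + \<psi> \<zeta>) \<in> H" by (simp add: cd)
  show "ip \<phi> \<psi> = cnj (ip \<psi> \<phi>)"
    using cd by (simp add: ip_fun_of infsum_cnj[symmetric] mult.commute del: infsum_cnj)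
  assume "\<eta> \<in> H"
  then obtain b where b: "l2 b" "\<eta> = fun_of b" by (metis mem_H_cases)
  have "ip (\<lambda>\<zeta>. fun_of c \<zeta> + fun_of d \<zeta>) (fun_of b) = ip (fun_of c) (fun_of b) + ip (fun_of d) (fun_of b)"
    unfolding fun_of_add[OF cd(1,2), symmetric] using cd b
    by (simp add: ip_fun_of l2_add distrib_right infsum_add l2_summable)
  then show "ip (\<lambda>\<zeta>. \<phi> \<zeta> + \<psi> \<zeta>) \<eta> = ip \<phi> \<eta> + ip \<psi> \<eta>" by (simp add: cd b)
next
  fix \<phi> \<psi> t assume "\<phi> \<in> H"
  then obtain c where c: "l2 c" "\<phi> = fun_of c" by (metis mem_H_cases)
  have "(\<lambda>\<zeta>. t * fun_of c \<zeta>) \<in> H"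
    using fun_of_mem[OF l2_scale[OF c(1)]] by (simp add: fun_of_scale c)
  then show "(\<lambda>\<zeta>. t * \<phi> \<zeta>) \<in> H" by (simp add: c)
  assume "\<psi> \<in> H"
  then obtain d where d: "l2 d" "\<psi> = fun_of d" by (metis mem_H_cases)
  have "ip (\<lambda>\<zeta>. t * fun_of c \<zeta>) (fun_of d) = t * ip (fun_of c) (fun_of d)"
    unfolding fun_of_scale[OF c(1), symmetric] using c d
    by (simp add: ip_fun_of l2_scale mult.assoc infsum_cmult_right l2_summable)
  then show "ip (\<lambda>\<zeta>. t * \<phi> \<zeta>) \<psi> = t * ip \<phi> \<psi>" by (simp add: c d)
next
  fix \<phi> assume "\<phi> \<in> H"
  then obtain c where c: "l2 c" "\<phi> = fun_of c" by (metis mem_H_cases)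
  show "0 \<le> Re (ip \<phi> \<phi>)" using c by (simp add: ip_fun_of_self infsum_nonneg)
  assume "ip \<phi> \<phi> = 0"
  then have "(\<Sum>\<^sub>\<infinity>i\<in>I. (cmod (c i))\<^sup>2) = 0" using c by (simp add: ip_fun_of_self)
  then have "(cmod (c i))\<^sup>2 = 0" if "i \<in> I" for i
    using that c by (intro nonneg_infsum_le_0D[of "\<lambda>i. (cmod (c i))\<^sup>2"]) (auto simp: l2_def)
  then have "c = (\<lambda>i. 0)" using c by (auto simp: l2_def)
  then show "\<phi> = (\<lambda>\<zeta>. 0)" using c by (simp add: fun_of_zero)
qed

definition basis_fun :: "pants_index \<Rightarrow> complex \<Rightarrow> complex" where
  "basis_fun i = fun_of (\<lambda>j. if j = i then 1 else 0)"

lemma l2_unit: "i \<in> I \<Longrightarrow> l2 (\<lambda>j. if j = i then 1 else 0)"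
proof -
  assume "i \<in> I"
  have "(\<lambda>j. (cmod (if j = i then 1 else 0))\<^sup>2) summable_on {i}" by simp
  then have "(\<lambda>j. (cmod (if j = i then 1 else 0))\<^sup>2) summable_on I"
    by (rule summable_on_cong_neutral[THEN iffD1, rotated -1]) (use \<open>i \<in> I\<close> in auto)
  then show ?thesis using \<open>i \<in> I\<close> by (auto simp: l2_def)
qed

lemma basis_fun_mem: "i \<in> I \<Longrightarrow> basis_fun i \<in> H"
  unfolding basis_fun_def by (intro fun_of_mem l2_unit)

lemma ip_basis_fun:
  assumes "l2 c" "i \<in> I" shows "ip (fun_of c) (basis_fun i) = c i"
proof -
  have "ip (fun_of c) (basis_fun i) = (\<Sum>\<^sub>\<infinity>j\<in>I. c j * cnj (if j = i then 1 else 0))"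
    unfolding basis_fun_def using assms by (simp add: ip_fun_of l2_unit)
  also have "\<dots> = (\<Sum>\<^sub>\<infinity>j\<in>{i}. c j * cnj (if j = i then 1 else 0))"
    using assms by (intro infsum_cong_neutral) auto
  finally show ?thesis by simp
qed

lemma ip_basis_fun_basis_fun: "i \<in> I \<Longrightarrow> j \<in> I \<Longrightarrow> ip (basis_fun i) (basis_fun j) = (if i = j then 1 else 0)"
  using ip_basis_fun[OF l2_unit, of i j] by (simp add: basis_fun_def)

text \<open>The abstract Hilbert space has its basis indexed by natural numbers. Any enumeration
  serves, since \<open>pants_shift\<close> only asks each \<open>e k\<close> to be one of the
  vectors E, F, G.\<close>

definition enum_index :: "nat \<Rightarrow> pants_index" where "enum_index = from_nat_into I"

lemma bij_enum_index: "bij_betw enum_index UNIV I"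
proof -
  have "countable I" by (simp add: indices_eq)
  moreover have "infinite (range E_ix)" by (rule range_inj_infinite) (auto simp: inj_def)
  then have "infinite I" by (simp add: indices_eq)
  ultimately show ?thesis unfolding enum_index_def by (rule bij_betw_from_nat_into)
qed

lemma enum_index_mem: "enum_index k \<in> I"
  using bij_betwE[OF bij_enum_index] by blast

lemma fun_hilbert_space: "fun_hilbert_space H ip (\<lambda>k. basis_fun (enum_index k))"
proof (intro fun_hilbert_space.intro fun_inner_product fun_hilbert_space_axioms.intro)
  show "basis_fun (enum_index k) \<in> H" for k by (intro basis_fun_mem enum_index_mem)
  show "ip (basis_fun (enum_index j)) (basis_fun (enum_index k)) = (if j = k then 1 else 0)" for j k
    using bij_enum_index by (auto simp: ip_basis_fun_basis_fun enum_index_mem bij_betw_def inj_def)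
next
  fix \<phi> assume "\<phi> \<in> H"
  then obtain c where c: "l2 c" "\<phi> = fun_of c" by (metis mem_H_cases)
  have "((\<lambda>k. (cmod (c (enum_index k)))\<^sup>2) has_sum (\<Sum>\<^sub>\<infinity>i\<in>I. (cmod (c i))\<^sup>2)) UNIV"
    unfolding has_sum_reindex_bij_betw[OF bij_enum_index, where f="\<lambda>i. (cmod (c i))\<^sup>2"]
    using c by (intro has_sum_infsum) (simp add: l2_def)
  then show "(\<lambda>k. (cmod (ip \<phi> (basis_fun (enum_index k))))\<^sup>2) sums (hnorm ip \<phi>)\<^sup>2"
    using c by (simp add: ip_basis_fun enum_index_mem norm_fun_of has_sum_imp_sums)
next
  fix c :: "nat \<Rightarrow> complex" assume "summable (\<lambda>k. (cmod (c k))\<^sup>2)"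
  then have "(\<lambda>k. (cmod (c k))\<^sup>2) summable_on UNIV"
    by (subst summable_on_UNIV_nonneg_real_iff) auto
  \<comment> \<open>The given sequence carried back along the enumeration, with the value 0 off
    \<open>I\<close> that \<open>l2\<close> prescribes.\<close>
  define d where "d i = (if i \<in> I then c (inv_into UNIV enum_index i) else 0)" for i
  have d_enum: "d (enum_index k) = c k" for k
    using bij_betw_inv_into_left[OF bij_enum_index] enum_index_mem by (simp add: d_def)
  have "l2 d"
    unfolding l2_def summable_on_reindex_bij_betw[OF bij_enum_index, where f="\<lambda>i. (cmod (d i))\<^sup>2", symmetric]
    using \<open>_ summable_on UNIV\<close> by (simp add: d_enum) (simp add: d_def)
  then show "\<exists>\<phi>\<in>H. \<forall>k. ip \<phi> (basis_fun (enum_index k)) = c k"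
    by (intro bexI[of _ "fun_of d"]) (auto simp: ip_basis_fun enum_index_mem d_enum fun_of_mem)
qed


section \<open>The coordinate operator of the pair of pants\<close>

text \<open>The matrix of z on coefficients. The entry at an index collects everything sent to that
  basis vector, so it reads coefficients one step earlier; \<open>E_ix 0\<close> receives from both
  chains ending at -1. The zero branches keep the family supported on \<open>I\<close>.\<close>

fun shift_coeff :: "(pants_index \<Rightarrow> complex) \<Rightarrow> pants_index \<Rightarrow> complex" where
  "shift_coeff c (E_ix 0) = of_real r1 * c (F_ix (-1)) + of_real r2 * c (G_ix (-1))"
| "shift_coeff c (E_ix (Suc n)) = c (E_ix n)"
| "shift_coeff c (F_ix n) = (if n \<le> - 1 then of_real r1 * c (F_ix (n - 1)) else 0)"
| "shift_coeff c (G_ix n) = (if n \<le> - 1 then of_real r2 * c (G_ix (n - 1)) + of_real a * c (G_ix n) else 0)"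

text \<open>
  \<open>shift_coeff c i\<close> is a combination of \<open>c (s1 i)\<close> and \<open>c (s2 i)\<close> with weights in \<open>[0, 1]\<close>, where
  \<open>s1\<close> and \<open>s2\<close> are bijections of the index set. This bounds the norm of \<open>z\<close> by 2.
\<close>

fun s1 :: "pants_index \<Rightarrow> pants_index" where
  "s1 (E_ix 0) = F_ix (-1)" | "s1 (E_ix (Suc n)) = E_ix n" | "s1 (F_ix n) = F_ix (n - 1)"
| "s1 (G_ix n) = G_ix n"

fun s2 :: "pants_index \<Rightarrow> pants_index" where
  "s2 (E_ix 0) = G_ix (-1)" | "s2 (E_ix (Suc n)) = E_ix n" | "s2 (F_ix n) = F_ix n"
| "s2 (G_ix n) = G_ix (n - 1)"

lemma mem_indices_iff: "E_ix n \<in> I" "F_ix m \<in> I \<longleftrightarrow> m \<le> -1" "G_ix m \<in> I \<longleftrightarrow> m \<le> -1"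
  by (auto simp: pants_indices_def)

lemma bij_s1: "bij_betw s1 I I"
proof (rule bij_betwI[where g="\<lambda>i. case i of E_ix n \<Rightarrow> E_ix (Suc n)
    | F_ix n \<Rightarrow> if n = -1 then E_ix 0 else F_ix (n + 1) | G_ix n \<Rightarrow> G_ix n"])
  show "s1 \<in> I \<rightarrow> I"
  proof
    fix i assume "i \<in> I" then show "s1 i \<in> I"
      by (cases i rule: s1.cases) (auto simp: mem_indices_iff)
  qed
next
  fix i assume "i \<in> I"
  then show "(case s1 i of E_ix n \<Rightarrow> E_ix (Suc n)
    | F_ix n \<Rightarrow> if n = -1 then E_ix 0 else F_ix (n + 1) | G_ix n \<Rightarrow> G_ix n) = i"
    by (cases i rule: s1.cases) (auto simp: mem_indices_iff)
qed (auto simp: mem_indices_iff split: pants_index.splits)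

lemma bij_s2: "bij_betw s2 I I"
proof (rule bij_betwI[where g="\<lambda>i. case i of E_ix n \<Rightarrow> E_ix (Suc n) | F_ix n \<Rightarrow> F_ix n
    | G_ix n \<Rightarrow> if n = -1 then E_ix 0 else G_ix (n + 1)"])
  show "s2 \<in> I \<rightarrow> I"
  proof
    fix i assume "i \<in> I" then show "s2 i \<in> I"
      by (cases i rule: s2.cases) (auto simp: mem_indices_iff)
  qed
next
  fix i assume "i \<in> I"
  then show "(case s2 i of E_ix n \<Rightarrow> E_ix (Suc n) | F_ix n \<Rightarrow> F_ix n
    | G_ix n \<Rightarrow> if n = -1 then E_ix 0 else G_ix (n + 1)) = i"
    by (cases i rule: s2.cases) (auto simp: mem_indices_iff)
qed (auto simp: mem_indices_iff split: pants_index.splits)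

lemma shift_coeff_sq_le:
  assumes "i \<in> I"
  shows "(cmod (shift_coeff c i))\<^sup>2 \<le> 2 * (cmod (c (s1 i)))\<^sup>2 + 2 * (cmod (c (s2 i)))\<^sup>2"
proof -
  have contr: "cmod (of_real t * x) \<le> cmod x" if "0 \<le> t" "t \<le> 1" for t x
    using that by (simp add: norm_mult mult_left_le_one_le)
  have sq: "(cmod (x + y))\<^sup>2 \<le> 2 * (cmod u)\<^sup>2 + 2 * (cmod v)\<^sup>2"
    if "cmod x \<le> cmod u" "cmod y \<le> cmod v" for x y u v
    using cmod_add_sq_le[of x y] power_mono[OF that(1) norm_ge_zero, of 2]
      power_mono[OF that(2) norm_ge_zero, of 2] by linarith
  have le1: "0 \<le> r1" "r1 \<le> 1" "0 \<le> r2" "r2 \<le> 1" "0 \<le> a" "a \<le> 1" using params by auto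
  show ?thesis
  proof (cases i rule: s1.cases)
    case 1
    then show ?thesis using sq[OF contr contr] le1 by simp
  next
    case (2 n)
    then show ?thesis by simp
  next
    case (3 n)
    then show ?thesis using assms le1 sq[OF contr[of r1 "c (F_ix (n - 1))"], of 0 "c (F_ix n)"]
      by (simp add: mem_indices_iff)
  next
    case (4 n)
    then show ?thesis using assms sq[OF contr contr, of a r2 "c (G_ix n)" "c (G_ix (n - 1))"] le1
      by (simp add: mem_indices_iff add.commute)
  qed
qed

text \<open>Reindexing by \<open>s1\<close> and by \<open>s2\<close> preserves the total sum, so the
  two weights 2 add up to 4, the square of the norm bound 2 for z.\<close>

lemma l2_shift_coeff:
  assumes "l2 c"
  shows "l2 (shift_coeff c)"
    and "(\<Sum>\<^sub>\<infinity>i\<in>I. (cmod (shift_coeff c i))\<^sup>2) \<le> 4 * (\<Sum>\<^sub>\<infinity>i\<in>I. (cmod (c i))\<^sup>2)"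
proof -
  let ?f = "\<lambda>i. (cmod (c i))\<^sup>2"
  have sm: "?f summable_on I" using assms by (simp add: l2_def)
  have sm12: "(\<lambda>i. 2 * ?f (s1 i)) summable_on I" "(\<lambda>i. 2 * ?f (s2 i)) summable_on I"
    using sm summable_on_reindex_bij_betw[OF bij_s1, of ?f] summable_on_reindex_bij_betw[OF bij_s2, of ?f]
    by (auto intro!: summable_on_cmult_right)
  have sm': "(\<lambda>i. 2 * ?f (s1 i) + 2 * ?f (s2 i)) summable_on I"
    using sm12 by (rule summable_on_add)
  have smz: "(\<lambda>i. (cmod (shift_coeff c i))\<^sup>2) summable_on I"
    by (rule summable_on_comparison_test[OF sm']) (auto intro: shift_coeff_sq_le)
  have "shift_coeff c i = 0" if "i \<notin> I" for i
    using that by (cases i) (auto simp: mem_indices_iff)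
  then show "l2 (shift_coeff c)" using smz by (simp add: l2_def)
  have "(\<Sum>\<^sub>\<infinity>i\<in>I. (cmod (shift_coeff c i))\<^sup>2) \<le> (\<Sum>\<^sub>\<infinity>i\<in>I. 2 * ?f (s1 i) + 2 * ?f (s2 i))"
    by (intro infsum_mono smz sm' shift_coeff_sq_le)
  also have "\<dots> = (\<Sum>\<^sub>\<infinity>i\<in>I. 2 * ?f (s1 i)) + (\<Sum>\<^sub>\<infinity>i\<in>I. 2 * ?f (s2 i))"
    using sm12 by (rule infsum_add)
  also have "\<dots> = (\<Sum>\<^sub>\<infinity>i\<in>I. 2 * ?f i) + (\<Sum>\<^sub>\<infinity>i\<in>I. 2 * ?f i)"
    using infsum_reindex_bij_betw[OF bij_s1, of "\<lambda>i. 2 * ?f i"]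
      infsum_reindex_bij_betw[OF bij_s2, of "\<lambda>i. 2 * ?f i"] by simp
  also have "\<dots> = 4 * (\<Sum>\<^sub>\<infinity>i\<in>I. ?f i)"
    using sm by (simp add: infsum_cmult_right)
  finally show "(\<Sum>\<^sub>\<infinity>i\<in>I. (cmod (shift_coeff c i))\<^sup>2) \<le> 4 * (\<Sum>\<^sub>\<infinity>i\<in>I. (cmod (c i))\<^sup>2)" .
qed

lemma shift_coeff_FG:
  "shift_coeff c (E_ix 0) = of_real r1 * c (Fi 0) + of_real r2 * c (Gi 0)"
  "shift_coeff c (Fi n) = of_real r1 * c (Fi (Suc n))"
  "shift_coeff c (Gi n) = of_real r2 * c (Gi (Suc n)) + of_real a * c (Gi n)"
proof -
  have "- 1 - int n - 1 = - 1 - int (Suc n)" by simp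
  then show "shift_coeff c (Fi n) = of_real r1 * c (Fi (Suc n))"
    "shift_coeff c (Gi n) = of_real r2 * c (Gi (Suc n)) + of_real a * c (Gi n)"
    by (simp_all only: Fi_def Gi_def shift_coeff.simps) simp_all
qed (simp add: Fi_def Gi_def)

text \<open>With w1 = r1 / \<zeta> and w2 = r2 / (\<zeta> - a), the relations \<zeta> w1 = r1 and
  \<zeta> w2 = r2 + a w2 remove one power from the \<open>F\<close> and \<open>G\<close> series. The
  leading coefficients split off in this way are the new constant term of the \<open>E\<close>
  series.\<close>

lemma series_shift_coeff:
  assumes c: "l2 c" and \<zeta>: "\<zeta> \<in> S"
  shows "series (shift_coeff c) \<zeta> = \<zeta> * series c \<zeta>"
proof -
  obtain M where M: "\<And>i. cmod (c i) \<le> M" using l2_bounded[OF c] by metis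
  obtain M' where M': "\<And>i. cmod (shift_coeff c i) \<le> M'" using l2_bounded[OF l2_shift_coeff(1)[OF c]] by metis
  note D = interior_pantsD[OF \<zeta>]
  define w1 where "w1 = of_real r1 / \<zeta>"
  define w2 where "w2 = of_real r2 / (\<zeta> - of_real a)"
  have w: "cmod w1 < 1" "cmod w2 < 1" using D by (simp_all add: w1_def w2_def)
  define P where "P f = psum (\<lambda>n. c (f n))" for f :: "nat \<Rightarrow> pants_index"
  have E: "psum (\<lambda>n. shift_coeff c (E_ix n)) \<zeta>
      = of_real r1 * c (Fi 0) + of_real r2 * c (Gi 0) + \<zeta> * P E_ix \<zeta>"
    using psum_Suc[of "\<lambda>n. shift_coeff c (E_ix n)", OF M' D(1)] by (simp only: shift_coeff_FG shift_coeff.simps P_def)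
  have F: "psum (\<lambda>n. shift_coeff c (Fi n)) w1 = of_real r1 * P (\<lambda>n. Fi (Suc n)) w1"
    using psum_scale[of "\<lambda>n. c (Fi (Suc n))", OF M w(1)] by (simp only: shift_coeff_FG P_def)
  have F': "P Fi w1 = c (Fi 0) + w1 * P (\<lambda>n. Fi (Suc n)) w1"
    using psum_Suc[of "\<lambda>n. c (Fi n)", OF M w(1)] by (simp only: P_def)
  have bd: "cmod (of_real t * c i) \<le> \<bar>t\<bar> * M" for t i
    using M by (simp add: norm_mult mult_left_mono)
  have G: "psum (\<lambda>n. shift_coeff c (Gi n)) w2 = of_real r2 * P (\<lambda>n. Gi (Suc n)) w2 + of_real a * P Gi w2"
    using psum_add[of "\<lambda>n. of_real r2 * c (Gi (Suc n))" _ "\<lambda>n. of_real a * c (Gi n)", OF bd bd w(2)]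
      psum_scale[of "\<lambda>n. c (Gi (Suc n))", OF M w(2)] psum_scale[of "\<lambda>n. c (Gi n)", OF M w(2)]
    by (simp only: shift_coeff_FG P_def)
  have G': "P Gi w2 = c (Gi 0) + w2 * P (\<lambda>n. Gi (Suc n)) w2"
    using psum_Suc[of "\<lambda>n. c (Gi n)", OF M w(2)] by (simp only: P_def)
  have z1: "\<zeta> * w1 = of_real r1" using D by (simp add: w1_def)
  have "(\<zeta> - of_real a) * w2 = of_real r2" using D by (simp add: w2_def)
  then have z2: "\<zeta> * w2 = of_real r2 + of_real a * w2" by (simp add: algebra_simps)
  have "\<zeta> * series c \<zeta> = \<zeta> * P E_ix \<zeta> + (\<zeta> * w1) * P Fi w1 + (\<zeta> * w2) * P Gi w2"
    unfolding series_def w1_def[symmetric] w2_def[symmetric] P_def by (simp add: algebra_simps)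
  also have "\<dots> = \<zeta> * P E_ix \<zeta> + of_real r1 * (c (Fi 0) + w1 * P (\<lambda>n. Fi (Suc n)) w1)
      + of_real r2 * (c (Gi 0) + w2 * P (\<lambda>n. Gi (Suc n)) w2) + of_real a * w2 * P Gi w2"
    unfolding z1 z2 F'[symmetric] G'[symmetric] by (simp add: algebra_simps)
  also have "\<dots> = series (shift_coeff c) \<zeta>"
    unfolding series_def w1_def[symmetric] w2_def[symmetric] E F G by (simp add: algebra_simps)
  finally show ?thesis by simp
qed

section \<open>Boundedness of the coordinate operator and its values on the basis\<close>

abbreviation z :: "complex op" where "z \<equiv> pants_z a r1 r2"

lemma z_fun_of: "l2 c \<Longrightarrow> z (fun_of c) = fun_of (shift_coeff c)"
  using fun_of_mem[of c] by (auto simp: pants_z_def fun_of_def series_shift_coeff fun_eq_iff)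

lemma z_bounded: "z \<in> bounded_ops H ip"
proof -
  interpret fun_inner_product H ip by (rule fun_inner_product)
  show ?thesis
  proof (rule bounded_opsI[where M=2])
    show "z \<in> extensional H" by (simp add: pants_z_def)
  next
    fix \<phi> assume \<phi>: "\<phi> \<in> H"
    then obtain c where c: "l2 c" "\<phi> = fun_of c" by (metis mem_H_cases)
    show zm: "z \<phi> \<in> H" using c by (simp add: z_fun_of l2_shift_coeff fun_of_mem)
    have "(N (z \<phi>))\<^sup>2 \<le> (2 * N \<phi>)\<^sup>2"
      using c l2_shift_coeff(2)[of c] by (simp add: z_fun_of norm_fun_of l2_shift_coeff(1) power_mult_distrib)
    then show "N (z \<phi>) \<le> 2 * N \<phi>"
      by (rule power2_le_imp_le) (use norm_nonneg[OF \<phi>] in simp)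
    show "z (\<lambda>x. t * \<phi> x) = (\<lambda>x. t * z \<phi> x)" for t
      using \<phi> by (simp add: pants_z_def scale_mem mult_ac)
    fix \<psi> assume "\<psi> \<in> H"
    then show "z (\<lambda>x. \<phi> x + \<psi> x) = (\<lambda>x. z \<phi> x + z \<psi> x)"
      using \<phi> by (simp add: pants_z_def add_mem distrib_left)
  qed
qed

lemma z_basis_fun:
  "z (basis_fun (E_ix n)) = basis_fun (E_ix (Suc n))"
  "z (basis_fun (Fi 0)) = (\<lambda>x. of_real r1 * basis_fun (E_ix 0) x)"
  "z (basis_fun (Fi (Suc n))) = (\<lambda>x. of_real r1 * basis_fun (Fi n) x)"
  "z (basis_fun (Gi 0)) = (\<lambda>x. of_real r2 * basis_fun (E_ix 0) x + of_real a * basis_fun (Gi 0) x)"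
  "z (basis_fun (Gi (Suc n))) = (\<lambda>x. of_real r2 * basis_fun (Gi n) x + of_real a * basis_fun (Gi (Suc n)) x)"
proof -
  let ?u = "\<lambda>i j. if j = i then 1 else 0 :: complex"
  have "shift_coeff (?u (E_ix n)) = ?u (E_ix (Suc n))"
    "shift_coeff (?u (Fi 0)) = (\<lambda>j. of_real r1 * ?u (E_ix 0) j)"
    "shift_coeff (?u (Fi (Suc n))) = (\<lambda>j. of_real r1 * ?u (Fi n) j)"
    "shift_coeff (?u (Gi 0)) = (\<lambda>j. of_real r2 * ?u (E_ix 0) j + of_real a * ?u (Gi 0) j)"
    "shift_coeff (?u (Gi (Suc n))) = (\<lambda>j. of_real r2 * ?u (Gi n) j + of_real a * ?u (Gi (Suc n)) j)"
    by (rule ext, case_tac j rule: s1.cases; force simp: Fi_def Gi_def)+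
  note shift = this
  have "z (basis_fun i) = fun_of (shift_coeff (?u i))" if "i \<in> I" for i
    using that by (simp add: basis_fun_def z_fun_of l2_unit)
  then show "z (basis_fun (E_ix n)) = basis_fun (E_ix (Suc n))"
    "z (basis_fun (Fi 0)) = (\<lambda>x. of_real r1 * basis_fun (E_ix 0) x)"
    "z (basis_fun (Fi (Suc n))) = (\<lambda>x. of_real r1 * basis_fun (Fi n) x)"
    "z (basis_fun (Gi 0)) = (\<lambda>x. of_real r2 * basis_fun (E_ix 0) x + of_real a * basis_fun (Gi 0) x)"
    "z (basis_fun (Gi (Suc n))) = (\<lambda>x. of_real r2 * basis_fun (Gi n) x + of_real a * basis_fun (Gi (Suc n)) x)"
    by (simp_all only: shift index_mem fun_of_add fun_of_scale l2_scale l2_unit basis_fun_def)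
qed

lemma pants_shift:
  "pants_shift H ip (\<lambda>k. basis_fun (enum_index k)) z a r1 r2 (\<lambda>n. basis_fun (E_ix n)) (\<lambda>n. basis_fun (Fi n)) (\<lambda>n. basis_fun (Gi n))"
proof (intro pants_shift.intro fun_hilbert_space pants_shift_axioms.intro z_bounded z_basis_fun)
  \<comment> \<open>Both radii are below 1, so their squares are at most r1 and r2, whose sum is
    below a and hence below 1.\<close>
  show "r1\<^sup>2 + r2\<^sup>2 < 1"
  proof -
    have "r1 * r1 \<le> r1 * 1" "r2 * r2 \<le> r2 * 1" using params by (intro mult_left_mono; simp)+
    then show ?thesis using params unfolding power2_eq_square by linarith
  qed
  show "basis_fun (enum_index k) \<in> range (\<lambda>n. basis_fun (E_ix n)) \<union> range (\<lambda>n. basis_fun (Fi n)) \<union> range (\<lambda>n. basis_fun (Gi n))" for k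
    using enum_index_mem[of k] by (auto elim: index_cases)
qed (use params in \<open>simp_all add: basis_fun_mem ip_basis_fun_basis_fun\<close>)

end

theorem theorem3p10:
  fixes a r1 r2 :: real
  assumes "r1 > 0" and "r2 > 0" and "0 < a" and "a < 1"
    and "a + r2 < 1" and "r1 + r2 < a"
  shows "commutator_ideal (pants_H a r1 r2) (pants_ip a r1 r2)
           (cstar_generated (pants_H a r1 r2) (pants_ip a r1 r2) (pants_z a r1 r2))
         = compact_ops (pants_H a r1 r2) (pants_ip a r1 r2)"
proof -
  interpret pants_params a r1 r2 by unfold_locales (use assms in auto)
  show ?thesis by (rule pants_shift.commutator_ideal_eq_compact[OF pants_shift])
qed

end
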